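(* Let $S_1\subseteq\mathbb{R}[\underline x]$ and $S_2\subseteq\mathscr{M}$ with $S_2$ finite. (1) For $f\in\mathscr{M}[\underline x]$ the following are equivalent: (i) $f(\mu,\underline X)\ge0$ for all $(\mu,\underline X)\in\mathbf{K}(S_1,S_2)\times K(S_1)$; (ii) for every $\varepsilon>0$ there exists $r\in\mathbb{N}$ such that $f+\varepsilon(\Phi_r+\Psi_r)\in\operatorname{QM}(S_1,S_2)$. (2) For $f\in\mathscr{M}$ the following are equivalent: (i') $f(\mu)\ge0$ for all $\mu\in\mathbf{K}(S_1,S_2)$; (ii') for every $\varepsilon>0$ there exists $r\in\mathbb{N}$ such that $f+\varepsilon(1+\Psi_r)\in\operatorname{qm}(S_1,S_2)$.
   Context: Let $\mathbb{R}[\underline x]=\mathbb{R}[x_1,\dots,x_n]$. Let $\mathscr{M}=\mathbb{R}[\mathtt{m}_{i_1,\dots,i_n}\colon (i_1,\dots,i_n)\in\mathbb{N}_0^n]$ be the polynomial ring in countably many indeterminates, with $\mathtt{m}_{0,\dots,0}:=1$, and $\mathscr{M}[\underline x]=\mathscr{M}\otimes_{\mathbb{R}}\mathbb{R}[\underline x]$. Let $\mathtt{m}:\mathscr{M}[\underline x]\to\mathscr{M}$ be the unique $\mathscr{M}$-linear map with $\mathtt{m}(x_1^{i_1}\cdots x_n^{i_n})=\mathtt{m}_{i_1,\dots,i_n}$. A quadratic module in a commutative unital ring $A$ is a subset $M$ with $1\in M$, $M+M\subseteq M$, $a^2M\subseteq M$ for $a\in A$. $\operatorname{qm}(S_1,S_2)$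 is the quadratic module of $\mathscr{M}$ generated by $\{\mathtt{m}(f^2s)\colon s\in\{1\}\cup S_1,\ f\in\mathscr{M}[\underline x]\}\cup S_2$, and $\operatorname{QM}(S_1,S_2)$ is the quadratic module of $\mathscr{M}[\underline x]$ generated by $S_1\cup\{\mathtt{m}(f^2s)\colon s\in\{1\}\cup S_1,\ f\in\mathscr{M}[\underline x]\}\cup S_2$. For closed $K\subseteq\mathbb{R}^n$, $\mathbf{P}(K)$ is the set of Borel probability measures on $\mathbb{R}^n$ supported on $K$ with all moments $\int x_j^{2k}\,d\mu$ finite. For $(\mu,\underline X)\in\mathbf{P}(\mathbb{R}^n)\times\mathbb{R}^n$, $f(\mu,\underline X)$ is the image of $f$ under the homomorphism $\mathtt{m}_{i_1,\dots,i_n}\mapsto\int x_1^{i_1}\cdots x_n^{i_n}d\mu$, $x_j\mapsto X_j$; for $f\in\mathscr{M}$ write $f(\mu)$. $K(S_1)=\{\underline X\in\mathbb{R}^n\colon p(\underline X)\ge0\ \forall p\in S_1\}$, $\mathbf{K}(S_1,S_2)=\{\mu\in\mathbf{P}(K(S_1))\colon s(\mu)\ge0\ \forall s\in S_2\}$. For $r\in\mathbb{N}$, $\Phi_r=\sum_{j=1}^n\sum_{k=0}^r\frac{x_j^{2k}}{k!}$ and $\Psi_r=\sum_{j=1}^n\sum_{k,\ell\in\mathbb{N},\,k\ell\le r}\frac{\mathtt{m}(x_j^{2k})^\ell}{(k!)^\ell\,\ell!}$. *)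

theory Defs
  imports "HOL-Probability.Probability" "HOL-Library.Poly_Mapping"
begin

(* Nonzero multi-indices alpha in N_0^n (n = CARD('n)); m_0 is identified with 1,
   so only nonzero indices give indeterminates m_alpha. *)
typedef 'n nzidx = "{a :: 'n \<Rightarrow> nat. a \<noteq> (\<lambda>_. 0)}" morphisms idx Abs_nzidx
  by (rule exI[of _ "\<lambda>_. 1"]) (simp add: fun_eq_iff)

(* indeterminates of M[x]: x_j (j :: 'n) and m_alpha (alpha nonzero) *)
datatype 'n var = Xv 'n | Mv "'n nzidx"

type_synonym 'n mpoly = "('n var \<Rightarrow>\<^sub>0 nat) \<Rightarrow>\<^sub>0 real"

definition pvar :: "'n var \<Rightarrow> 'n mpoly" where
  "pvar v = Poly_Mapping.single (Poly_Mapping.single v 1) 1"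

definition pconst :: "real \<Rightarrow> 'n mpoly" where
  "pconst c = Poly_Mapping.single 0 c"

definition peval :: "('n var \<Rightarrow> real) \<Rightarrow> 'n mpoly \<Rightarrow> real" where
  "peval \<sigma> p = (\<Sum>mo\<in>Poly_Mapping.keys p. Poly_Mapping.lookup p mo * (\<Prod>v\<in>Poly_Mapping.keys mo. \<sigma> v ^ Poly_Mapping.lookup mo v))"

definition inM :: "'n mpoly \<Rightarrow> bool" where
  "inM p \<longleftrightarrow> (\<forall>mo\<in>Poly_Mapping.keys p. \<forall>j. Poly_Mapping.lookup mo (Xv j) = 0)"

definition inRx :: "'n mpoly \<Rightarrow> bool" where
  "inRx p \<longleftrightarrow> (\<forall>mo\<in>Poly_Mapping.keys p. \<forall>a. Poly_Mapping.lookup mo (Mv a) = 0)"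

definition mvar :: "('n \<Rightarrow> nat) \<Rightarrow> 'n mpoly" where
  "mvar \<alpha> = (if \<alpha> = (\<lambda>_. 0) then 1 else pvar (Mv (Abs_nzidx \<alpha>)))"

definition xexp :: "('n var \<Rightarrow>\<^sub>0 nat) \<Rightarrow> 'n \<Rightarrow> nat" where
  "xexp mn = (\<lambda>j. Poly_Mapping.lookup mn (Xv j))"

definition mpart :: "('n var \<Rightarrow>\<^sub>0 nat) \<Rightarrow> 'n mpoly" where
  "mpart mn = (\<Prod>v\<in>Poly_Mapping.keys mn. (case v of Xv _ \<Rightarrow> 1 | Mv _ \<Rightarrow> pvar v ^ Poly_Mapping.lookup mn v))"

(* the M-linear map m : M[x] -> M with m(x^alpha) = m_alpha *)
definition mmap :: "'n mpoly \<Rightarrow> 'n mpoly" where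
  "mmap p = (\<Sum>mn\<in>Poly_Mapping.keys p. pconst (Poly_Mapping.lookup p mn) * mpart mn * mvar (xexp mn))"

(* quadratic module of a ring A (given as a subset closed under ring operations)
   generated by G *)
inductive_set qmod :: "'a::comm_ring_1 set \<Rightarrow> 'a set \<Rightarrow> 'a set" for A G where
  one: "1 \<in> qmod A G"
| gen: "g \<in> G \<Longrightarrow> g \<in> qmod A G"
| add: "x \<in> qmod A G \<Longrightarrow> y \<in> qmod A G \<Longrightarrow> x + y \<in> qmod A G"
| sq:  "a \<in> A \<Longrightarrow> x \<in> qmod A G \<Longrightarrow> a ^ 2 * x \<in> qmod A G"

definition mgens :: "'n mpoly set \<Rightarrow> 'n mpoly set" where
  "mgens S1 = {mmap (f ^ 2 * s) | f s. s \<in> insert 1 S1}"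

definition qm :: "'n mpoly set \<Rightarrow> 'n mpoly set \<Rightarrow> 'n mpoly set" where
  "qm S1 S2 = qmod {p. inM p} (mgens S1 \<union> S2)"

definition QM :: "'n mpoly set \<Rightarrow> 'n mpoly set \<Rightarrow> 'n mpoly set" where
  "QM S1 S2 = qmod UNIV (S1 \<union> mgens S1 \<union> S2)"

definition Pmeas :: "(real ^ 'n) set \<Rightarrow> (real ^ 'n) measure set" where
  "Pmeas K = {\<mu>. prob_space \<mu> \<and> sets \<mu> = sets borel \<and> emeasure \<mu> (UNIV - K) = 0 \<and>
     (\<forall>j k. integrable \<mu> (\<lambda>x. (x $ j) ^ (2 * k)))}"

definition moment :: "(real ^ 'n) measure \<Rightarrow> ('n \<Rightarrow> nat) \<Rightarrow> real" where
  "moment \<mu> \<alpha> = (\<integral>x. (\<Prod>j\<in>UNIV. (x $ j) ^ \<alpha> j) \<partial>\<mu>)"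

definition evalMX :: "(real ^ 'n) measure \<Rightarrow> real ^ 'n \<Rightarrow> 'n mpoly \<Rightarrow> real" where
  "evalMX \<mu> X p = peval (\<lambda>v. case v of Xv j \<Rightarrow> X $ j | Mv a \<Rightarrow> moment \<mu> (idx a)) p"

definition evalM :: "(real ^ 'n) measure \<Rightarrow> 'n mpoly \<Rightarrow> real" where
  "evalM \<mu> p = evalMX \<mu> 0 p"

definition evalX :: "real ^ 'n \<Rightarrow> 'n mpoly \<Rightarrow> real" where
  "evalX X p = peval (\<lambda>v. case v of Xv j \<Rightarrow> X $ j | Mv _ \<Rightarrow> 0) p"

definition Kset :: "'n mpoly set \<Rightarrow> (real ^ 'n) set" where
  "Kset S1 = {X. \<forall>p\<in>S1. evalX X p \<ge> 0}"

definition KK :: "'n mpoly set \<Rightarrow> 'n mpoly set \<Rightarrow> (real ^ 'n) measure set" where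
  "KK S1 S2 = {\<mu> \<in> Pmeas (Kset S1). \<forall>s\<in>S2. evalM \<mu> s \<ge> 0}"

definition Phi :: "nat \<Rightarrow> 'n::finite mpoly" where
  "Phi r = (\<Sum>j\<in>UNIV. \<Sum>k=0..r. pconst (1 / fact k) * pvar (Xv j) ^ (2 * k))"

definition Psi :: "nat \<Rightarrow> 'n::finite mpoly" where
  "Psi r = (\<Sum>j\<in>UNIV. \<Sum>(k, l)\<in>{(k, l). 1 \<le> k \<and> 1 \<le> l \<and> k * l \<le> r}.
      pconst (1 / (fact k ^ l * fact l)) * mmap (pvar (Xv j) ^ (2 * k)) ^ l)"

end

theory Submission
  imports Defs "HOL-Analysis.Finite_Function_Topology"
begin

text \<open>If \<open>f + \<epsilon> * (Phi r + Psi r)\<close> lies outside the quadratic module for all \<open>r\<close>, then a Hahn-Banach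
  argument yields a linear functional \<open>L\<close>, nonnegative on the quadratic module and bounded on all
  \<open>Phi r + Psi r\<close>, with \<open>L f < 0\<close>, and \<open>L\<close> can be chosen to span an extreme ray. The bounds make
  \<open>L (p * sin (t * v))\<close>, defined by its power series, converge for every variable \<open>v\<close> and small \<open>t\<close>.
  As \<open>1 \<plusminus> sin (t * v) = (cos (t * v / 2) \<plusminus> sin (t * v / 2))\<^sup>2\<close>, the functionals
  \<open>p \<mapsto> L (p * (1 \<plusminus> sin (t * v)))\<close> are again nonnegative on the quadratic module. Their sum is
  \<open>2 * L\<close>, so by extremality they are multiples of \<open>L\<close>, and differentiating at \<open>t = 0\<close> shows that
  \<open>L\<close> is, up to a factor, a ring homomorphism \<open>\<phi>\<close>. The same result applied to \<open>S1\<close> alone shows that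
  \<open>p \<mapsto> \<phi> (m p)\<close> is nonnegative on polynomials that are nonnegative on \<open>Kset S1\<close>. Since \<open>f\<close> and the
  finitely many elements of \<open>S2\<close> involve finitely many moments, a Tchakaloff-type argument provides a
  finitely supported measure on \<open>Kset S1\<close> with these moments, at which \<open>f\<close> is negative.

  For the converse the given measure is first replaced by a finitely supported one with the same
  relevant moments; at such a measure \<open>Psi r\<close> is bounded in \<open>r\<close>. The second equivalence
  is obtained by adjoining \<open>\<plusminus> x j\<close> to the generators and setting \<open>x = 0\<close>.\<close>

section \<open>Extreme functionals below a sublinear functional\<close>

text \<open>The quadratic module need not be Archimedean: the variables can be unbounded modulo it,
  and multiplication by a variable need not produce a functional dominated by \<open>L\<close>. The
  sine is used because it is bounded while its derivative at 0 recovers the variable. The factorial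
  coefficients of the weights force \<open>L (v ^ (2 * k))\<close> to be of order at most
  \<open>c ^ k * fact (2 * k)\<close> for each variable \<open>v\<close>; for a moment variable this
  goes through \<open>(m p)\<^sup>2 \<le> m (p\<^sup>2)\<close>. This order is what gives the sine
  series a positive radius of convergence. No representing measure for \<open>L\<close> is
  constructed: extremality takes its place. The character yields numbers \<tau> for the moment
  variables that are not shown to be the moments of one measure, but finitely many constraints see
  only finitely many of them. Boundedness of \<phi> on the weights is used once more for the
  positivity of \<open>\<phi> (m p)\<close>: modulo the module, \<open>m (Phi r)\<close> is at most
  \<open>n + Psi r\<close>, so replacing \<open>p\<close> by \<open>p + \<delta> * Phi r\<close>
  costs a multiple of \<delta> that does not depend on \<open>r\<close>.\<close>

definition sublinear :: "('a::real_vector \<Rightarrow> real) \<Rightarrow> bool" where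
  "sublinear q \<longleftrightarrow> (\<forall>x y. q (x + y) \<le> q x + q y) \<and> (\<forall>c\<ge>0. \<forall>x. q (c *\<^sub>R x) = c * q x)"

lemma sublinear_add: "sublinear q \<Longrightarrow> q (x + y) \<le> q x + q y"
  and sublinear_scale: "sublinear q \<Longrightarrow> c \<ge> 0 \<Longrightarrow> q (c *\<^sub>R x) = c * q x"
  by (auto simp: sublinear_def)

lemma sublinear_0: "sublinear q \<Longrightarrow> q 0 = 0"
  using sublinear_scale[of q 0 0] by simp

lemma sublinear_minus: "sublinear q \<Longrightarrow> - q (- x) \<le> q x"
  using sublinear_add[of q x "- x"] sublinear_0[of q] by simp

text \<open>The largest sublinear minorant of \<open>q\<close> that agrees with \<open>q\<close> at \<open>a\<close> and is linear on the
  line spanned by \<open>a\<close>.\<close>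
definition slide :: "('a::real_vector \<Rightarrow> real) \<Rightarrow> 'a \<Rightarrow> 'a \<Rightarrow> real" where
  "slide q a x = (INF t\<in>{0..}. q (x + t *\<^sub>R a) - t * q a)"

lemma slide_bdd:
  assumes "sublinear q"
  shows "bdd_below ((\<lambda>t. q (x + t *\<^sub>R a) - t * q a) ` {0..})"
proof (rule bdd_belowI2)
  fix t :: real assume "t \<in> {0..}"
  then have "t * q a = q ((x + t *\<^sub>R a) + (- x))"
    using sublinear_scale[OF assms, of t a] by simp
  also have "\<dots> \<le> q (x + t *\<^sub>R a) + q (- x)" by (rule sublinear_add[OF assms])
  finally show "- q (- x) \<le> q (x + t *\<^sub>R a) - t * q a" by simp
qed

lemma slide_le:
  assumes "sublinear q" "t \<ge> 0"
  shows "slide q a x \<le> q (x + t *\<^sub>R a) - t * q a"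
  unfolding slide_def using assms by (intro cINF_lower slide_bdd) auto

lemma slide_greatest:
  assumes "\<And>t. t \<ge> 0 \<Longrightarrow> m \<le> q (x + t *\<^sub>R a) - t * q a"
  shows "m \<le> slide q a x"
  unfolding slide_def using assms by (intro cINF_greatest) auto

lemma slide_le_self: "sublinear q \<Longrightarrow> slide q a x \<le> q x"
  using slide_le[of q 0 a x] by simp

lemma slide_neg: "sublinear q \<Longrightarrow> slide q a (- a) \<le> - q a"
  using slide_le[of q 1 a "- a"] by (simp add: sublinear_0)

lemma sublinear_slide:
  assumes q: "sublinear q"
  shows "sublinear (slide q a)"
  unfolding sublinear_def
proof (intro conjI allI impI)
  fix x y
  have *: "slide q a (x + y) \<le> (q (x + s *\<^sub>R a) - s * q a) + (q (y + t *\<^sub>R a) - t * q a)"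
    if "s \<ge> 0" "t \<ge> 0" for s t
  proof -
    have "slide q a (x + y) \<le> q (x + y + (s + t) *\<^sub>R a) - (s + t) * q a"
      using that by (intro slide_le[OF q]) auto
    also have "q (x + y + (s + t) *\<^sub>R a) \<le> q (x + s *\<^sub>R a) + q (y + t *\<^sub>R a)"
      using sublinear_add[OF q, of "x + s *\<^sub>R a" "y + t *\<^sub>R a"] by (simp add: algebra_simps)
    finally show ?thesis by (simp add: algebra_simps)
  qed
  have "slide q a (x + y) - (q (y + t *\<^sub>R a) - t * q a) \<le> slide q a x" if "t \<ge> 0" for t
    using *[OF _ that] by (intro slide_greatest) (auto simp: algebra_simps)
  then have "slide q a (x + y) - slide q a x \<le> slide q a y"
    by (intro slide_greatest) (auto simp: algebra_simps)
  then show "slide q a (x + y) \<le> slide q a x + slide q a y" by simp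
next
  have le: "slide q a (c *\<^sub>R x) \<le> c * slide q a x" if c: "c > 0" for c x
  proof -
    have "slide q a (c *\<^sub>R x) / c \<le> slide q a x"
    proof (rule slide_greatest)
      fix t :: real assume t: "t \<ge> 0"
      have "slide q a (c *\<^sub>R x) \<le> q (c *\<^sub>R x + (c * t) *\<^sub>R a) - (c * t) * q a"
        using t c by (intro slide_le[OF q]) auto
      also have "c *\<^sub>R x + (c * t) *\<^sub>R a = c *\<^sub>R (x + t *\<^sub>R a)" by (simp add: algebra_simps)
      finally show "slide q a (c *\<^sub>R x) / c \<le> q (x + t *\<^sub>R a) - t * q a"
        using c sublinear_scale[OF q, of c "x + t *\<^sub>R a"] by (simp add: field_simps)
    qed
    then show ?thesis using c by (simp add: field_simps)
  qed
  fix c :: real and x assume "c \<ge> 0"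
  show "slide q a (c *\<^sub>R x) = c * slide q a x"
  proof (cases "c = 0")
    case True
    have "slide q a 0 = 0"
      unfolding slide_def by (simp add: sublinear_scale[OF q])
    then show ?thesis using True by simp
  next
    case False
    then have c: "c > 0" using \<open>c \<ge> 0\<close> by simp
    have "slide q a ((1 / c) *\<^sub>R (c *\<^sub>R x)) \<le> (1 / c) * slide q a (c *\<^sub>R x)"
      using c by (intro le) auto
    then have "c * slide q a x \<le> slide q a (c *\<^sub>R x)" using c by (simp add: field_simps)
    with le[OF c, of x] show ?thesis by simp
  qed
qed

text \<open>A sublinear \<open>q \<le> p\<close> is a face if the linear functionals below \<open>q\<close> form a face of the
  convex set of linear functionals below \<open>p\<close>.\<close>
definition sublinear_face :: "('a::real_vector \<Rightarrow> real) \<Rightarrow> ('a \<Rightarrow> real) \<Rightarrow> bool" where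
  "sublinear_face p q \<longleftrightarrow> (\<forall>L1 L2 u w. linear L1 \<longrightarrow> linear L2 \<longrightarrow> u > 0 \<longrightarrow> w > 0 \<longrightarrow> u + w = 1 \<longrightarrow>
     (\<forall>x. L1 x \<le> p x) \<longrightarrow> (\<forall>x. L2 x \<le> p x) \<longrightarrow> (\<forall>x. u * L1 x + w * L2 x \<le> q x) \<longrightarrow>
     (\<forall>x. L1 x \<le> q x \<and> L2 x \<le> q x))"

text \<open>A convex combination below \<open>slide q a\<close> lies below \<open>q\<close>, so both
  parts do, since \<open>q\<close> is a face. At \<open>- a\<close> the bound
  \<open>slide q a (- a) \<le> - q a\<close> forces both parts to take the largest possible value
  \<open>q a\<close> at \<open>a\<close>, and a functional below \<open>q\<close> that attains
  \<open>q a\<close> lies below the slide.\<close>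

lemma sublinear_face_slide:
  fixes p q :: "'a::real_vector \<Rightarrow> real"
  assumes q: "sublinear q" and face: "sublinear_face p q"
  shows "sublinear_face p (slide q a)"
  unfolding sublinear_face_def
proof (intro allI impI)
  fix L1 L2 :: "'a \<Rightarrow> real" and u w :: real and x
  assume lin: "linear L1" "linear L2" and uw: "u > 0" "w > 0" "u + w = 1"
    and p: "\<forall>x. L1 x \<le> p x" "\<forall>x. L2 x \<le> p x"
    and comb: "\<forall>x. u * L1 x + w * L2 x \<le> slide q a x"
  have "\<forall>x. u * L1 x + w * L2 x \<le> q x"
    using comb slide_le_self[OF q, of a] order_trans by blast
  then have le: "L1 x \<le> q x" "L2 x \<le> q x" for x
    using face lin uw p unfolding sublinear_face_def by blast+
  have "u * L1 (- a) + w * L2 (- a) \<le> - q a"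
    using comb slide_neg[OF q, of a] order_trans by blast
  then have "u * (q a - L1 a) + w * (q a - L2 a) \<le> (u + w - 1) * q a"
    using lin by (simp add: linear_neg algebra_simps)
  then have *: "u * (q a - L1 a) + w * (q a - L2 a) \<le> 0" using uw by simp
  have "u * (q a - L1 a) \<ge> 0" "w * (q a - L2 a) \<ge> 0" using le uw by auto
  then have "u * (q a - L1 a) = 0" "w * (q a - L2 a) = 0" using * by linarith+
  then have eq: "L1 a = q a" "L2 a = q a" using uw by auto
  have "L x \<le> slide q a x" if "linear L" "L a = q a" "\<And>x. L x \<le> q x" for L
  proof (rule slide_greatest)
    fix t :: real
    have "L x = L (x + t *\<^sub>R a) - t * q a"
      using that(1,2) by (simp add: linear_add linear_scale)
    then show "L x \<le> q (x + t *\<^sub>R a) - t * q a" using that(3) by simp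
  qed
  then show "L1 x \<le> slide q a x \<and> L2 x \<le> slide q a x" using lin eq le by blast
qed

text \<open>Zorn's lemma on faces plays the role of Krein-Milman without a topology: sliding a
  minimal face along any \<open>a\<close> gives a face again, hence changes nothing, which makes it
  odd and therefore linear. A linear face is an extreme functional. Starting below
  \<open>slide p f\<close> fixes the value at \<open>f\<close>.\<close>

theorem extreme_functional_below_sublinear:
  fixes p :: "'a::real_vector \<Rightarrow> real"
  assumes p: "sublinear p"
  obtains L where "linear L" "\<And>x. L x \<le> p x" "L f = p f"
    "\<And>L1 L2 u w x. linear L1 \<Longrightarrow> linear L2 \<Longrightarrow> u > 0 \<Longrightarrow> w > 0 \<Longrightarrow> u + w = 1 \<Longrightarrow>
      (\<And>x. L1 x \<le> p x) \<Longrightarrow> (\<And>x. L2 x \<le> p x) \<Longrightarrow> (\<And>x. L x = u * L1 x + w * L2 x) \<Longrightarrow> L1 x = L x"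
proof -
  define S where "S = {q. sublinear q \<and> sublinear_face p q \<and> (\<forall>x. q x \<le> slide p f x)}"
  \<comment> \<open>The order is reversed: a maximal element for \<open>R\<close> is a minimal
    face.\<close>
  define R where "R = (\<lambda>(q::'a \<Rightarrow> real) r. r \<le> q)"
  have Sp: "q x \<le> p x" if "q \<in> S" for q x
    using that slide_le_self[OF p, of f x] unfolding S_def by (auto intro: order_trans)
  have top: "slide p f \<in> S"
  proof -
    have "sublinear_face p p" unfolding sublinear_face_def by blast
    then show ?thesis
      using sublinear_slide[OF p] sublinear_face_slide[OF p] unfolding S_def by blast
  qed
  have "\<exists>m\<in>S. \<forall>a\<in>S. R m a \<longrightarrow> a = m"
  proof (rule predicate_Zorn)
    show "partial_order_on S (relation_of R S)"
      by (rule partial_order_on_relation_ofI) (auto simp: R_def)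
  next
    fix C assume C: "C \<in> Chains (relation_of R S)"
    then have CS: "C \<subseteq> S" and tot: "\<And>q r. q \<in> C \<Longrightarrow> r \<in> C \<Longrightarrow> q \<le> r \<or> r \<le> q"
      by (auto simp: Chains_def relation_of_def R_def)
    show "\<exists>u\<in>S. \<forall>a\<in>C. R a u"
    proof (cases "C = {}")
      case True then show ?thesis using top by auto
    next
      case False
      define m where "m = (\<lambda>x. INF q\<in>C. q x)"
      \<comment> \<open>This bound is uniform over the chain and keeps the pointwise infimum
        finite.\<close>
      have lb: "- p (- x) \<le> q x" if "q \<in> C" for q x
      proof -
        have "q \<in> S" using that CS by auto
        then have "- q (- x) \<le> q x" using sublinear_minus unfolding S_def by auto
        then show ?thesis using Sp[OF \<open>q \<in> S\<close>, of "- x"] by linarith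
      qed
      then have bdd: "bdd_below ((\<lambda>q. q x) ` C)" for x by (intro bdd_belowI2) auto
      have mle: "m x \<le> q x" if "q \<in> C" for q x
        unfolding m_def using that by (intro cINF_lower bdd) auto
      have mge: "c \<le> m x" if "\<And>q. q \<in> C \<Longrightarrow> c \<le> q x" for c x
        unfolding m_def using that False by (intro cINF_greatest) auto
      have sub: "sublinear m"
        unfolding sublinear_def
      proof (intro conjI allI impI)
        fix x y
        \<comment> \<open>Subadditivity survives the infimum because a chain has one member below
          both \<open>q\<close> and \<open>r\<close>.\<close>
        have *: "m (x + y) \<le> q x + r y" if "q \<in> C" "r \<in> C" for q r
        proof -
          obtain s where s: "s \<in> C" "s \<le> q" "s \<le> r" using tot[of q r] \<open>q \<in> C\<close> \<open>r \<in> C\<close> by blast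
          have "m (x + y) \<le> s (x + y)" using mle s by auto
          also have "\<dots> \<le> s x + s y" using s CS by (intro sublinear_add) (auto simp: S_def)
          also have "\<dots> \<le> q x + r y" using s by (intro add_mono) (auto simp: le_fun_def)
          finally show ?thesis .
        qed
        have "m (x + y) - r y \<le> m x" if "r \<in> C" for r
          using *[OF _ that] by (intro mge) (auto simp: algebra_simps)
        then have "m (x + y) - m x \<le> m y" by (intro mge) (auto simp: algebra_simps)
        then show "m (x + y) \<le> m x + m y" by simp
      next
        fix c :: real and x assume c: "c \<ge> 0"
        have q: "q (c *\<^sub>R x) = c * q x" if "q \<in> C" for q
          using that CS c by (intro sublinear_scale) (auto simp: S_def)
        show "m (c *\<^sub>R x) = c * m x"
        proof (cases "c = 0")
          case True
          have "m (c *\<^sub>R x) = (INF q\<in>C. 0)" unfolding m_def using q True by (intro INF_cong) auto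
          then show ?thesis using True False by simp
        next
          case cn: False
          then have c: "c > 0" using c by simp
          have "m (c *\<^sub>R x) / c \<le> m x"
          proof (rule mge)
            fix r assume r: "r \<in> C"
            show "m (c *\<^sub>R x) / c \<le> r x" using mle[OF r, of "c *\<^sub>R x"] q[OF r] c
              by (simp add: field_simps)
          qed
          moreover have "c * m x \<le> m (c *\<^sub>R x)"
          proof (rule mge)
            fix r assume r: "r \<in> C"
            have "c * m x \<le> c * r x" using mle[OF r] c by (intro mult_left_mono) auto
            then show "c * m x \<le> r (c *\<^sub>R x)" using q[OF r] by simp
          qed
          ultimately show ?thesis using c by (simp add: field_simps)
        qed
      qed
      have face: "sublinear_face p m"
        unfolding sublinear_face_def
      proof (intro allI impI)
        fix L1 L2 u w x
        assume a: "linear L1" "linear L2" "u > (0::real)" "w > 0" "u + w = 1" "\<forall>x. L1 x \<le> p x" "\<forall>x. L2 x \<le> p x"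
          and le: "\<forall>x. u * L1 x + w * L2 x \<le> m x"
        have "L1 x \<le> q x \<and> L2 x \<le> q x" if "q \<in> C" for q
        proof -
          have "\<forall>x. u * L1 x + w * L2 x \<le> q x" using le mle[OF that] order_trans by blast
          moreover have "sublinear_face p q" using that CS by (auto simp: S_def)
          ultimately show ?thesis using a unfolding sublinear_face_def by blast
        qed
        then show "L1 x \<le> m x \<and> L2 x \<le> m x" by (auto intro: mge)
      qed
      obtain q where q: "q \<in> C" using False by auto
      have "m x \<le> slide p f x" for x
        using mle[OF q, of x] q CS unfolding S_def by (auto intro: order_trans)
      then have "m \<in> S" using sub face unfolding S_def by auto
      then show ?thesis using mle by (auto simp: R_def le_fun_def)
    qed
  qed
  then obtain L where L: "L \<in> S" and min: "\<And>q. q \<in> S \<Longrightarrow> q \<le> L \<Longrightarrow> q = L"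
    unfolding R_def by blast
  have subL: "sublinear L" and faceL: "sublinear_face p L" and Lf: "\<And>x. L x \<le> slide p f x"
    using L by (auto simp: S_def)
  have neg: "L (- a) = - L a" for a
  proof -
    have "slide L a \<in> S"
      using sublinear_slide[OF subL] sublinear_face_slide[OF subL faceL]
        order_trans[OF slide_le_self[OF subL] Lf]
      unfolding S_def by auto
    then have "slide L a = L" using slide_le_self[OF subL] by (intro min) (auto simp: le_fun_def)
    then have "L (- a) \<le> - L a" using slide_neg[OF subL, of a] by simp
    then show ?thesis using sublinear_minus[OF subL, of a] by simp
  qed
  have "linear L"
  proof (rule linearI)
    fix x y
    have "L (- x + - y) \<le> L (- x) + L (- y)" by (rule sublinear_add[OF subL])
    then have "L x + L y \<le> L (x + y)" using neg[of x] neg[of y] neg[of "x + y"] by simp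
    then show "L (x + y) = L x + L y" using sublinear_add[OF subL, of x y] by simp
  next
    fix c x
    show "L (c *\<^sub>R x) = c *\<^sub>R L x"
      using sublinear_scale[OF subL, of c x] sublinear_scale[OF subL, of "- c" x] neg[of "c *\<^sub>R x"]
      by (cases "c \<ge> 0") auto
  qed
  moreover have "L x \<le> p x" for x using Sp[OF L] .
  moreover have "L f = p f"
    using Lf[of "- f"] slide_neg[OF p, of f] neg[of f] Sp[OF L, of f] by linarith
  moreover have "L1 x = L x"
    if "linear L1" "linear L2" "u > 0" "w > 0" "u + w = 1"
      "\<And>x. L1 x \<le> p x" "\<And>x. L2 x \<le> p x" "\<And>x. L x = u * L1 x + w * L2 x" for L1 L2 u w x
  proof -
    have "\<forall>x. u * L1 x + w * L2 x \<le> L x" using that(8) by auto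
    then have "L1 x \<le> L x" for x using faceL that unfolding sublinear_face_def by blast
    from this[of x] this[of "- x"] show ?thesis
      using neg[of x] that(1) by (simp add: linear_neg)
  qed
  ultimately show ?thesis by (rule that)
qed

section \<open>Quadratic modules and growth\<close>

lemma double_conv_scaleR: "(2::'a::real_algebra_1) * x = 2 *\<^sub>R x"
  by (simp add: scaleR_conv_of_real)

locale quadratic_module =
  fixes Q :: "'a::{comm_ring_1,real_algebra_1} set"
  assumes one_mem: "1 \<in> Q"
    and add_mem: "x \<in> Q \<Longrightarrow> y \<in> Q \<Longrightarrow> x + y \<in> Q"
    and square_mult_mem: "x \<in> Q \<Longrightarrow> a\<^sup>2 * x \<in> Q"
begin

lemma zero_mem: "0 \<in> Q"
  using square_mult_mem[OF one_mem, of 0] by simp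

lemma square_mem: "a\<^sup>2 \<in> Q"
  using square_mult_mem[OF one_mem] by simp

lemma even_power_mem: "a ^ (2 * k) \<in> Q"
  using square_mem[of "a ^ k"] by (simp add: power_mult power2_eq_square flip: power_mult_distrib)

lemma even_power_mult_mem: "x \<in> Q \<Longrightarrow> a ^ (2 * k) * x \<in> Q"
  using square_mult_mem[of x "a ^ k"] by (simp add: power_mult power2_eq_square flip: power_mult_distrib)

lemma scaleR_mem:
  assumes "c \<ge> 0" "x \<in> Q"
  shows "c *\<^sub>R x \<in> Q"
proof -
  have "(of_real (sqrt c))\<^sup>2 * x = c *\<^sub>R x"
    using assms(1) by (simp add: scaleR_conv_of_real flip: of_real_power)
  then show ?thesis using square_mult_mem[OF assms(2), of "of_real (sqrt c)"] by simp
qed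

lemma sum_mem: "(\<And>i. i \<in> I \<Longrightarrow> g i \<in> Q) \<Longrightarrow> sum g I \<in> Q"
  by (induction I rule: infinite_finite_induct) (auto simp: zero_mem intro: add_mem)

definition le :: "'a \<Rightarrow> 'a \<Rightarrow> bool" (infix "\<preceq>" 50)
  where "x \<preceq> y \<longleftrightarrow> y - x \<in> Q"

lemma le_refl: "x \<preceq> x"
  by (simp add: le_def zero_mem)

lemma le_trans [trans]: "x \<preceq> y \<Longrightarrow> y \<preceq> z \<Longrightarrow> x \<preceq> z"
  using add_mem[of "y - x" "z - y"] by (simp add: le_def)

lemma eq_le_trans [trans]: "x = y \<Longrightarrow> y \<preceq> z \<Longrightarrow> x \<preceq> z"
  and le_eq_trans [trans]: "x \<preceq> y \<Longrightarrow> y = z \<Longrightarrow> x \<preceq> z"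
  by simp_all

lemma le_add: "x \<preceq> y \<Longrightarrow> x' \<preceq> y' \<Longrightarrow> x + x' \<preceq> y + y'"
  using add_mem[of "y - x" "y' - x'"] by (simp add: le_def algebra_simps)

lemma le_scaleR: "c \<ge> 0 \<Longrightarrow> x \<preceq> y \<Longrightarrow> c *\<^sub>R x \<preceq> c *\<^sub>R y"
  using scaleR_mem[of c "y - x"] by (simp add: le_def scaleR_diff_right)

lemma le_scaleR_cancel: "c > 0 \<Longrightarrow> c *\<^sub>R x \<preceq> c *\<^sub>R y \<Longrightarrow> x \<preceq> y"
  using le_scaleR[of "inverse c" "c *\<^sub>R x" "c *\<^sub>R y"] by simp

lemma le_scaleR_left_mono: "c \<le> d \<Longrightarrow> 0 \<preceq> x \<Longrightarrow> c *\<^sub>R x \<preceq> d *\<^sub>R x"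
  using scaleR_mem[of "d - c" x] by (simp add: le_def scaleR_diff_left)

lemma le_square_mult: "x \<preceq> y \<Longrightarrow> a\<^sup>2 * x \<preceq> a\<^sup>2 * y"
  using square_mult_mem[of "y - x" a] by (simp add: le_def algebra_simps)

lemma le_even_power_mult: "x \<preceq> y \<Longrightarrow> a ^ (2 * k) * x \<preceq> a ^ (2 * k) * y"
  using even_power_mult_mem[of "y - x" a k] by (simp add: le_def algebra_simps)

text \<open>Products of elements of \<open>Q\<close> need not lie in \<open>Q\<close>, so the
  difference is factored with \<open>w\<^sup>2 - u\<^sup>2\<close> as the only factor that is not a
  square.\<close>

lemma square_le_power_mono:
  assumes "u\<^sup>2 \<preceq> w\<^sup>2"
  shows "u ^ (2 * k) \<preceq> w ^ (2 * k)"
proof -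
  have "w ^ (2 * k) - u ^ (2 * k) = (w\<^sup>2) ^ k - (u\<^sup>2) ^ k" by (simp add: power_mult)
  also have "\<dots> = (\<Sum>i<k. (u\<^sup>2) ^ (k - Suc i) * (w\<^sup>2) ^ i * (w\<^sup>2 - u\<^sup>2))"
    by (simp add: power_diff_sumr2 sum_distrib_left mult.commute)
  also have "\<dots> = (\<Sum>i<k. (u ^ (k - Suc i) * w ^ i)\<^sup>2 * (w\<^sup>2 - u\<^sup>2))"
    by (intro sum.cong refl) (simp add: power_mult_distrib mult.commute flip: power_mult)
  also have "\<dots> \<in> Q" using assms by (intro sum_mem square_mult_mem) (simp add: le_def)
  finally show ?thesis by (simp add: le_def)
qed

text \<open>A Chebyshev-type inequality: the difference of the sides is
  \<open>(u\<^sup>2 - w\<^sup>2) * (u ^ (2 * k) - w ^ (2 * k))\<close>, where the second factor is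
  the first times a sum of squares.\<close>

lemma even_power_mixed_le:
  "(u\<^sup>2 + w\<^sup>2) * (u ^ (2 * k) + w ^ (2 * k)) \<preceq> 2 * (u ^ (2 * Suc k) + w ^ (2 * Suc k))"
proof -
  have "2 * (u ^ (2 * Suc k) + w ^ (2 * Suc k)) - (u\<^sup>2 + w\<^sup>2) * (u ^ (2 * k) + w ^ (2 * k))
      = (u\<^sup>2 - w\<^sup>2) * ((u\<^sup>2) ^ k - (w\<^sup>2) ^ k)"
    unfolding power_mult by (simp add: algebra_simps)
  also have "\<dots> = (\<Sum>i<k. (u\<^sup>2 - w\<^sup>2)\<^sup>2 * ((w\<^sup>2) ^ (k - Suc i) * (u\<^sup>2) ^ i))"
    by (simp add: power_diff_sumr2 sum_distrib_left power2_eq_square mult.assoc)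
  also have "\<dots> = (\<Sum>i<k. ((u\<^sup>2 - w\<^sup>2) * w ^ (k - Suc i) * u ^ i)\<^sup>2)"
    by (intro sum.cong refl) (simp add: power_mult_distrib mult.commute mult.left_commute flip: power_mult)
  also have "\<dots> \<in> Q" by (intro sum_mem square_mem)
  finally show ?thesis by (simp add: le_def)
qed

text \<open>Each induction step contributes a 2 from \<open>(u + w)\<^sup>2 \<preceq> 2 *\<^sub>R
  (u\<^sup>2 + w\<^sup>2)\<close> and a 2 from the mixed inequality; hence
  \<open>4 ^ k\<close>.\<close>

lemma even_power_add_le: "(u + w) ^ (2 * k) \<preceq> 4 ^ k *\<^sub>R (u ^ (2 * k) + w ^ (2 * k))"
proof (induction k)
  case 0
  then show ?case by (simp add: le_def one_mem)
next
  case (Suc k)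
  have "(u + w)\<^sup>2 \<preceq> 2 *\<^sub>R (u\<^sup>2 + w\<^sup>2)"
    using square_mem[of "u - w"] by (simp add: le_def power2_eq_square algebra_simps flip: double_conv_scaleR)
  then have "u ^ (2 * k) * (u + w)\<^sup>2 + w ^ (2 * k) * (u + w)\<^sup>2
      \<preceq> u ^ (2 * k) * (2 *\<^sub>R (u\<^sup>2 + w\<^sup>2)) + w ^ (2 * k) * (2 *\<^sub>R (u\<^sup>2 + w\<^sup>2))"
    by (intro le_add le_even_power_mult)
  then have *: "(u + w)\<^sup>2 * (u ^ (2 * k) + w ^ (2 * k)) \<preceq> 2 *\<^sub>R ((u\<^sup>2 + w\<^sup>2) * (u ^ (2 * k) + w ^ (2 * k)))"
    by (simp add: algebra_simps)
  have "(u + w) ^ (2 * Suc k) = (u + w)\<^sup>2 * (u + w) ^ (2 * k)" by (simp add: power2_eq_square)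
  also have "\<dots> \<preceq> (u + w)\<^sup>2 * (4 ^ k *\<^sub>R (u ^ (2 * k) + w ^ (2 * k)))"
    by (intro le_square_mult Suc)
  also have "\<dots> = 4 ^ k *\<^sub>R ((u + w)\<^sup>2 * (u ^ (2 * k) + w ^ (2 * k)))" by simp
  also have "\<dots> \<preceq> 4 ^ k *\<^sub>R (2 *\<^sub>R ((u\<^sup>2 + w\<^sup>2) * (u ^ (2 * k) + w ^ (2 * k))))"
    using * by (intro le_scaleR) auto
  also have "\<dots> \<preceq> 4 ^ k *\<^sub>R (2 *\<^sub>R (2 * (u ^ (2 * Suc k) + w ^ (2 * Suc k))))"
    by (intro le_scaleR even_power_mixed_le) auto
  also have "\<dots> = 4 ^ Suc k *\<^sub>R (u ^ (2 * Suc k) + w ^ (2 * Suc k))"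
    by (simp only: double_conv_scaleR scaleR_scaleR) (simp add: mult.commute)
  finally show ?case .
qed

lemma double_mult_le: "2 * (u * w) \<preceq> u\<^sup>2 + w\<^sup>2"
  using square_mem[of "u - w"] by (simp add: le_def power2_eq_square algebra_simps)

definition positive :: "('a \<Rightarrow> real) \<Rightarrow> bool" where
  "positive L \<longleftrightarrow> linear L \<and> (\<forall>q\<in>Q. L q \<ge> 0)"

lemma positive_linear: "positive L \<Longrightarrow> linear L"
  and positive_nonneg: "positive L \<Longrightarrow> q \<in> Q \<Longrightarrow> L q \<ge> 0"
  by (auto simp: positive_def)

lemma positive_mono: "positive L \<Longrightarrow> x \<preceq> y \<Longrightarrow> L x \<le> L y"
  using positive_nonneg[of L "y - x"] by (simp add: le_def positive_def linear_diff)

lemma positive_cauchy_schwarz: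
  assumes L: "positive L"
  shows "(L (x * y))\<^sup>2 \<le> L (x\<^sup>2) * L (y\<^sup>2)"
proof -
  note lin = positive_linear[OF L]
  have quad: "0 \<le> L (x\<^sup>2) + 2 * t * L (x * y) + t\<^sup>2 * L (y\<^sup>2)" for t
  proof -
    have "0 \<le> L ((x + t *\<^sub>R y)\<^sup>2)" by (rule positive_nonneg[OF L square_mem])
    also have "(x + t *\<^sub>R y)\<^sup>2 = x\<^sup>2 + (2 * t) *\<^sub>R (x * y) + t\<^sup>2 *\<^sub>R y\<^sup>2"
      by (simp add: power2_eq_square algebra_simps scaleR_2 flip: scaleR_scaleR)
    finally show ?thesis by (simp add: lin linear_add linear_scale)
  qed
  have nn: "L (x\<^sup>2) \<ge> 0" "L (y\<^sup>2) \<ge> 0" by (auto intro: positive_nonneg[OF L square_mem])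
  show ?thesis
  proof (cases "L (y\<^sup>2) = 0")
    case True
    have "L (x * y) = 0"
    proof (rule ccontr)
      assume "L (x * y) \<noteq> 0"
      \<comment> \<open>With \<open>L (y\<^sup>2) = 0\<close> the form is affine in
        \<open>t\<close>, and this \<open>t\<close> gives it the value -1.\<close>
      then show False using quad[of "- (L (x\<^sup>2) + 1) / (2 * L (x * y))"] True by (simp add: field_simps)
    qed
    then show ?thesis using nn by simp
  next
    case False
    then show ?thesis
      using quad[of "- L (x * y) / L (y\<^sup>2)"] nn by (simp add: field_simps power2_eq_square)
  qed
qed

end

section \<open>Weights and growth conditions modulo a quadratic module\<close>

inductive_set generated_algebra :: "'a::{comm_ring_1,real_algebra_1} set \<Rightarrow> 'a set" for V where
  const: "of_real c \<in> generated_algebra V"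
| gen: "v \<in> V \<Longrightarrow> v \<in> generated_algebra V"
| add: "x \<in> generated_algebra V \<Longrightarrow> y \<in> generated_algebra V \<Longrightarrow> x + y \<in> generated_algebra V"
| mult: "x \<in> generated_algebra V \<Longrightarrow> y \<in> generated_algebra V \<Longrightarrow> x * y \<in> generated_algebra V"

text \<open>\<open>\<theta> r\<close> is later \<open>Phi r\<close> or \<open>Phi r + Psi r\<close>.
  Monotonicity lets bounds with different indices be moved to the larger index.\<close>

locale weighted_module = quadratic_module Q
  for Q :: "'a::{comm_ring_1,real_algebra_1} set" +
  fixes \<theta> :: "nat \<Rightarrow> 'a"
  assumes weight_Suc: "\<theta> (Suc r) - \<theta> r \<in> Q"
    and weight_0: "\<theta> 0 - 1 \<in> Q"
begin

lemma weight_mono: "r \<le> s \<Longrightarrow> \<theta> r \<preceq> \<theta> s"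
proof (induction s rule: dec_induct)
  case base
  show ?case by (rule le_refl)
next
  case (step n)
  then show ?case using weight_Suc[of n] le_trans unfolding le_def by blast
qed

lemma one_le_weight: "1 \<preceq> \<theta> r"
  using weight_0 weight_mono[of 0 r] le_trans[of 1 "\<theta> 0" "\<theta> r"] by (simp add: le_def)

lemma weight_nonneg: "0 \<preceq> \<theta> r"
  using one_le_weight[of r] one_mem le_trans[of 0 1] by (simp add: le_def)

lemma le_weight_mono:
  assumes "x \<preceq> a *\<^sub>R \<theta> r" "0 \<le> a" "a \<le> b" "r \<le> s"
  shows "x \<preceq> b *\<^sub>R \<theta> s"
  using assms(1) le_scaleR[OF assms(2) weight_mono[OF assms(4)]]
    le_scaleR_left_mono[OF assms(3) weight_nonneg[of s]] le_trans by blast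

definition bounded_above :: "'a \<Rightarrow> bool" where
  "bounded_above g \<longleftrightarrow> (\<exists>t\<ge>0. \<exists>r. g \<preceq> t *\<^sub>R \<theta> r)"

lemma bounded_above_le: "g \<preceq> h \<Longrightarrow> bounded_above h \<Longrightarrow> bounded_above g"
  unfolding bounded_above_def using le_trans by blast

lemma bounded_above_add:
  assumes "bounded_above g" "bounded_above h"
  shows "bounded_above (g + h)"
proof -
  obtain t r where t: "t \<ge> 0" "g \<preceq> t *\<^sub>R \<theta> r" using assms(1) by (auto simp: bounded_above_def)
  obtain u s where u: "u \<ge> 0" "h \<preceq> u *\<^sub>R \<theta> s" using assms(2) by (auto simp: bounded_above_def)
  have "g \<preceq> t *\<^sub>R \<theta> (max r s)" "h \<preceq> u *\<^sub>R \<theta> (max r s)"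
    using t u by (auto intro: le_weight_mono)
  then have "g + h \<preceq> (t + u) *\<^sub>R \<theta> (max r s)"
    using le_add by (fastforce simp: scaleR_add_left)
  then show ?thesis unfolding bounded_above_def using t(1) u(1) by (intro exI[of _ "t + u"]) auto
qed

lemma bounded_above_scaleR:
  assumes "c \<ge> 0" "bounded_above g"
  shows "bounded_above (c *\<^sub>R g)"
proof -
  obtain t r where t: "t \<ge> 0" "g \<preceq> t *\<^sub>R \<theta> r" using assms(2) by (auto simp: bounded_above_def)
  then have "c *\<^sub>R g \<preceq> (c * t) *\<^sub>R \<theta> r" using le_scaleR[OF assms(1) t(2)] by simp
  then show ?thesis unfolding bounded_above_def using t(1) assms(1) by (intro exI[of _ "c * t"]) auto
qed

lemma bounded_above_of_real: "bounded_above (of_real c)"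
proof -
  have "of_real c \<preceq> \<bar>c\<bar> *\<^sub>R (1::'a)"
    using le_scaleR_left_mono[of c "\<bar>c\<bar>" 1] one_mem by (simp add: le_def of_real_def)
  also have "\<dots> \<preceq> \<bar>c\<bar> *\<^sub>R \<theta> 0" by (intro le_scaleR one_le_weight) auto
  finally show ?thesis unfolding bounded_above_def by (intro exI[of _ "\<bar>c\<bar>"]) auto
qed

definition power_bounded :: "'a \<Rightarrow> bool" where
  "power_bounded g \<longleftrightarrow> (\<forall>k. bounded_above (g ^ (2 * k)))"

text \<open>All even powers are carried along because a product is handled by
  \<open>2 * (x * y) ^ (2 * k) \<preceq> x ^ (4 * k) + y ^ (4 * k)\<close>, which doubles the
  exponents.\<close>

lemma power_bounded_generated:
  assumes "\<And>v. v \<in> V \<Longrightarrow> power_bounded v" "g \<in> generated_algebra V"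
  shows "power_bounded g"
  using assms(2)
proof induction
  case (const c)
  then show ?case
    unfolding power_bounded_def by (metis bounded_above_of_real of_real_power)
next
  case (gen v)
  then show ?case by (rule assms(1))
next
  case (add x y)
  then show ?case
    unfolding power_bounded_def
    by (auto intro!: bounded_above_le[OF even_power_add_le] bounded_above_scaleR bounded_above_add)
next
  case (mult x y)
  show ?case
    unfolding power_bounded_def
  proof
    fix k
    have "2 * ((x * y) ^ (2 * k)) \<preceq> x ^ (2 * (2 * k)) + y ^ (2 * (2 * k))"
      using double_mult_le[of "x ^ (2 * k)" "y ^ (2 * k)"] by (simp add: power_mult_distrib mult.commute flip: power_mult)
    moreover have "bounded_above (x ^ (2 * (2 * k)) + y ^ (2 * (2 * k)))"
      using mult.IH unfolding power_bounded_def by (intro bounded_above_add) blast+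
    ultimately have "bounded_above ((1 / 2) *\<^sub>R (2 * ((x * y) ^ (2 * k))))"
      by (intro bounded_above_scaleR) (auto intro: bounded_above_le)
    then show "bounded_above ((x * y) ^ (2 * k))" by (simp only: double_conv_scaleR scaleR_scaleR) simp
  qed
qed

lemma power_bounded_imp_bounded_above:
  assumes "power_bounded g"
  shows "bounded_above g"
proof -
  have "2 * g \<preceq> 1 + g\<^sup>2" using double_mult_le[of 1 g] by simp
  moreover have "bounded_above (1 + g\<^sup>2)"
    using assms bounded_above_of_real[of 1] unfolding power_bounded_def
    by (intro bounded_above_add) (auto dest: spec[of _ 1])
  ultimately have "bounded_above ((1 / 2) *\<^sub>R (2 * g))"
    by (intro bounded_above_scaleR) (auto intro: bounded_above_le)
  then show ?thesis by (simp only: double_conv_scaleR scaleR_scaleR) simp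
qed

text \<open>The growth that makes \<open>\<Sum>m. t ^ m / fact m * L (p * g ^ m)\<close> converge for small \<open>t\<close>
  whenever \<open>L\<close> is positive and bounded on the weights.\<close>
definition factorial_growth :: "'a \<Rightarrow> bool" where
  "factorial_growth g \<longleftrightarrow> (\<exists>c\<ge>1. \<forall>k. \<exists>r. g ^ (2 * k) \<preceq> (c ^ Suc k * fact (2 * k)) *\<^sub>R \<theta> r)"

lemma factorial_growth_power_bounded: "factorial_growth g \<Longrightarrow> power_bounded g"
  unfolding power_bounded_def bounded_above_def factorial_growth_def
  by (metis fact_ge_zero mult_nonneg_nonneg zero_le_power zero_le_one order_trans)

lemma factorial_growth_of_real: "factorial_growth (of_real a)"
  unfolding factorial_growth_def
proof (intro exI[of _ "1 + a\<^sup>2"] conjI allI)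
  fix k
  have "(of_real a ::'a) ^ (2 * k) = a ^ (2 * k) *\<^sub>R 1"
    by (simp only: of_real_power[symmetric]) (simp only: of_real_def)
  also have "\<dots> \<preceq> a ^ (2 * k) *\<^sub>R \<theta> 0" by (intro le_scaleR one_le_weight) auto
  finally have "(of_real a ::'a) ^ (2 * k) \<preceq> a ^ (2 * k) *\<^sub>R \<theta> 0" .
  moreover have "a ^ (2 * k) \<le> (1 + a\<^sup>2) ^ Suc k * fact (2 * k)"
  proof -
    have "a ^ (2 * k) \<le> (1 + a\<^sup>2) ^ k" by (simp add: power_mult power_mono)
    also have "\<dots> \<le> (1 + a\<^sup>2) ^ Suc k" by (intro power_increasing) auto
    also have "\<dots> \<le> (1 + a\<^sup>2) ^ Suc k * fact (2 * k)"
      using mult_left_mono[OF fact_ge_1, of "(1 + a\<^sup>2) ^ Suc k" "2 * k"] by simp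
    finally show ?thesis .
  qed
  ultimately show "\<exists>r. (of_real a ::'a) ^ (2 * k) \<preceq> ((1 + a\<^sup>2) ^ Suc k * fact (2 * k)) *\<^sub>R \<theta> r"
    using le_weight_mono[of _ "a ^ (2 * k)" 0 _ 0] by auto
qed auto

lemma factorial_growth_add:
  assumes "factorial_growth g" "factorial_growth h"
  shows "factorial_growth (g + h)"
proof -
  obtain c where c: "c \<ge> 1" "\<And>k. \<exists>r. g ^ (2 * k) \<preceq> (c ^ Suc k * fact (2 * k)) *\<^sub>R \<theta> r"
    using assms(1) unfolding factorial_growth_def by blast
  obtain d where d: "d \<ge> 1" "\<And>k. \<exists>r. h ^ (2 * k) \<preceq> (d ^ Suc k * fact (2 * k)) *\<^sub>R \<theta> r"
    using assms(2) unfolding factorial_growth_def by blast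
  show ?thesis
    unfolding factorial_growth_def
  proof (intro exI[of _ "4 * (c + d)"] conjI allI)
    fix k
    let ?F = "fact (2 * k) :: real"
    obtain r s where r: "g ^ (2 * k) \<preceq> (c ^ Suc k * ?F) *\<^sub>R \<theta> r"
      and s: "h ^ (2 * k) \<preceq> (d ^ Suc k * ?F) *\<^sub>R \<theta> s" using c(2) d(2) by blast
    have "g ^ (2 * k) \<preceq> (c ^ Suc k * ?F) *\<^sub>R \<theta> (max r s)" "h ^ (2 * k) \<preceq> (d ^ Suc k * ?F) *\<^sub>R \<theta> (max r s)"
      using c(1) d(1) by (auto intro: le_weight_mono[OF r] le_weight_mono[OF s])
    then have "g ^ (2 * k) + h ^ (2 * k) \<preceq> ((c ^ Suc k + d ^ Suc k) * ?F) *\<^sub>R \<theta> (max r s)"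
      using le_add by (fastforce simp: algebra_simps)
    then have "4 ^ k *\<^sub>R (g ^ (2 * k) + h ^ (2 * k)) \<preceq> 4 ^ k *\<^sub>R ((c ^ Suc k + d ^ Suc k) * ?F) *\<^sub>R \<theta> (max r s)"
      by (intro le_scaleR) auto
    then have *: "(g + h) ^ (2 * k) \<preceq> (4 ^ k * ((c ^ Suc k + d ^ Suc k) * ?F)) *\<^sub>R \<theta> (max r s)"
      using le_trans[OF even_power_add_le] by simp
    have "4 ^ k * (c ^ Suc k + d ^ Suc k) \<le> (4 * (c + d)) ^ Suc k"
    proof -
      have "c ^ Suc k \<le> c * (c + d) ^ k" "d ^ Suc k \<le> d * (c + d) ^ k"
        using c(1) d(1) by (auto intro!: mult_left_mono power_mono)
      then have "c ^ Suc k + d ^ Suc k \<le> (c + d) ^ Suc k" by (simp add: algebra_simps)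
      moreover have "(4::real) ^ k \<le> 4 ^ Suc k" by simp
      ultimately show ?thesis
        using c(1) d(1) unfolding power_mult_distrib by (intro mult_mono) auto
    qed
    then have "4 ^ k * ((c ^ Suc k + d ^ Suc k) * ?F) \<le> (4 * (c + d)) ^ Suc k * ?F"
      using mult_right_mono[of "4 ^ k * (c ^ Suc k + d ^ Suc k)" "(4 * (c + d)) ^ Suc k" ?F]
      by (simp only: mult.assoc fact_ge_zero)
    then show "\<exists>r. (g + h) ^ (2 * k) \<preceq> ((4 * (c + d)) ^ Suc k * ?F) *\<^sub>R \<theta> r"
      using le_weight_mono[OF *, of "(4 * (c + d)) ^ Suc k * ?F" "max r s"] c(1) d(1) by auto
  qed (use c d in auto)
qed

lemma factorial_growth_scaleR:
  assumes "factorial_growth g"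
  shows "factorial_growth (a *\<^sub>R g)"
proof -
  obtain c where c: "c \<ge> 1" "\<And>k. \<exists>r. g ^ (2 * k) \<preceq> (c ^ Suc k * fact (2 * k)) *\<^sub>R \<theta> r"
    using assms unfolding factorial_growth_def by blast
  show ?thesis
    unfolding factorial_growth_def
  proof (intro exI[of _ "(1 + a\<^sup>2) * c"] conjI allI)
    have "1 * 1 \<le> (1 + a\<^sup>2) * c" using c(1) by (intro mult_mono) auto
    then show "1 \<le> (1 + a\<^sup>2) * c" by simp
    fix k
    let ?F = "fact (2 * k) :: real"
    obtain r where r: "g ^ (2 * k) \<preceq> (c ^ Suc k * ?F) *\<^sub>R \<theta> r" using c(2) by blast
    have "(a *\<^sub>R g) ^ (2 * k) = a ^ (2 * k) *\<^sub>R g ^ (2 * k)"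
      by (simp add: scaleR_conv_of_real power_mult_distrib)
    also have "\<dots> \<preceq> a ^ (2 * k) *\<^sub>R (c ^ Suc k * ?F) *\<^sub>R \<theta> r" by (intro le_scaleR r) auto
    finally have *: "(a *\<^sub>R g) ^ (2 * k) \<preceq> (a ^ (2 * k) * (c ^ Suc k * ?F)) *\<^sub>R \<theta> r" by simp
    have "a ^ (2 * k) \<le> (1 + a\<^sup>2) ^ k" by (simp add: power_mult power_mono)
    also have "\<dots> \<le> (1 + a\<^sup>2) ^ Suc k" by (intro power_increasing) auto
    finally have "a ^ (2 * k) * (c ^ Suc k * ?F) \<le> (1 + a\<^sup>2) ^ Suc k * (c ^ Suc k * ?F)"
      using c(1) by (intro mult_right_mono) auto
    then have "a ^ (2 * k) * (c ^ Suc k * ?F) \<le> ((1 + a\<^sup>2) * c) ^ Suc k * ?F"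
      unfolding power_mult_distrib by (simp only: mult.assoc)
    moreover have "0 \<le> a ^ (2 * k) * (c ^ Suc k * ?F)" using c(1) by simp
    ultimately show "\<exists>r. (a *\<^sub>R g) ^ (2 * k) \<preceq> (((1 + a\<^sup>2) * c) ^ Suc k * ?F) *\<^sub>R \<theta> r"
      using le_weight_mono[OF *] by blast
  qed
qed

lemma factorial_growth_sum: "(\<And>i. i \<in> I \<Longrightarrow> factorial_growth (g i)) \<Longrightarrow> factorial_growth (sum g I)"
proof (induction I rule: infinite_finite_induct)
  case (insert x F)
  then show ?case by (auto intro: factorial_growth_add)
qed (use factorial_growth_of_real[of 0] in auto)

text \<open>From \<open>a\<^sup>2 \<preceq> b\<close> follows
  \<open>a ^ (4 * k) \<preceq> b ^ (2 * k)\<close>, and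
  \<open>2 * a ^ (2 * k) \<preceq> 1 + a ^ (4 * k)\<close> returns to the exponent wanted. This is
  how growth passes from even moments to arbitrary moment variables.\<close>

lemma factorial_growth_square_le:
  assumes "factorial_growth b" "a\<^sup>2 \<preceq> b"
  shows "factorial_growth a"
proof -
  obtain c where c: "c \<ge> 1" "\<And>k. \<exists>r. b ^ (2 * k) \<preceq> (c ^ Suc k * fact (2 * k)) *\<^sub>R \<theta> r"
    using assms(1) unfolding factorial_growth_def by blast
  have "b\<^sup>2 - (a\<^sup>2)\<^sup>2 = (b - a\<^sup>2)\<^sup>2 + a\<^sup>2 * (b - a\<^sup>2) + a\<^sup>2 * (b - a\<^sup>2)"
    by (simp add: power2_eq_square algebra_simps)
  also have "\<dots> \<in> Q" using assms(2) by (intro add_mem square_mem square_mult_mem) (auto simp: le_def)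
  finally have "(a\<^sup>2)\<^sup>2 \<preceq> b\<^sup>2" by (simp add: le_def)
  then have ab: "(a\<^sup>2) ^ (2 * k) \<preceq> b ^ (2 * k)" for k by (rule square_le_power_mono)
  show ?thesis
    unfolding factorial_growth_def
  proof (intro exI[of _ "2 * c"] conjI allI)
    fix k
    let ?F = "fact (2 * k) :: real"
    obtain r where r: "b ^ (2 * k) \<preceq> (c ^ Suc k * ?F) *\<^sub>R \<theta> r" using c(2) by blast
    have "2 * a ^ (2 * k) \<preceq> 1 + (a\<^sup>2) ^ (2 * k)"
      using double_mult_le[of 1 "a ^ (2 * k)"] by (simp add: mult.commute flip: power_mult)
    also have "\<dots> \<preceq> \<theta> r + (c ^ Suc k * ?F) *\<^sub>R \<theta> r"
      using ab r le_trans by (intro le_add one_le_weight) blast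
    also have "\<dots> = (1 + c ^ Suc k * ?F) *\<^sub>R \<theta> r" by (simp add: algebra_simps)
    finally have *: "2 * a ^ (2 * k) \<preceq> (1 + c ^ Suc k * ?F) *\<^sub>R \<theta> r" .
    have one: "1 \<le> c ^ Suc k * ?F"
      using mult_mono[of 1 "c ^ Suc k" 1 ?F] one_le_power[OF c(1), of "Suc k"] c(1) by (auto intro: fact_ge_1)
    have "c ^ Suc k * ?F \<le> (2 * c) ^ Suc k * ?F"
      using c(1) by (intro mult_right_mono power_mono) auto
    then have "2 * a ^ (2 * k) \<preceq> (2 * ((2 * c) ^ Suc k * ?F)) *\<^sub>R \<theta> r"
      using one by (intro le_weight_mono[OF *]) auto
    then have "2 *\<^sub>R a ^ (2 * k) \<preceq> 2 *\<^sub>R ((2 * c) ^ Suc k * ?F) *\<^sub>R \<theta> r"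
      by (simp only: double_conv_scaleR[of "a ^ (2 * k)"] scaleR_scaleR)
    then show "\<exists>r. a ^ (2 * k) \<preceq> ((2 * c) ^ Suc k * ?F) *\<^sub>R \<theta> r"
      by (intro exI[of _ r]) (rule le_scaleR_cancel[of 2], simp_all)
  qed (use c in auto)
qed

end

section \<open>Characters from extreme functionals\<close>

text \<open>Central binomial coefficients are at most \<open>4 ^ m\<close>. After Cauchy-Schwarz
  this turns a bound by \<open>fact (2 * m)\<close> for \<open>L ((v ^ m)\<^sup>2)\<close> into one
  by \<open>fact m\<close> for \<open>L (p * v ^ m)\<close>.\<close>

lemma fact_double_le: "(fact (2 * m) :: real) \<le> 4 ^ m * (fact m)\<^sup>2"
proof -
  have "real (2 * m choose m) \<le> 2 ^ (2 * m)"
    using binomial_le_pow2[of "2 * m" m] of_nat_mono by fastforce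
  moreover have "real (2 * m choose m) = fact (2 * m) / (fact m)\<^sup>2"
    using binomial_fact[of m "2 * m", where 'a = real] by (simp add: power2_eq_square)
  moreover have "(2::real) ^ (2 * m) = 4 ^ m" by (simp add: power_mult)
  ultimately have "fact (2 * m) / (fact m)\<^sup>2 \<le> (4::real) ^ m" by simp
  then show ?thesis by (simp add: pos_divide_le_eq)
qed

text \<open>For products of two truncated series: the functional grows like
  \<open>fact (i + j)\<close>, while the coefficients provide only \<open>fact i * fact j\<close>.
  The loss \<open>2 ^ (i + j)\<close> is paid for by the half angle.\<close>

lemma fact_add_le: "(fact (i + j) :: real) \<le> 2 ^ (i + j) * (fact i * fact j)"
proof -
  have "real (i + j choose i) \<le> 2 ^ (i + j)"
    using binomial_le_pow2[of "i + j" i] of_nat_mono by fastforce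
  moreover have "real (i + j choose i) = fact (i + j) / (fact i * fact j)"
    using binomial_fact[of i "i + j", where 'a = real] by simp
  ultimately show ?thesis by (simp add: field_simps)
qed

text \<open>Cosine lives in even and sine in odd degrees, so no coefficient of the combination
  receives two contributions.\<close>

lemma fps_sin_nth_le: "\<bar>fps_nth (fps_sin (t::real)) m\<bar> \<le> \<bar>t\<bar> ^ m / fact m"
  and fps_sin_plus_cos_nth_le:
    "\<bar>s\<bar> = 1 \<Longrightarrow> \<bar>fps_nth (fps_cos t + fps_const s * fps_sin (t::real)) m\<bar> \<le> \<bar>t\<bar> ^ m / fact m"
  by (auto simp: fps_sin_def fps_cos_def abs_mult power_abs)

lemma fps_sin_plus_cos_square:
  fixes t s :: real
  assumes "s\<^sup>2 = 1"
  shows "(fps_cos (t / 2) + fps_const s * fps_sin (t / 2))\<^sup>2 = 1 + fps_const s * fps_sin t"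
proof -
  let ?c = "fps_cos (t / 2)" and ?s = "fps_sin (t / 2)"
  have "(c + S * s)\<^sup>2 = c\<^sup>2 + S * S * s\<^sup>2 + S * (s * c + c * s)" for c s S :: "real fps"
    by (simp add: power2_eq_square algebra_simps)
  moreover have "fps_const s * fps_const s = 1" using assms by (simp add: power2_eq_square)
  ultimately have "(?c + fps_const s * ?s)\<^sup>2 = (?c\<^sup>2 + ?s\<^sup>2) + fps_const s * (?s * ?c + ?c * ?s)"
    by simp
  also have "?s * ?c + ?c * ?s = fps_sin t"
    using fps_sin_add[of "t / 2" "t / 2"] by simp
  finally show ?thesis by (simp add: fps_sin_cos_sum_of_squares)
qed

text \<open>Controls a truncation error below: at most \<open>(Suc N)\<^sup>2\<close> index pairs,
  each contributing at most a fixed multiple of \<open>x ^ Suc N\<close>.\<close>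

lemma square_mult_power_tendsto_0:
  fixes x :: real
  assumes "0 \<le> x" "x < 1"
  shows "(\<lambda>n. (real (Suc n))\<^sup>2 * x ^ Suc n) \<longlonglongrightarrow> 0"
proof -
  have "(\<lambda>n. real n * sqrt x ^ n) \<longlonglongrightarrow> 0"
    using assms by (intro powser_times_n_limit_0) auto
  then have "(\<lambda>n. (real (Suc n) * sqrt x ^ Suc n)\<^sup>2) \<longlonglongrightarrow> 0\<^sup>2"
    by (intro tendsto_power LIMSEQ_Suc)
  moreover have "(real (Suc n) * sqrt x ^ Suc n)\<^sup>2 = (real (Suc n))\<^sup>2 * x ^ Suc n" for n
    using assms(1) by (simp only: power_mult_distrib power_mult[symmetric] mult.commute[of "Suc n" 2])
      (simp only: power_mult real_sqrt_pow2)
  ultimately show ?thesis by (simp only: zero_power2)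
qed

section \<open>Extreme rays in the cone of positive functionals\<close>

context weighted_module
begin

text \<open>No bound on the weights is asked of \<open>L1\<close> and \<open>L2\<close>: as
  \<open>\<theta> r\<close> lies in \<open>Q\<close>, both are nonnegative there and hence at most
  \<open>L (\<theta> r)\<close>.\<close>

definition ray_extreme :: "('a \<Rightarrow> real) \<Rightarrow> bool" where
  "ray_extreme L \<longleftrightarrow> positive L \<and> (\<forall>r. L (\<theta> r) \<le> 1) \<and>
     (\<forall>L1 L2. positive L1 \<longrightarrow> positive L2 \<longrightarrow> (\<forall>x. L x = L1 x + L2 x) \<longrightarrow> (\<exists>c. \<forall>x. L1 x = c * L x))"

lemma positive_vanish:
  assumes L: "positive L" and 0: "\<And>r. L (\<theta> r) \<le> 0" and b: "bounded_above g" "bounded_above (- g)"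
  shows "L g = 0"
proof -
  have "L h \<le> 0" if h: "bounded_above h" for h
  proof -
    obtain t r where t: "t \<ge> 0" "h \<preceq> t *\<^sub>R \<theta> r" using h by (auto simp: bounded_above_def)
    have "L h \<le> t * L (\<theta> r)"
      using positive_mono[OF L t(2)] positive_linear[OF L] by (simp add: linear_scale)
    also have "\<dots> \<le> 0" using t(1) 0 by (simp add: mult_nonneg_nonpos)
    finally show ?thesis .
  qed
  from this[OF b(1)] this[OF b(2)] show ?thesis
    using positive_linear[OF L] by (simp add: linear_neg)
qed

text \<open>The Minkowski functional of the neighbourhood \<open>{g. \<exists>r. \<theta> r + g \<in> Q}\<close> of zero.\<close>
definition defect :: "'a \<Rightarrow> real" where
  "defect g = Inf {t. t \<ge> 0 \<and> (\<exists>r. - g \<preceq> t *\<^sub>R \<theta> r)}"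

context
  assumes all_bounded: "\<And>g. bounded_above g"
begin

lemma defect_nonempty: "{t. t \<ge> 0 \<and> (\<exists>r. - g \<preceq> t *\<^sub>R \<theta> r)} \<noteq> {}"
  using all_bounded[of "- g"] by (auto simp: bounded_above_def)

lemma defect_le: "t \<ge> 0 \<Longrightarrow> - g \<preceq> t *\<^sub>R \<theta> r \<Longrightarrow> defect g \<le> t"
  unfolding defect_def by (intro cInf_lower bdd_belowI[of _ 0]) auto

lemma defect_greatest:
  "(\<And>t r. t \<ge> 0 \<Longrightarrow> - g \<preceq> t *\<^sub>R \<theta> r \<Longrightarrow> m \<le> t) \<Longrightarrow> m \<le> defect g"
  unfolding defect_def using defect_nonempty by (intro cInf_greatest) auto

lemma defect_nonneg: "0 \<le> defect g"
  by (rule defect_greatest)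

lemma sublinear_defect: "sublinear defect"
  unfolding sublinear_def
proof (intro conjI allI impI)
  fix g h
  have *: "defect (g + h) \<le> t + u" if "t \<ge> 0" "- g \<preceq> t *\<^sub>R \<theta> r" "u \<ge> 0" "- h \<preceq> u *\<^sub>R \<theta> s" for t u r s
  proof -
    have "- g \<preceq> t *\<^sub>R \<theta> (max r s)" "- h \<preceq> u *\<^sub>R \<theta> (max r s)"
      using that by (auto intro: le_weight_mono)
    from le_add[OF this] show ?thesis
      using that by (intro defect_le[of _ _ "max r s"]) (auto simp: algebra_simps)
  qed
  have "defect (g + h) - u \<le> defect g" if "u \<ge> 0" "- h \<preceq> u *\<^sub>R \<theta> s" for u s
    using *[OF _ _ that] by (intro defect_greatest) (fastforce simp: algebra_simps)
  then have "defect (g + h) - defect g \<le> defect h"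
    by (intro defect_greatest) (fastforce simp: algebra_simps)
  then show "defect (g + h) \<le> defect g + defect h" by simp
next
  have le: "defect (c *\<^sub>R g) \<le> c * defect g" if "c > 0" for c g
  proof -
    have "defect (c *\<^sub>R g) / c \<le> defect g"
    proof (rule defect_greatest)
      fix t r assume t: "t \<ge> 0" "- g \<preceq> t *\<^sub>R \<theta> r"
      have "defect (c *\<^sub>R g) \<le> c * t"
        using le_scaleR[of c, OF _ t(2)] t(1) that by (intro defect_le[of _ _ r]) auto
      then show "defect (c *\<^sub>R g) / c \<le> t" using that by (simp add: field_simps)
    qed
    then show ?thesis using that by (simp add: field_simps)
  qed
  fix c :: real and g assume "c \<ge> 0"
  show "defect (c *\<^sub>R g) = c * defect g"
  proof (cases "c = 0")
    case True
    have "defect 0 \<le> 0" by (rule defect_le[of _ _ 0]) (auto simp: le_refl)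
    then show ?thesis using True defect_nonneg[of 0] by simp
  next
    case False
    then have c: "c > 0" using \<open>c \<ge> 0\<close> by simp
    have "defect ((1 / c) *\<^sub>R (c *\<^sub>R g)) \<le> (1 / c) * defect (c *\<^sub>R g)"
      using c by (intro le) auto
    then have "c * defect g \<le> defect (c *\<^sub>R g)" using c by (simp add: field_simps)
    with le[OF c, of g] show ?thesis by simp
  qed
qed

text \<open>Elements of \<open>Q\<close> have defect 0 and \<open>- \<theta> r\<close> has defect at
  most 1, so the functionals below \<open>defect\<close> are exactly the negatives of the positive
  functionals normalised by the weights.\<close>

lemma below_defect_iff:
  assumes "linear L"
  shows "(\<forall>g. - L g \<le> defect g) \<longleftrightarrow> (\<forall>q\<in>Q. L q \<ge> 0) \<and> (\<forall>r. L (\<theta> r) \<le> 1)"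
proof (intro iffI conjI ballI allI)
  assume a: "\<forall>g. - L g \<le> defect g"
  show "L q \<ge> 0" if "q \<in> Q" for q
  proof -
    have "defect q \<le> 0" using that by (intro defect_le[of _ _ 0]) (auto simp: le_def)
    then show ?thesis using a[rule_format, of q] by simp
  qed
  show "L (\<theta> r) \<le> 1" for r
  proof -
    have "defect (- \<theta> r) \<le> 1" by (intro defect_le[of _ _ r]) (auto simp: le_refl)
    then show ?thesis using a[rule_format, of "- \<theta> r"] assms by (simp add: linear_neg)
  qed
next
  fix g
  assume a: "(\<forall>q\<in>Q. L q \<ge> 0) \<and> (\<forall>r. L (\<theta> r) \<le> 1)"
  show "- L g \<le> defect g"
  proof (rule defect_greatest)
    fix t r assume t: "t \<ge> 0" "- g \<preceq> t *\<^sub>R \<theta> r"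
    then have "0 \<le> L (t *\<^sub>R \<theta> r - (- g))" using a by (auto simp: le_def)
    then have "0 \<le> t * L (\<theta> r) + L g" using assms by (simp add: linear_add linear_scale)
    also have "\<dots> \<le> t * 1 + L g" using a t(1) by (intro add_mono mult_left_mono) auto
    finally show "- L g \<le> t" by simp
  qed
qed

text \<open>An extreme point of the set of normalised positive functionals spans an extreme ray: if
  \<open>L = L1 + L2\<close> and \<open>N\<close> is the supremum of \<open>L1\<close> on the
  weights, then \<open>L2\<close> is at most \<open>1 - N\<close> there, so for
  \<open>0 < N < 1\<close> the functional \<open>L\<close> is a convex combination of
  \<open>L1 / N\<close> and \<open>L2 / (1 - N)\<close>, both in the set.\<close>

lemma ray_extreme_exists:
  assumes "\<epsilon> > 0" "\<And>r. f + \<epsilon> *\<^sub>R \<theta> r \<notin> Q"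
  obtains L where "ray_extreme L" "L f < 0"
proof -
  obtain M where M: "linear M" "\<And>x. M x \<le> defect x" "M f = defect f"
    and ext: "\<And>L1 L2 u w x. linear L1 \<Longrightarrow> linear L2 \<Longrightarrow> u > 0 \<Longrightarrow> w > 0 \<Longrightarrow> u + w = 1 \<Longrightarrow>
      (\<And>x. L1 x \<le> defect x) \<Longrightarrow> (\<And>x. L2 x \<le> defect x) \<Longrightarrow> (\<And>x. M x = u * L1 x + w * L2 x) \<Longrightarrow> L1 x = M x"
    using extreme_functional_below_sublinear[OF sublinear_defect, of f] by blast
  define L where "L x = - M x" for x
  have lin: "linear L" using M(1) unfolding L_def by (rule linear_compose_neg)
  have bd: "\<forall>q\<in>Q. L q \<ge> 0" "\<And>r. L (\<theta> r) \<le> 1"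
    using below_defect_iff[OF lin] M(2) by (auto simp: L_def)
  have pos: "positive L" using lin bd(1) by (simp add: positive_def)
  have "\<epsilon> \<le> defect f"
  proof (rule defect_greatest)
    fix t r assume t: "t \<ge> 0" "- f \<preceq> t *\<^sub>R \<theta> r"
    show "\<epsilon> \<le> t"
    proof (rule ccontr)
      assume "\<not> \<epsilon> \<le> t"
      then have "- f \<preceq> \<epsilon> *\<^sub>R \<theta> r" using t by (intro le_weight_mono[OF t(2,1)]) auto
      then show False using assms(2)[of r] by (simp add: le_def add.commute)
    qed
  qed
  then have "L f < 0" using M(3) assms(1) by (simp add: L_def)
  moreover have "\<exists>c. \<forall>x. L1 x = c * L x"
    if L1: "positive L1" and L2: "positive L2" and sum: "\<forall>x. L x = L1 x + L2 x" for L1 L2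
  proof -
    have nn: "0 \<le> L1 (\<theta> r)" "0 \<le> L2 (\<theta> r)" for r
      using weight_nonneg[of r] L1 L2 by (auto simp: le_def intro: positive_nonneg)
    have le1: "L1 (\<theta> r) \<le> 1" for r using nn[of r] bd(2)[of r] sum by (auto simp: algebra_simps)
    define N where "N = (SUP r. L1 (\<theta> r))"
    have bdd: "bdd_above (range (\<lambda>r. L1 (\<theta> r)))" using le1 by (intro bdd_aboveI2) auto
    have N: "L1 (\<theta> r) \<le> N" for r unfolding N_def by (rule cSUP_upper[OF UNIV_I bdd])
    \<comment> \<open>Different indices are needed to add the two suprema; monotonicity of the
      weights moves both to \<open>max r s\<close>.\<close>
    have "L1 (\<theta> r) + L2 (\<theta> s) \<le> 1" for r s
    proof -
      have "L1 (\<theta> r) \<le> L1 (\<theta> (max r s))" "L2 (\<theta> s) \<le> L2 (\<theta> (max r s))"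
        using positive_mono[OF L1 weight_mono] positive_mono[OF L2 weight_mono] by auto
      then show ?thesis using bd(2)[of "max r s"] sum by (auto simp: algebra_simps)
    qed
    then have "L1 (\<theta> r) \<le> 1 - L2 (\<theta> s)" for r s by (simp add: algebra_simps)
    then have "N \<le> 1 - L2 (\<theta> s)" for s unfolding N_def by (intro cSUP_least) auto
    then have N2: "L2 (\<theta> s) \<le> 1 - N" for s by (simp add: algebra_simps)
    have N01: "0 \<le> N" "N \<le> 1" using nn[of 0] N[of 0] N2[of 0] by linarith+
    consider "N = 0" | "N = 1" | "0 < N" "N < 1" using N01 by fastforce
    then show ?thesis
    proof cases
      \<comment> \<open>A positive functional that is at most 0 on all weights vanishes, because
        every element and its negative is bounded by a multiple of a weight.\<close>
      case 1
      then have "L1 x = 0" for x using N all_bounded by (intro positive_vanish[OF L1]) auto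
      then show ?thesis by (intro exI[of _ 0]) auto
    next
      case 2
      then have "L2 x = 0" for x using N2 all_bounded by (intro positive_vanish[OF L2]) auto
      then show ?thesis using sum by (intro exI[of _ 1]) auto
    next
      case 3
      have below: "- (c *\<^sub>R H g) \<le> defect g"
        if "positive H" "c > 0" "\<And>r. H (\<theta> r) \<le> 1 / c" for H c g
      proof -
        have lin: "linear (\<lambda>x. c *\<^sub>R H x)" using positive_linear[OF that(1)] by (rule linear_compose_scale_right)
        have "\<forall>g. - (c *\<^sub>R H g) \<le> defect g"
          using that positive_nonneg[OF that(1)] by (subst below_defect_iff[OF lin]) (auto simp: field_simps)
        then show ?thesis by blast
      qed
      define A where "A x = - ((1 / N) *\<^sub>R L1 x)" for x
      define B where "B x = - ((1 / (1 - N)) *\<^sub>R L2 x)" for x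
      have A: "linear A" "\<And>x. A x \<le> defect x"
        unfolding A_def using 3 N L1 below[of L1 "1 / N"] positive_linear[OF L1]
        by (auto intro!: linear_compose_neg linear_compose_scale_right simp del: real_scaleR_def)
      have B: "linear B" "\<And>x. B x \<le> defect x"
        unfolding B_def using 3 N2 L2 below[of L2 "1 / (1 - N)"] positive_linear[OF L2]
        by (auto intro!: linear_compose_neg linear_compose_scale_right simp del: real_scaleR_def)
      have "M x = N * A x + (1 - N) * B x" for x
      proof -
        have "N * A x = - L1 x" "(1 - N) * B x = - L2 x" using 3 by (simp_all add: A_def B_def)
        moreover have "M x = - (L1 x + L2 x)" using sum[rule_format, of x] by (simp add: L_def)
        ultimately show ?thesis by linarith
      qed
      then have AM: "A x = M x" for x
        using 3 by (intro ext[OF A(1) B(1), of N "1 - N"] A(2) B(2)) auto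
      have "L1 x = N * L x" for x
      proof -
        have "L1 x = - (N * A x)" using 3 by (simp add: A_def)
        then show ?thesis using AM[of x] by (simp add: L_def)
      qed
      then show ?thesis by blast
    qed
  qed
  ultimately show ?thesis using that pos bd(2) unfolding ray_extreme_def by blast
qed

end

text \<open>Cauchy-Schwarz splits off \<open>p\<close>, and \<open>D = 2 * sqrt c\<close> comes from
  the square root of \<open>c ^ Suc m * 4 ^ m\<close>. Only \<open>K\<close> depends on
  \<open>L\<close> and \<open>p\<close>, so one radius of convergence serves all
  \<open>p\<close>.\<close>

lemma factorial_growth_functional_le:
  assumes "factorial_growth v"
  obtains D where "D > 0"
    "\<And>L p. positive L \<Longrightarrow> (\<And>r. L (\<theta> r) \<le> 1) \<Longrightarrow> \<exists>K\<ge>0. \<forall>m. \<bar>L (p * v ^ m)\<bar> \<le> K * D ^ m * fact m"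
proof -
  obtain c where c: "c \<ge> 1" "\<And>k. \<exists>r. v ^ (2 * k) \<preceq> (c ^ Suc k * fact (2 * k)) *\<^sub>R \<theta> r"
    using assms unfolding factorial_growth_def by blast
  have "\<exists>K\<ge>0. \<forall>m. \<bar>L (p * v ^ m)\<bar> \<le> K * (2 * sqrt c) ^ m * fact m"
    if L: "positive L" and L1: "\<And>r. L (\<theta> r) \<le> 1" for L p
  proof (intro exI conjI allI)
    fix m
    have Lv: "L ((v ^ m)\<^sup>2) \<le> c ^ Suc m * fact (2 * m)"
    proof -
      obtain r where r: "v ^ (2 * m) \<preceq> (c ^ Suc m * fact (2 * m)) *\<^sub>R \<theta> r" using c(2) by blast
      have "L (v ^ (2 * m)) \<le> (c ^ Suc m * fact (2 * m)) * L (\<theta> r)"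
        using positive_mono[OF L r] positive_linear[OF L] by (simp add: linear_scale)
      also have "\<dots> \<le> (c ^ Suc m * fact (2 * m)) * 1"
        using c(1) by (intro mult_left_mono L1) auto
      finally show ?thesis by (simp add: mult.commute flip: power_mult)
    qed
    have Lp: "L (p\<^sup>2) \<ge> 0" by (rule positive_nonneg[OF L square_mem])
    have "(L (p * v ^ m))\<^sup>2 \<le> L (p\<^sup>2) * L ((v ^ m)\<^sup>2)" by (rule positive_cauchy_schwarz[OF L])
    also have "\<dots> \<le> L (p\<^sup>2) * (c ^ Suc m * (4 ^ m * (fact m)\<^sup>2))"
      using Lv c(1) fact_double_le[of m] Lp
      by (intro mult_left_mono) (auto intro: order_trans mult_left_mono)
    also have "\<dots> = (sqrt (c * L (p\<^sup>2)) * (2 * sqrt c) ^ m * fact m)\<^sup>2"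
    proof -
      have "((2 * sqrt c) ^ m)\<^sup>2 = ((2 * sqrt c)\<^sup>2) ^ m"
        by (metis power_mult mult.commute)
      also have "\<dots> = 4 ^ m * c ^ m" using c(1) by (simp add: power_mult_distrib)
      finally show ?thesis using c(1) Lp by (simp add: power_mult_distrib)
    qed
    finally show "\<bar>L (p * v ^ m)\<bar> \<le> sqrt (c * L (p\<^sup>2)) * (2 * sqrt c) ^ m * fact m"
      using c(1) Lp by (subst (asm) abs_le_square_iff[symmetric]) auto
    show "sqrt (c * L (p\<^sup>2)) \<ge> 0" using c(1) Lp by simp
  qed
  then show ?thesis using c(1) by (intro that[of "2 * sqrt c"]) auto
qed

end

text \<open>Truncating a square of a power series \<open>h\<close> gives squares in the ring, and the
  factorial decay of the coefficients makes the truncation error vanish.\<close>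
lemma fps_square_truncation_limit:
  fixes h :: "real fps" and B :: "nat \<Rightarrow> real"
  assumes h: "\<And>m. \<bar>fps_nth h m\<bar> \<le> (t / 2) ^ m / fact m"
    and B: "\<And>m. \<bar>B m\<bar> \<le> K * D ^ m * fact m"
    and nn: "0 \<le> t" "0 < D" "0 \<le> K" "t * D < 1"
    and sm: "summable (\<lambda>m. fps_nth (h\<^sup>2) m * B m)"
    and pos: "\<And>N. 0 \<le> (\<Sum>i\<le>N. \<Sum>j\<le>N. fps_nth h i * fps_nth h j * B (i + j))"
  shows "0 \<le> suminf (\<lambda>m. fps_nth (h\<^sup>2) m * B m)"
proof -
  define a where "a i j = fps_nth h i * fps_nth h j * B (i + j)" for i j
  define x where "x = t * D"
  have x: "0 \<le> x" "x < 1" using nn by (auto simp: x_def)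
  \<comment> \<open>The \<open>2 ^ (i + j)\<close> from the estimate of \<open>fact (i + j)\<close>
    cancels against the coefficients in \<open>t / 2\<close> and leaves powers of
    \<open>t * D\<close>.\<close>
  have a: "\<bar>a i j\<bar> \<le> K * x ^ (i + j)" for i j
  proof -
    have "\<bar>a i j\<bar> \<le> (t / 2) ^ i / fact i * ((t / 2) ^ j / fact j) * (K * D ^ (i + j) * fact (i + j))"
      unfolding a_def abs_mult using nn by (intro mult_mono h B) auto
    also have "\<dots> = K * x ^ (i + j) * (fact (i + j) / (2 ^ (i + j) * (fact i * fact j)))"
      by (simp add: x_def power_add power_mult_distrib power_divide field_simps)
    also have "\<dots> \<le> K * x ^ (i + j) * 1"
      using fact_add_le[of i j] nn x by (intro mult_left_mono) (auto simp: field_simps)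
    finally show ?thesis by simp
  qed
  have part: "(\<Sum>m\<le>N. fps_nth (h\<^sup>2) m * B m) = (\<Sum>(i,j)\<in>{(i,j). i + j \<le> N}. a i j)" for N
    unfolding sum.triangle_reindex_eq
    by (simp add: power2_eq_square fps_mult_nth a_def sum_distrib_right atLeast0AtMost)
  \<comment> \<open>The partial sum of the squared series runs over \<open>i + j \<le> N\<close>,
    the square of the truncation over all \<open>i, j \<le> N\<close>. The surplus pairs have
    \<open>i + j > N\<close>, so their total is bounded by a quantity that tends to 0.\<close>
  have tail: "- (K * ((real (Suc N))\<^sup>2 * x ^ Suc N)) \<le> (\<Sum>m\<le>N. fps_nth (h\<^sup>2) m * B m)" for N
  proof -
    let ?S = "{..N} \<times> {..N}" and ?T = "{(i,j). i + j \<le> N}"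
    have sub: "?T \<subseteq> ?S" and fin: "finite ?S" by auto
    have "(\<Sum>(i,j)\<in>?S. a i j) = (\<Sum>(i,j)\<in>?S - ?T. a i j) + (\<Sum>(i,j)\<in>?T. a i j)"
      using sum.subset_diff[OF sub fin] by blast
    moreover have "(\<Sum>(i,j)\<in>?S - ?T. a i j) \<le> K * ((real (Suc N))\<^sup>2 * x ^ Suc N)"
    proof -
      have "(\<Sum>(i,j)\<in>?S - ?T. a i j) \<le> (\<Sum>(i,j)\<in>?S - ?T. K * x ^ Suc N)"
      proof (rule sum_mono)
        fix z assume "z \<in> ?S - ?T"
        then obtain i j where z: "z = (i, j)" "\<not> i + j \<le> N" by auto
        then have "x ^ (i + j) \<le> x ^ Suc N" using x by (intro power_decreasing) auto
        then have "K * x ^ (i + j) \<le> K * x ^ Suc N" using nn by (intro mult_left_mono)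
        then show "(case z of (i, j) \<Rightarrow> a i j) \<le> (case z of (i, j) \<Rightarrow> K * x ^ Suc N)"
          using a[of i j] z(1) by simp
      qed
      also have "\<dots> = real (card (?S - ?T)) * (K * x ^ Suc N)" by (simp add: split_def)
      also have "\<dots> \<le> (real (Suc N))\<^sup>2 * (K * x ^ Suc N)"
      proof (rule mult_right_mono)
        have "card (?S - ?T) \<le> card ?S" by (intro card_mono) auto
        then have "card (?S - ?T) \<le> (Suc N)\<^sup>2" by (simp add: card_cartesian_product power2_eq_square)
        then show "real (card (?S - ?T)) \<le> (real (Suc N))\<^sup>2"
          by (metis of_nat_le_iff of_nat_power)
      qed (use nn x in auto)
      finally show ?thesis by (simp add: algebra_simps)
    qed
    moreover have "(\<Sum>(i,j)\<in>?S. a i j) \<ge> 0"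
      using pos[of N] by (simp add: sum.cartesian_product a_def)
    ultimately show ?thesis unfolding part by linarith
  qed
  have lim1: "(\<lambda>N. \<Sum>m\<le>N. fps_nth (h\<^sup>2) m * B m) \<longlonglongrightarrow> suminf (\<lambda>m. fps_nth (h\<^sup>2) m * B m)"
    using summable_LIMSEQ'[OF sm] .
  have "(\<lambda>N. - (K * ((real (Suc N))\<^sup>2 * x ^ Suc N))) \<longlonglongrightarrow> - (K * 0)"
    using square_mult_power_tendsto_0[OF x] by (intro tendsto_intros)
  then show ?thesis using tail lim1 by (intro LIMSEQ_le[OF _ lim1]) auto
qed

section \<open>Multiplicativity of extreme functionals\<close>

context weighted_module
begin

definition sin_functional :: "real \<Rightarrow> 'a \<Rightarrow> ('a \<Rightarrow> real) \<Rightarrow> 'a \<Rightarrow> real" where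
  "sin_functional t v L p = suminf (\<lambda>m. fps_nth (fps_sin t) m * L (p * v ^ m))"

text \<open>Extremality makes \<open>sin_functional t v L\<close> proportional to \<open>L\<close>
  for small \<open>t \<ge> 0\<close>. The resulting relation is a power series in \<open>t\<close>
  that vanishes on an interval to the right of 0; its linear coefficient is the claim.\<close>

lemma ray_extreme_mult:
  assumes L: "ray_extreme L" and v: "factorial_growth v"
  shows "L (p * v) * L 1 = L v * L p"
proof -
  have pos: "positive L" and le1: "\<And>r. L (\<theta> r) \<le> 1"
    and ext: "\<And>L1 L2. positive L1 \<Longrightarrow> positive L2 \<Longrightarrow> (\<forall>x. L x = L1 x + L2 x) \<Longrightarrow> \<exists>c. \<forall>x. L1 x = c * L x"
    using L by (auto simp: ray_extreme_def)
  note lin = positive_linear[OF pos]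
  obtain D where D: "D > 0" and Db: "\<And>p. \<exists>K\<ge>0. \<forall>m. \<bar>L (p * v ^ m)\<bar> \<le> K * D ^ m * fact m"
    using factorial_growth_functional_le[OF v] pos le1 by metis
  have sm: "summable (\<lambda>m. fps_nth (fps_sin t) m * L (p * v ^ m))" if t: "\<bar>t\<bar> * D < 1" for t p
  proof -
    obtain K where K: "K \<ge> 0" "\<And>m. \<bar>L (p * v ^ m)\<bar> \<le> K * D ^ m * fact m" using Db by blast
    show ?thesis
    proof (rule summable_comparison_test')
      show "summable (\<lambda>m. K * (\<bar>t\<bar> * D) ^ m)" using t D by (intro summable_mult summable_geometric) auto
      fix m
      have "\<bar>fps_nth (fps_sin t) m * L (p * v ^ m)\<bar> \<le> \<bar>t\<bar> ^ m / fact m * (K * D ^ m * fact m)"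
        unfolding abs_mult by (intro mult_mono fps_sin_nth_le K) auto
      then show "norm (fps_nth (fps_sin t) m * L (p * v ^ m)) \<le> K * (\<bar>t\<bar> * D) ^ m"
        by (simp add: power_mult_distrib field_simps)
    qed
  qed
  have linS: "linear (sin_functional t v L)" if t: "\<bar>t\<bar> * D < 1" for t
  proof (rule linearI)
    fix p q
    show "sin_functional t v L (p + q) = sin_functional t v L p + sin_functional t v L q"
      unfolding sin_functional_def suminf_add[OF sm[OF t] sm[OF t]]
      by (simp add: distrib_right distrib_left linear_add[OF lin])
  next
    fix c p
    show "sin_functional t v L (c *\<^sub>R p) = c *\<^sub>R sin_functional t v L p"
      unfolding sin_functional_def using suminf_mult[OF sm[OF t], of c p]
      by (simp add: linear_scale[OF lin] mult.left_commute)
  qed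
  have posS: "0 \<le> L q + s * sin_functional t v L q"
    if t: "0 \<le> t" "t * D < 1" and s: "\<bar>s\<bar> = 1" and q: "q \<in> Q" for t s q
  proof -
    have t': "\<bar>t\<bar> * D < 1" using t by simp
    have s2: "s\<^sup>2 = 1" using s by (metis power2_abs one_power2)
    define h where "h = fps_cos (t / 2) + fps_const s * fps_sin (t / 2)"
    have h2: "h\<^sup>2 = 1 + fps_const s * fps_sin t"
      unfolding h_def by (rule fps_sin_plus_cos_square[OF s2])
    have coeff: "fps_nth (h\<^sup>2) m * L (q * v ^ m)
        = (if m = 0 then L q else 0) + s * (fps_nth (fps_sin t) m * L (q * v ^ m))" for m
      by (simp add: h2 algebra_simps)
    have sums: "(\<lambda>m. fps_nth (h\<^sup>2) m * L (q * v ^ m)) sums (L q + s * sin_functional t v L q)"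
      unfolding coeff sin_functional_def
      by (intro sums_add sums_mult summable_sums sm t') (rule sums_single)
    obtain K where K: "K \<ge> 0" "\<And>m. \<bar>L (q * v ^ m)\<bar> \<le> K * D ^ m * fact m" using Db by blast
    have "0 \<le> suminf (\<lambda>m. fps_nth (h\<^sup>2) m * L (q * v ^ m))"
    proof (rule fps_square_truncation_limit[where K = K and D = D and t = t])
      show "\<bar>fps_nth h m\<bar> \<le> (t / 2) ^ m / fact m" for m
        unfolding h_def using fps_sin_plus_cos_nth_le[OF s, of "t / 2" m] t(1) by simp
      show "0 \<le> (\<Sum>i\<le>N. \<Sum>j\<le>N. fps_nth h i * fps_nth h j * L (q * v ^ (i + j)))" for N
      proof -
        have "(\<Sum>i\<le>N. fps_nth h i *\<^sub>R v ^ i)\<^sup>2 * q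
            = (\<Sum>i\<le>N. \<Sum>j\<le>N. (fps_nth h i * fps_nth h j) *\<^sub>R (q * v ^ (i + j)))"
          unfolding power2_eq_square sum_product
          by (simp add: sum_distrib_left power_add mult_ac)
        then have "L ((\<Sum>i\<le>N. fps_nth h i *\<^sub>R v ^ i)\<^sup>2 * q)
            = (\<Sum>i\<le>N. \<Sum>j\<le>N. fps_nth h i * fps_nth h j * L (q * v ^ (i + j)))"
          by (simp add: linear_sum[OF lin] linear_scale[OF lin])
        then show ?thesis using positive_nonneg[OF pos square_mult_mem[OF q]] by metis
      qed
      show "summable (\<lambda>m. fps_nth (h\<^sup>2) m * L (q * v ^ m))" using sums by (rule sums_summable)
    qed (use K D t in auto)
    then show ?thesis using sums_unique[OF sums] by simp
  qed
  have proportional: "sin_functional t v L p * L 1 = sin_functional t v L 1 * L p" if t: "0 \<le> t" "t * D < 1" for t p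
  proof -
    have linS': "linear (sin_functional t v L)" using linS t by simp
    have P: "positive (\<lambda>x. (1 / 2) *\<^sub>R (L x + s *\<^sub>R sin_functional t v L x))" if s: "\<bar>s\<bar> = 1" for s
      unfolding positive_def
    proof (intro conjI ballI)
      show "linear (\<lambda>x. (1 / 2) *\<^sub>R (L x + s *\<^sub>R sin_functional t v L x))"
        by (intro linear_compose_scale_right linear_compose_add lin linS')
    qed (use posS[OF t s] in simp)
    have "\<exists>c. \<forall>x. (1 / 2) *\<^sub>R (L x + 1 *\<^sub>R sin_functional t v L x) = c * L x"
      by (rule ext[OF P[of 1] P[of "-1"]]) (auto simp: add_divide_distrib diff_divide_distrib)
    then obtain c where c: "\<And>x. (1 / 2) *\<^sub>R (L x + 1 *\<^sub>R sin_functional t v L x) = c * L x" by blast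
    have "sin_functional t v L x = (2 * c - 1) * L x" for x
      using c[of x] by (simp add: field_simps)
    then show ?thesis by simp
  qed
  \<comment> \<open>The coefficient of \<open>t ^ m\<close> in the difference of the two sides of
    \<open>proportional\<close>; \<open>C 1\<close> is
    \<open>L (p * v) * L 1 - L v * L p\<close>.\<close>
  define C where "C m = fps_nth (fps_sin 1) m * (L (p * v ^ m) * L 1 - L (v ^ m) * L p)" for m
  have sinpow: "fps_nth (fps_sin t) m = fps_nth (fps_sin 1) m * t ^ m" for t :: real and m
    by (simp add: fps_sin_def)
  have Csums: "(\<lambda>m. C m * t ^ m) sums (sin_functional t v L p * L 1 - sin_functional t v L 1 * L p)"
    if t: "\<bar>t\<bar> * D < 1" for t
  proof -
    have "(\<lambda>m. fps_nth (fps_sin t) m * L (p * v ^ m) * L 1 - fps_nth (fps_sin t) m * L (1 * v ^ m) * L p)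
        sums (sin_functional t v L p * L 1 - sin_functional t v L 1 * L p)"
      unfolding sin_functional_def by (intro sums_diff sums_mult2 summable_sums sm t)
    then show ?thesis by (simp add: C_def sinpow[of t] algebra_simps)
  qed
  define T where "T = 1 / (2 * D)"
  have T: "T > 0" "T * D < 1" using D by (auto simp: T_def)
  have "summable (\<lambda>n. C n * T ^ n)" using Csums[of T] T sums_summable by auto
  then have der: "((\<lambda>t. suminf (\<lambda>n. C n * t ^ n)) has_field_derivative suminf (\<lambda>n. diffs C n * 0 ^ n)) (at 0)"
    using T by (intro termdiffs_strong) auto
  have C0: "suminf (\<lambda>n. C n * t ^ n) = 0" if "0 \<le> t" "t < T" for t
  proof -
    have "t * D \<le> T * D" using that D by (intro mult_right_mono) auto
    then have tD: "t * D < 1" using T by simp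
    then show ?thesis using sums_unique[OF Csums[of t]] proportional[of t p] that by simp
  qed
  \<comment> \<open>Vanishing is known only for \<open>t \<ge> 0\<close>, so the derivative at 0 is
    evaluated as a limit from the right.\<close>
  have "((\<lambda>t. suminf (\<lambda>n. C n * t ^ n)) has_field_derivative suminf (\<lambda>n. diffs C n * 0 ^ n)) (at_right 0)"
    using der by (rule has_field_derivative_at_within)
  then have "((\<lambda>t. (suminf (\<lambda>n. C n * t ^ n) - suminf (\<lambda>n. C n * 0 ^ n)) / (t - 0)) \<longlongrightarrow> suminf (\<lambda>n. diffs C n * 0 ^ n)) (at_right 0)"
    by (simp only: has_field_derivative_iff)
  moreover have "eventually (\<lambda>t. (suminf (\<lambda>n. C n * t ^ n) - suminf (\<lambda>n. C n * 0 ^ n)) / (t - 0) = 0) (at_right 0)"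
  proof -
    have "(suminf (\<lambda>n. C n * t ^ n) - suminf (\<lambda>n. C n * 0 ^ n)) / (t - 0) = 0" if "t \<in> {0<..<T}" for t
      using C0[of t] C0[of 0] that T(1) by simp
    then show ?thesis
      using eventually_at_right_real[OF T(1)] by (rule eventually_mono[rotated]) auto
  qed
  ultimately have "((\<lambda>t::real. 0) \<longlongrightarrow> suminf (\<lambda>n. diffs C n * 0 ^ n)) (at_right 0)"
    by (rule Lim_transform_eventually)
  then have "suminf (\<lambda>n. diffs C n * 0 ^ n) = 0"
    by (simp add: tendsto_const_iff)
  then have "C 1 = 0" by (simp only: powser_zero) (simp add: diffs_def)
  then show ?thesis by (simp add: C_def)
qed

text \<open>The bound on the weights is recorded because it later bounds
  \<open>\<phi> (mmap (Phi r))\<close> uniformly in \<open>r\<close>.\<close>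

definition character :: "('a \<Rightarrow> real) \<Rightarrow> bool" where
  "character \<phi> \<longleftrightarrow> linear \<phi> \<and> \<phi> 1 = 1 \<and> (\<forall>x y. \<phi> (x * y) = \<phi> x * \<phi> y) \<and> (\<forall>q\<in>Q. \<phi> q \<ge> 0) \<and>
     (\<exists>C. \<forall>r. \<phi> (\<theta> r) \<le> C)"

text \<open>The sine argument yields multiplicativity only against elements of factorial growth;
  induction over the algebra they generate extends it to all factors.\<close>

theorem weighted_positivstellensatz:
  assumes V: "\<And>v. v \<in> V \<Longrightarrow> factorial_growth v" and gen: "generated_algebra V = UNIV"
    and f: "\<And>\<phi>. character \<phi> \<Longrightarrow> \<phi> f \<ge> 0" and \<epsilon>: "\<epsilon> > 0"
  shows "\<exists>r. f + \<epsilon> *\<^sub>R \<theta> r \<in> Q"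
proof (rule ccontr)
  assume "\<not> ?thesis"
  then have notin: "f + \<epsilon> *\<^sub>R \<theta> r \<notin> Q" for r by blast
  have bnd: "bounded_above g" for g
    using power_bounded_generated[of V g] factorial_growth_power_bounded[OF V] gen
    by (intro power_bounded_imp_bounded_above) auto
  obtain L where L: "ray_extreme L" "L f < 0"
    using ray_extreme_exists[OF bnd \<epsilon> notin] by blast
  then have pos: "positive L" and le1: "\<And>r. L (\<theta> r) \<le> 1" by (auto simp: ray_extreme_def)
  note lin = positive_linear[OF pos]
  \<comment> \<open>If \<open>L 1\<close> were 0, Cauchy-Schwarz against 1 would give
    \<open>L f = 0\<close>.\<close>
  have L1: "L 1 > 0"
  proof (rule ccontr)
    assume "\<not> L 1 > 0"
    then have "L 1 = 0" using positive_nonneg[OF pos one_mem] by simp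
    moreover have "(L (1 * f))\<^sup>2 \<le> L (1\<^sup>2) * L (f\<^sup>2)" by (rule positive_cauchy_schwarz[OF pos])
    ultimately show False using L(2) by simp
  qed
  define \<phi> where "\<phi> x = (1 / L 1) *\<^sub>R L x" for x
  have lin\<phi>: "linear \<phi>" unfolding \<phi>_def using lin by (rule linear_compose_scale_right)
  have mult: "\<forall>p. \<phi> (p * q) = \<phi> p * \<phi> q" for q
  proof -
    have "q \<in> generated_algebra V" using gen by simp
    then show ?thesis
    proof induction
      case (const c)
      have "p * of_real c = c *\<^sub>R p" "(of_real c ::'a) = c *\<^sub>R 1" for p :: 'a
        by (simp_all add: scaleR_conv_of_real mult.commute)
      then show ?case using L1 by (simp add: \<phi>_def linear_scale[OF lin])
    next
      case (gen v)
      have "L (p * v) * L 1 = L v * L p" for p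
        by (rule ray_extreme_mult[OF L(1) V[OF gen]])
      then show ?case using L1 by (simp add: \<phi>_def field_simps)
    next
      case (add x y)
      then show ?case using lin\<phi> by (simp add: distrib_left linear_add)
    next
      case (mult x y)
      then show ?case by (simp flip: mult.assoc)
    qed
  qed
  have "character \<phi>"
    unfolding character_def
  proof (intro conjI exI[of _ "1 / L 1"] allI ballI)
    show "\<phi> (\<theta> r) \<le> 1 / L 1" for r using le1[of r] L1 by (simp add: \<phi>_def field_simps)
    show "0 \<le> \<phi> q" if "q \<in> Q" for q using positive_nonneg[OF pos that] L1 by (simp add: \<phi>_def)
  qed (use lin\<phi> mult L1 in \<open>auto simp: \<phi>_def\<close>)
  then have "\<phi> f \<ge> 0" by (rule f)
  then show False using L(2) L1 by (simp add: \<phi>_def field_simps)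
qed

end

section \<open>Separation of cones in finite dimensions\<close>

definition blunt_cone :: "'a::real_vector set \<Rightarrow> bool" where
  "blunt_cone C \<longleftrightarrow> 0 \<notin> C \<and> (\<forall>x\<in>C. \<forall>y\<in>C. x + y \<in> C) \<and> (\<forall>x\<in>C. \<forall>t>0. t *\<^sub>R x \<in> C)"

text \<open>If neither \<open>y\<close> nor \<open>- y\<close> belonged to a maximal cone
  \<open>D\<close>, for some \<open>y \<noteq> 0\<close>, adjoining the ray of \<open>y\<close>
  would enlarge it: 0 could enter only as \<open>d + t *\<^sub>R y\<close> with
  \<open>t > 0\<close>, which puts \<open>- y\<close> into \<open>D\<close>.\<close>

lemma blunt_cone_maximal:
  assumes C: "blunt_cone C"
  obtains D where "C \<subseteq> D" "blunt_cone D" "\<And>y. y \<noteq> 0 \<Longrightarrow> y \<in> D \<or> - y \<in> D"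
proof -
  define \<A> where "\<A> = {D. C \<subseteq> D \<and> blunt_cone D}"
  have "\<exists>M\<in>\<A>. \<forall>X\<in>\<A>. M \<subseteq> X \<longrightarrow> X = M"
  proof (rule subset_Zorn_nonempty)
    show "\<A> \<noteq> {}" using C by (auto simp: \<A>_def)
    fix \<C> assume ne: "\<C> \<noteq> {}" and ch: "subset.chain \<A> \<C>"
    have mem: "\<And>D. D \<in> \<C> \<Longrightarrow> C \<subseteq> D \<and> blunt_cone D"
      and tot: "\<And>D E. D \<in> \<C> \<Longrightarrow> E \<in> \<C> \<Longrightarrow> D \<subseteq> E \<or> E \<subseteq> D"
      using ch by (auto simp: subset_chain_def \<A>_def)
    have "x + y \<in> \<Union>\<C>" if xy: "x \<in> \<Union>\<C>" "y \<in> \<Union>\<C>" for x y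
    proof -
      obtain D E where DE: "D \<in> \<C>" "x \<in> D" "E \<in> \<C>" "y \<in> E" using xy by blast
      then obtain F where "F \<in> \<C>" "x \<in> F" "y \<in> F" using tot[of D E] by blast
      then show ?thesis using mem[of F] by (auto simp: blunt_cone_def)
    qed
    then have "blunt_cone (\<Union>\<C>)"
      using mem unfolding blunt_cone_def by blast
    then show "\<Union>\<C> \<in> \<A>" using mem ne by (auto simp: \<A>_def)
  qed
  then obtain D where D: "C \<subseteq> D" "blunt_cone D" and max: "\<And>X. D \<subseteq> X \<Longrightarrow> blunt_cone X \<Longrightarrow> X = D"
    unfolding \<A>_def by auto
  have add: "x + y \<in> D" if "x \<in> D" "y \<in> D" for x y using that D(2) by (auto simp: blunt_cone_def)
  have scl: "t *\<^sub>R x \<in> D" if "x \<in> D" "t > 0" for x t using that D(2) by (auto simp: blunt_cone_def)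
  have add0: "x + y \<in> insert 0 D" if "x \<in> insert 0 D" "y \<in> insert 0 D" for x y using that add by auto
  have "y \<in> D" if y: "y \<noteq> 0" "- y \<notin> D" for y
  proof -
    define X where "X = D \<union> {d + t *\<^sub>R y | d t. d \<in> insert 0 D \<and> t > 0}"
    have XI: "d + t *\<^sub>R y \<in> X" if "d \<in> insert 0 D" "t > 0" for d t using that by (auto simp: X_def)
    \<comment> \<open>The clause for \<open>t = 0\<close> rules out
      \<open>0 + 0 *\<^sub>R y\<close>, a combination that must stay outside
      \<open>X\<close>.\<close>
    have XE: "\<exists>d t. x = d + t *\<^sub>R y \<and> d \<in> insert 0 D \<and> t \<ge> 0 \<and> (t = 0 \<longrightarrow> d \<in> D)" if "x \<in> X" for x
      using that unfolding X_def by (force intro: exI[of _ 0])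
    have XI': "d + t *\<^sub>R y \<in> X" if "d \<in> insert 0 D" "t \<ge> 0" "t = 0 \<longrightarrow> d \<in> D" for d t
    proof (cases "t = 0")
      case True
      then show ?thesis using that by (simp add: X_def)
    next
      case False
      then show ?thesis using that by (intro XI) auto
    qed
    have "blunt_cone X"
      unfolding blunt_cone_def
    proof (intro conjI ballI allI impI)
      show "0 \<notin> X"
      proof
        assume "0 \<in> X"
        then obtain d t where d: "0 = d + t *\<^sub>R y" "d \<in> insert 0 D" "t \<ge> 0" "t = 0 \<longrightarrow> d \<in> D"
          using XE by blast
        have D0: "0 \<notin> D" using D(2) by (auto simp: blunt_cone_def)
        have "t > 0" using d D0 by (cases "t = 0") auto
        then have "- y = (1 / t) *\<^sub>R d" using d(1)
          by (metis add_eq_0_iff2 scaleR_minus_right scaleR_scaleR nonzero_divide_eq_eq order_less_irrefl scaleR_one)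
        then show False using \<open>t > 0\<close> d(2) y scl[of d "1 / t"] by auto
      qed
    next
      fix u v assume "u \<in> X" "v \<in> X"
      then obtain d t e s where u: "u = d + t *\<^sub>R y" "d \<in> insert 0 D" "t \<ge> 0" "t = 0 \<longrightarrow> d \<in> D"
        and v: "v = e + s *\<^sub>R y" "e \<in> insert 0 D" "s \<ge> 0" "s = 0 \<longrightarrow> e \<in> D" using XE by meson
      have "(d + e) + (t + s) *\<^sub>R y \<in> X"
        using u v add0[of d e] add[of d e] by (intro XI') auto
      then show "u + v \<in> X" using u v by (simp add: algebra_simps)
    next
      fix u and r :: real assume "u \<in> X" and r: "r > 0"
      then obtain d t where u: "u = d + t *\<^sub>R y" "d \<in> insert 0 D" "t \<ge> 0" "t = 0 \<longrightarrow> d \<in> D"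
        using XE by blast
      have "r *\<^sub>R d + (r * t) *\<^sub>R y \<in> X" using u r scl[of d r] by (intro XI') auto
      then show "r *\<^sub>R u \<in> X" using u by (simp add: algebra_simps)
    qed
    then have "X = D" by (intro max) (auto simp: X_def)
    then show ?thesis using XI[of 0 1] by simp
  qed
  then show ?thesis using that[OF D] by blast
qed

text \<open>Separation in finite dimensions needs no interior point: a maximal blunt cone totally orders
  the space, and finitely many vectors are dominated by an order unit.\<close>
theorem blunt_cone_separation:
  fixes C :: "'a::real_vector set" and b :: "'i \<Rightarrow> 'a"
  assumes C: "blunt_cone C" and F: "finite F" "F \<noteq> {}" "\<And>i. i \<in> F \<Longrightarrow> b i \<noteq> 0"
  obtains \<alpha> where "\<exists>i\<in>F. \<alpha> i \<noteq> 0"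
    "\<And>c. (\<Sum>i\<in>F. c i *\<^sub>R b i) \<in> C \<Longrightarrow> 0 \<le> (\<Sum>i\<in>F. c i * \<alpha> i :: real)"
proof -
  obtain D where CD: "C \<subseteq> D" and D: "blunt_cone D" and tot: "\<And>y. y \<noteq> 0 \<Longrightarrow> y \<in> D \<or> - y \<in> D"
    using blunt_cone_maximal[OF C] by blast
  have D0: "0 \<notin> D" using D by (auto simp: blunt_cone_def)
  have add: "x + y \<in> D" if "x \<in> D" "y \<in> D" for x y using that D by (auto simp: blunt_cone_def)
  have scl: "t *\<^sub>R x \<in> D" if "x \<in> D" "t > 0" for x t using that D by (auto simp: blunt_cone_def)
  have neg: "- x \<notin> D" if "x \<in> D" for x using add[OF that, of "- x"] D0 by auto
  \<comment> \<open>Signs are chosen to make all vectors positive in the order given by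
    \<open>D\<close>; twice their sum \<open>e\<close> then dominates each of them.\<close>
  define B where "B i = (if b i \<in> D then b i else - b i)" for i
  have B: "B i \<in> D" if "i \<in> F" for i using tot[OF F(3)[OF that]] by (auto simp: B_def)
  have sumD: "sum g I \<in> D" if "finite I" "I \<noteq> {}" "\<And>i. i \<in> I \<Longrightarrow> g i \<in> D" for g and I :: "'i set"
    using that by (induction I rule: finite_ne_induct) (auto intro: add)
  define e where "e = sum B F"
  have e: "e \<in> D" unfolding e_def using F B by (intro sumD) auto
  have te: "t *\<^sub>R e \<in> D \<longleftrightarrow> t > 0" for t
  proof -
    consider "t > 0" | "t = 0" | "- t > 0" by linarith
    then show ?thesis
    proof cases
      case 3
      then show ?thesis using neg[OF scl[OF e 3]] by auto
    qed (use scl[OF e] D0 in auto)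
  qed
  define S where "S = {y. \<exists>t. t *\<^sub>R e - y \<in> D \<and> t *\<^sub>R e + y \<in> D}"
  have Sadd: "x + y \<in> S" if xy: "x \<in> S" "y \<in> S" for x y
  proof -
    obtain t s where "t *\<^sub>R e - x \<in> D" "t *\<^sub>R e + x \<in> D" "s *\<^sub>R e - y \<in> D" "s *\<^sub>R e + y \<in> D"
      using xy by (auto simp: S_def)
    then have "(t *\<^sub>R e - x) + (s *\<^sub>R e - y) \<in> D" "(t *\<^sub>R e + x) + (s *\<^sub>R e + y) \<in> D" by (auto intro: add)
    then show ?thesis unfolding S_def by (auto intro!: exI[of _ "t + s"] simp: algebra_simps)
  qed
  have Sneg: "- x \<in> S" if "x \<in> S" for x using that by (auto simp: S_def)
  have Spos: "c *\<^sub>R x \<in> S" if x: "x \<in> S" "c > 0" for c x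
  proof -
    obtain t where "t *\<^sub>R e - x \<in> D" "t *\<^sub>R e + x \<in> D" using x by (auto simp: S_def)
    then have "c *\<^sub>R (t *\<^sub>R e - x) \<in> D" "c *\<^sub>R (t *\<^sub>R e + x) \<in> D" using x by (auto intro: scl)
    then show ?thesis unfolding S_def by (auto intro!: exI[of _ "c * t"] simp: algebra_simps)
  qed
  have S0: "0 \<in> S" using e by (auto simp: S_def intro!: exI[of _ 1])
  have Sscl: "c *\<^sub>R x \<in> S" if "x \<in> S" for c x
  proof -
    consider "c > 0" | "c = 0" | "- c > 0" by linarith
    then show ?thesis
      using Spos[OF that, of c] S0 Sneg[OF Spos[OF that, of "- c"]] by cases auto
  qed
  have BS: "B i \<in> S" if i: "i \<in> F" for i
  proof -
    have "e + B i \<in> D" using e B[OF i] by (rule add)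
    \<comment> \<open>The factor 2 matters: \<open>e - B i\<close> is 0 when \<open>F\<close> is a
      singleton, and 0 is not in \<open>D\<close>.\<close>
    moreover have "2 *\<^sub>R e - B i \<in> D"
    proof (cases "F - {i} = {}")
      case True
      then have "F = {i}" using i by auto
      then have "e = B i" by (simp add: e_def)
      then show ?thesis using B[OF i] by (simp add: scaleR_2)
    next
      case False
      have "e + sum B (F - {i}) \<in> D" using F B False by (intro add e sumD) auto
      moreover have "sum B (F - {i}) = e - B i" unfolding e_def using F i by (simp add: sum_diff1)
      ultimately show ?thesis by (simp add: scaleR_2 algebra_simps)
    qed
    ultimately show ?thesis
      using add[OF e, of "e + B i"] unfolding S_def by (auto intro!: exI[of _ 2] simp: scaleR_2 algebra_simps)
  qed
  have bS: "b i \<in> S" if "i \<in> F" for i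
    using BS[OF that] Sneg[OF BS[OF that]] by (auto simp: B_def split: if_splits)
  \<comment> \<open>On \<open>S\<close> the cone \<open>D\<close> is a total order with order unit
    \<open>e\<close>; this is the cut of \<open>y\<close> in the multiples of \<open>e\<close>, with
    infinitesimals sent to 0.\<close>
  define a where "a y = Inf {t. t *\<^sub>R e - y \<in> D}" for y
  have ne: "{t. t *\<^sub>R e - y \<in> D} \<noteq> {}" if "y \<in> S" for y using that by (auto simp: S_def)
  have lower: "- s \<le> t" if st: "t *\<^sub>R e - y \<in> D" "s *\<^sub>R e + y \<in> D" for s t y
    using add[OF st] te[of "t + s"] by (simp add: algebra_simps)
  have a_le: "a y \<le> t" if y: "y \<in> S" and t: "t *\<^sub>R e - y \<in> D" for y t
    unfolding a_def
  proof (rule cInf_lower)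
    obtain s where "s *\<^sub>R e + y \<in> D" using y by (auto simp: S_def)
    then show "bdd_below {t. t *\<^sub>R e - y \<in> D}" using lower by (intro bdd_belowI[of _ "- s"]) blast
  qed (use t in auto)
  have a_ge: "m \<le> a y" if "y \<in> S" "\<And>t. t *\<^sub>R e - y \<in> D \<Longrightarrow> m \<le> t" for y m
    unfolding a_def using ne[OF that(1)] that(2) by (intro cInf_greatest) auto
  have a_sub: "a (x + y) \<le> a x + a y" if S: "x \<in> S" "y \<in> S" for x y
  proof -
    have *: "a (x + y) \<le> t + s" if "t *\<^sub>R e - x \<in> D" "s *\<^sub>R e - y \<in> D" for t s
      using add[OF that] by (intro a_le Sadd S) (simp add: algebra_simps)
    have "a (x + y) - s \<le> a x" if "s *\<^sub>R e - y \<in> D" for s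
      using *[OF _ that] by (intro a_ge S) (auto simp: algebra_simps)
    then have "a (x + y) - a x \<le> a y" by (intro a_ge S) (auto simp: algebra_simps)
    then show ?thesis by simp
  qed
  \<comment> \<open>Totality enters here: a \<open>t\<close> below the cut of \<open>y\<close> has
    \<open>y - t *\<^sub>R e\<close> in \<open>insert 0 D\<close>, which bounds \<open>- y\<close>
    from above. The smaller \<open>s\<close> absorbs the case of 0.\<close>
  have a_neg_le: "a (- y) \<le> - a y" if S: "y \<in> S" for y
  proof (rule ccontr)
    assume "\<not> a (- y) \<le> - a y"
    then obtain t where t: "- a (- y) < t" "t < a y"
      using dense[of "- a (- y)" "a y"] by auto
    have "t *\<^sub>R e - y \<notin> D" using a_le[OF S, of t] t by auto
    then have "y - t *\<^sub>R e \<in> insert 0 D" using tot[of "t *\<^sub>R e - y"] by auto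
    moreover obtain s where s: "- a (- y) < s" "s < t" using dense[OF t(1)] by blast
    moreover have "(t - s) *\<^sub>R e \<in> D" using te s by simp
    ultimately have "(y - t *\<^sub>R e) + (t - s) *\<^sub>R e \<in> D" by (auto intro: add)
    then have "(- s) *\<^sub>R e - (- y) \<in> D" by (simp add: algebra_simps)
    then have "a (- y) \<le> - s" by (intro a_le Sneg S)
    then show False using s by simp
  qed
  have a0: "a 0 = 0"
  proof -
    have "{t. t *\<^sub>R e - 0 \<in> D} = {0<..}" using te by auto
    then show ?thesis unfolding a_def by simp
  qed
  have a_neg: "a (- y) = - a y" if "y \<in> S" for y
    using a_sub[OF that Sneg[OF that]] a_neg_le[OF that] a0 by simp
  have a_add: "a (x + y) = a x + a y" if "x \<in> S" "y \<in> S" for x y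
    using a_sub[OF that] a_sub[OF Sneg[OF that(1)] Sneg[OF that(2)]]
      a_neg[OF that(1)] a_neg[OF that(2)] a_neg[OF Sadd[OF that]] by simp
  have a_pos_le: "a (c *\<^sub>R y) \<le> c * a y" if S: "y \<in> S" and c: "c > 0" for y c
  proof -
    have "a (c *\<^sub>R y) / c \<le> a y"
    proof (rule a_ge[OF S])
      fix t assume "t *\<^sub>R e - y \<in> D"
      from scl[OF this c] have "a (c *\<^sub>R y) \<le> c * t" by (intro a_le Sscl S) (simp add: algebra_simps)
      then show "a (c *\<^sub>R y) / c \<le> t" using c by (simp add: field_simps)
    qed
    then show ?thesis using c by (simp add: field_simps)
  qed
  have a_pos: "a (c *\<^sub>R y) = c * a y" if S: "y \<in> S" and c: "c > 0" for y c
    using a_pos_le[OF S c] a_pos_le[OF Sneg[OF S] c] a_neg[OF S] a_neg[OF Sscl[OF S, of c]] by simp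
  have a_scl: "a (c *\<^sub>R y) = c * a y" if S: "y \<in> S" for y c
  proof -
    consider "c > 0" | "c = 0" | "- c > 0" by linarith
    then show ?thesis
      using a_pos[OF S, of c] a0 a_pos[OF S, of "- c"] a_neg[OF Sscl[OF S, of c]] by cases auto
  qed
  have a_lin: "(\<Sum>i\<in>I. c i *\<^sub>R g i) \<in> S \<and> a (\<Sum>i\<in>I. c i *\<^sub>R g i) = (\<Sum>i\<in>I. c i * a (g i))"
    if "finite I" "\<And>i. i \<in> I \<Longrightarrow> g i \<in> S" for c g and I :: "'i set"
    using that by (induction I rule: finite_induct) (auto simp: S0 a0 a_add a_scl Sadd Sscl)
  have a_nonneg: "0 \<le> a d" if "d \<in> D" "d \<in> S" for d
    using a_le[OF Sneg[OF that(2)], of 0] a_neg[OF that(2)] that(1) by simp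
  \<comment> \<open>\<open>e\<close> is a signed sum of the \<open>b i\<close>, so this value
    prevents all \<open>a (b i)\<close> from being 0.\<close>
  have ae: "a e = 1"
  proof -
    have "t *\<^sub>R e - e \<in> D \<longleftrightarrow> t > 1" for t using te[of "t - 1"] by (simp add: algebra_simps)
    then have "{t. t *\<^sub>R e - e \<in> D} = {1<..}" by auto
    then show ?thesis unfolding a_def by simp
  qed
  show ?thesis
  proof (rule that[of "\<lambda>i. a (b i)"])
    show "\<exists>i\<in>F. a (b i) \<noteq> 0"
    proof (rule ccontr)
      assume "\<not> ?thesis"
      then have "a (B i) = 0" if "i \<in> F" for i using that a_neg[OF bS[OF that]] by (auto simp: B_def)
      moreover have "a e = (\<Sum>i\<in>F. 1 * a (B i))"
        using a_lin[OF F(1), of B "\<lambda>_. 1"] BS by (simp add: e_def)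
      ultimately show False using ae by simp
    qed
    show "0 \<le> (\<Sum>i\<in>F. c i * a (b i))" if "(\<Sum>i\<in>F. c i *\<^sub>R b i) \<in> C" for c
      using a_lin[OF F(1), of b c] bS a_nonneg[of "\<Sum>i\<in>F. c i *\<^sub>R b i"] that CD by auto
  qed
qed

section \<open>Polynomials and the moment map\<close>

lemma lookup_scaleR: "Poly_Mapping.lookup (c *\<^sub>R p) m = c *\<^sub>R Poly_Mapping.lookup p m"
proof -
  have "finite {m. c *\<^sub>R Poly_Mapping.lookup p m \<noteq> 0}"
    by (rule finite_subset[of _ "Poly_Mapping.keys p"]) (auto simp: in_keys_iff)
  then show ?thesis unfolding scaleR_poly_mapping_def by simp
qed

lemma scaleR_conv_single_mult:
  fixes p :: "'m::comm_monoid_add \<Rightarrow>\<^sub>0 'b::{comm_ring_1,real_algebra_1}"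
  shows "c *\<^sub>R p = Poly_Mapping.single 0 (of_real c) * p"
  by (rule poly_mapping_eqI)
    (simp add: lookup_scaleR scaleR_conv_of_real Poly_Mapping.map.rep_eq when_def flip: mult_map_scale_conv_mult)

instance poly_mapping :: (comm_monoid_add, "{comm_ring_1,real_algebra_1}") real_algebra_1
proof
  fix c :: real and x y :: "'a \<Rightarrow>\<^sub>0 'b"
  show "c *\<^sub>R x * y = c *\<^sub>R (x * y)" "x * c *\<^sub>R y = c *\<^sub>R (x * y)"
    by (simp_all add: scaleR_conv_single_mult mult_ac)
qed

lemma poly_mapping_sum_single: "p = (\<Sum>m\<in>Poly_Mapping.keys p. Poly_Mapping.single m (Poly_Mapping.lookup p m))"
  by (rule poly_mapping_eqI) (auto simp: lookup_sum lookup_single when_def in_keys_iff)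

lemma scaleR_single: "c *\<^sub>R Poly_Mapping.single m a = Poly_Mapping.single m (c *\<^sub>R a)"
  by (rule poly_mapping_eqI) (simp add: lookup_scaleR lookup_single when_def)

lemma poly_mapping_real_expand:
  fixes p :: "'m \<Rightarrow>\<^sub>0 real"
  shows "p = (\<Sum>m\<in>Poly_Mapping.keys p. Poly_Mapping.lookup p m *\<^sub>R Poly_Mapping.single m 1)"
  using poly_mapping_sum_single[of p] by (simp add: scaleR_single)

definition linear_extension :: "('m \<Rightarrow> 'b::real_vector) \<Rightarrow> ('m \<Rightarrow>\<^sub>0 real) \<Rightarrow> 'b" where
  "linear_extension g p = (\<Sum>m\<in>Poly_Mapping.keys p. Poly_Mapping.lookup p m *\<^sub>R g m)"

lemma linear_extension_superset:
  "finite S \<Longrightarrow> Poly_Mapping.keys p \<subseteq> S \<Longrightarrow> linear_extension g p = (\<Sum>m\<in>S. Poly_Mapping.lookup p m *\<^sub>R g m)"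
  unfolding linear_extension_def by (intro sum.mono_neutral_left) (auto simp: in_keys_iff)

lemma linear_linear_extension: "linear (linear_extension g)"
proof (rule linearI)
  fix p q :: "'a \<Rightarrow>\<^sub>0 real"
  let ?S = "Poly_Mapping.keys p \<union> Poly_Mapping.keys q"
  have "Poly_Mapping.keys (p + q) \<subseteq> ?S" by (rule keys_add)
  then show "linear_extension g (p + q) = linear_extension g p + linear_extension g q"
    by (simp add: linear_extension_superset[of ?S] lookup_add scaleR_add_left sum.distrib)
next
  fix c and p :: "'a \<Rightarrow>\<^sub>0 real"
  have "Poly_Mapping.keys (c *\<^sub>R p) \<subseteq> Poly_Mapping.keys p" by (auto simp: in_keys_iff lookup_scaleR)
  then show "linear_extension g (c *\<^sub>R p) = c *\<^sub>R linear_extension g p"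
    by (simp add: linear_extension_superset[of "Poly_Mapping.keys p"] lookup_scaleR scaleR_sum_right)
qed

lemma linear_extension_single [simp]: "linear_extension g (Poly_Mapping.single m c) = c *\<^sub>R g m"
  by (simp add: linear_extension_def)

lemma linear_eq_on_monomials:
  fixes F G :: "('m \<Rightarrow>\<^sub>0 real) \<Rightarrow> 'b::real_vector"
  assumes "linear F" "linear G"
    and "\<And>m. m \<in> Poly_Mapping.keys p \<Longrightarrow> F (Poly_Mapping.single m 1) = G (Poly_Mapping.single m 1)"
  shows "F p = G p"
proof -
  have e: "H p = (\<Sum>m\<in>Poly_Mapping.keys p. Poly_Mapping.lookup p m *\<^sub>R H (Poly_Mapping.single m 1))"
    if "linear H" for H :: "('m \<Rightarrow>\<^sub>0 real) \<Rightarrow> 'b"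
    using arg_cong[OF poly_mapping_real_expand[of p], of H] that by (simp add: linear_sum linear_scale)
  show ?thesis
    unfolding e[OF assms(1)] e[OF assms(2)] using assms(3) by (intro sum.cong refl) simp
qed

lemma linear_mult_on_monomials:
  fixes F :: "('m::comm_monoid_add \<Rightarrow>\<^sub>0 real) \<Rightarrow> 'b::{comm_ring_1,real_algebra_1}"
  assumes F: "linear F" and m: "\<And>m n. F (Poly_Mapping.single (m + n) 1) = F (Poly_Mapping.single m 1) * F (Poly_Mapping.single n 1)"
  shows "F (p * q) = F p * F q"
proof -
  have step: "F (p * Poly_Mapping.single n 1) = F p * F (Poly_Mapping.single n 1)" for p n
  proof (rule linear_eq_on_monomials[of "\<lambda>p. F (p * Poly_Mapping.single n 1)"
        "\<lambda>p. F p * F (Poly_Mapping.single n 1)"])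
    show "linear (\<lambda>p. F (p * Poly_Mapping.single n 1))" "linear (\<lambda>p. F p * F (Poly_Mapping.single n 1))"
      by (auto intro!: linearI simp: distrib_right linear_add[OF F] linear_scale[OF F])
  qed (simp add: mult_single m)
  show ?thesis
  proof (rule linear_eq_on_monomials[of "\<lambda>q. F (p * q)" "\<lambda>q. F p * F q"])
    show "linear (\<lambda>q. F (p * q))" "linear (\<lambda>q. F p * F q)"
      by (auto intro!: linearI simp: distrib_left linear_add[OF F] linear_scale[OF F])
  qed (rule step)
qed

section \<open>Substitution homomorphisms\<close>

definition monomial_value :: "('v \<Rightarrow> 'b::comm_monoid_mult) \<Rightarrow> ('v \<Rightarrow>\<^sub>0 nat) \<Rightarrow> 'b" where
  "monomial_value \<sigma> m = (\<Prod>v\<in>Poly_Mapping.keys m. \<sigma> v ^ Poly_Mapping.lookup m v)"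

lemma monomial_value_superset:
  "finite S \<Longrightarrow> Poly_Mapping.keys m \<subseteq> S \<Longrightarrow> monomial_value \<sigma> m = (\<Prod>v\<in>S. \<sigma> v ^ Poly_Mapping.lookup m v)"
  unfolding monomial_value_def by (intro prod.mono_neutral_left) (auto simp: in_keys_iff)

lemma monomial_value_0 [simp]: "monomial_value \<sigma> 0 = 1"
  by (simp add: monomial_value_def)

lemma monomial_value_add: "monomial_value \<sigma> (m + n) = monomial_value \<sigma> m * monomial_value \<sigma> n"
proof -
  let ?S = "Poly_Mapping.keys m \<union> Poly_Mapping.keys n"
  have "Poly_Mapping.keys (m + n) \<subseteq> ?S" by (rule keys_add)
  then show ?thesis
    by (simp add: monomial_value_superset[of ?S] lookup_add power_add prod.distrib)
qed

lemma monomial_value_single [simp]: "monomial_value \<sigma> (Poly_Mapping.single v k) = \<sigma> v ^ k"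
  by (cases "k = 0") (simp_all add: monomial_value_def)

lemma monomial_value_cong:
  "(\<And>v. v \<in> Poly_Mapping.keys m \<Longrightarrow> \<sigma> v = \<tau> v) \<Longrightarrow> monomial_value \<sigma> m = monomial_value \<tau> m"
  unfolding monomial_value_def by (intro prod.cong) auto

lemma monomial_value_mult: "monomial_value (\<lambda>v. \<sigma> v * \<tau> v) m = monomial_value \<sigma> m * monomial_value \<tau> m"
  by (simp add: monomial_value_def power_mult_distrib prod.distrib)

text \<open>Values lie in an arbitrary algebra: real values give evaluations, polynomial values give
  endomorphisms such as \<open>forget_x\<close>.\<close>

definition psubst :: "('v \<Rightarrow> 'b::{comm_ring_1,real_algebra_1}) \<Rightarrow> (('v \<Rightarrow>\<^sub>0 nat) \<Rightarrow>\<^sub>0 real) \<Rightarrow> 'b" where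
  "psubst \<sigma> = linear_extension (monomial_value \<sigma>)"

lemma linear_psubst: "linear (psubst \<sigma>)"
  unfolding psubst_def by (rule linear_linear_extension)

lemmas psubst_add = linear_add[OF linear_psubst]
  and psubst_diff = linear_diff[OF linear_psubst]
  and psubst_neg = linear_neg[OF linear_psubst]
  and psubst_0 = linear_0[OF linear_psubst]
  and psubst_sum = linear_sum[OF linear_psubst]
  and psubst_scaleR = linear_scale[OF linear_psubst]

lemma psubst_single: "psubst \<sigma> (Poly_Mapping.single m c) = c *\<^sub>R monomial_value \<sigma> m"
  by (simp add: psubst_def)

lemma psubst_mult: "psubst \<sigma> (p * q) = psubst \<sigma> p * psubst \<sigma> q"
  by (rule linear_mult_on_monomials[OF linear_psubst]) (simp add: psubst_single monomial_value_add)

lemma psubst_1 [simp]: "psubst \<sigma> 1 = 1"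
  using psubst_single[of \<sigma> 0 1] by simp

lemma psubst_power: "psubst \<sigma> (p ^ k) = psubst \<sigma> p ^ k"
  by (induction k) (simp_all add: psubst_mult)

lemma psubst_prod: "psubst \<sigma> (prod g I) = (\<Prod>i\<in>I. psubst \<sigma> (g i))"
  by (induction I rule: infinite_finite_induct) (simp_all add: psubst_mult)

lemma psubst_cong:
  assumes "\<And>m v. m \<in> Poly_Mapping.keys p \<Longrightarrow> v \<in> Poly_Mapping.keys m \<Longrightarrow> \<sigma> v = \<tau> v"
  shows "psubst \<sigma> p = psubst \<tau> p"
  unfolding psubst_def linear_extension_def
  by (intro sum.cong refl arg_cong2[where f = scaleR] monomial_value_cong assms)

lemma peval_eq_psubst: "peval \<sigma> = psubst \<sigma>"
  by (rule ext) (simp add: peval_def psubst_def linear_extension_def monomial_value_def)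

lemma psubst_pvar [simp]: "psubst \<sigma> (pvar v) = \<sigma> v"
  by (simp add: pvar_def psubst_single)

lemma pconst_eq_of_real: "pconst c = of_real c"
  by (simp add: pconst_def of_real_def scaleR_single flip: single_one)

lemma pconst_mult: "pconst c * p = c *\<^sub>R p"
  by (simp add: pconst_eq_of_real scaleR_conv_of_real)

lemma single_eq_monomial_value: "Poly_Mapping.single m 1 = monomial_value (pvar :: 'n var \<Rightarrow> 'n mpoly) m"
proof -
  have add: "Poly_Mapping.single (a + b) (1::real) = Poly_Mapping.single a 1 * Poly_Mapping.single b 1"
    for a b :: "'n var \<Rightarrow>\<^sub>0 nat"
    by (simp add: mult_single)
  have pow: "Poly_Mapping.single (Poly_Mapping.single v k) 1 = (pvar v :: 'n mpoly) ^ k" for v k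
  proof (induction k)
    case (Suc k)
    have "Poly_Mapping.single v (Suc k) = Poly_Mapping.single v 1 + Poly_Mapping.single v k"
      by (simp flip: single_add)
    then show ?case using Suc by (simp only: add power_Suc pvar_def)
  qed simp
  have "Poly_Mapping.single (\<Sum>v\<in>I. Poly_Mapping.single v (k v)) 1 = (\<Prod>v\<in>I. (pvar v :: 'n mpoly) ^ k v)" for I k
    by (induction I rule: infinite_finite_induct) (simp_all add: add pow)
  from this[where k = "Poly_Mapping.lookup m" and I = "Poly_Mapping.keys m"] show ?thesis
    by (simp add: monomial_value_def flip: poly_mapping_sum_single)
qed

lemma psubst_pvar_id: "psubst pvar p = (p :: 'n mpoly)"
  using linear_eq_on_monomials[OF linear_psubst linear_ident, of p pvar]
  by (simp add: psubst_single flip: single_eq_monomial_value)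

lemma generated_algebra_power: "x \<in> generated_algebra V \<Longrightarrow> x ^ k \<in> generated_algebra V"
  using generated_algebra.const[of 1 V] by (induction k) (auto intro: generated_algebra.mult)

lemma generated_algebra_prod: "(\<And>i. i \<in> I \<Longrightarrow> g i \<in> generated_algebra V) \<Longrightarrow> prod g I \<in> generated_algebra V"
  using generated_algebra.const[of 1 V]
  by (induction I rule: infinite_finite_induct) (auto intro: generated_algebra.mult)

lemma generated_algebra_sum: "(\<And>i. i \<in> I \<Longrightarrow> g i \<in> generated_algebra V) \<Longrightarrow> sum g I \<in> generated_algebra V"
  using generated_algebra.const[of 0 V]
  by (induction I rule: infinite_finite_induct) (auto intro: generated_algebra.add)

lemma psubst_mem_generated_algebra:
  assumes "\<And>v. \<sigma> v \<in> generated_algebra V"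
  shows "psubst \<sigma> p \<in> generated_algebra V"
proof -
  have scl: "c *\<^sub>R x \<in> generated_algebra V" if "x \<in> generated_algebra V" for c x
    using generated_algebra.mult[OF generated_algebra.const that, of c] by (simp add: scaleR_conv_of_real)
  show ?thesis
    unfolding psubst_def linear_extension_def monomial_value_def
    by (intro generated_algebra_sum scl generated_algebra_prod generated_algebra_power assms)
qed

lemma generated_algebra_pvar: "generated_algebra (range pvar) = (UNIV :: 'n mpoly set)"
proof -
  have "psubst pvar p \<in> generated_algebra (range pvar)" for p :: "'n mpoly"
    by (intro psubst_mem_generated_algebra generated_algebra.gen) auto
  then show ?thesis unfolding psubst_pvar_id by auto
qed

lemma algebra_hom_eq_psubst:
  fixes \<phi> :: "'n mpoly \<Rightarrow> real"
  assumes lin: "linear \<phi>" and one: "\<phi> 1 = 1" and mult: "\<And>p q. \<phi> (p * q) = \<phi> p * \<phi> q"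
  shows "\<phi> p = psubst (\<lambda>v. \<phi> (pvar v)) p"
proof (rule linear_eq_on_monomials[OF lin linear_psubst])
  fix m :: "'n var \<Rightarrow>\<^sub>0 nat"
  have pow: "\<phi> (q ^ k) = \<phi> q ^ k" for q k by (induction k) (simp_all add: one mult)
  have "\<phi> (prod g I) = (\<Prod>i\<in>I. \<phi> (g i))" for g and I :: "'n var set"
    by (induction I rule: infinite_finite_induct) (simp_all add: one mult)
  then show "\<phi> (Poly_Mapping.single m 1) = psubst (\<lambda>v. \<phi> (pvar v)) (Poly_Mapping.single m 1)"
    by (simp add: single_eq_monomial_value psubst_prod psubst_power monomial_value_def pow)
qed

section \<open>Polynomials in the moment variables and the moment map\<close>

lemma inM_iff: "inM p \<longleftrightarrow> (\<forall>m\<in>Poly_Mapping.keys p. \<forall>v\<in>Poly_Mapping.keys m. \<forall>j. v \<noteq> Xv j)"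
  unfolding inM_def by (metis in_keys_iff)

lemma inRx_iff: "inRx p \<longleftrightarrow> (\<forall>m\<in>Poly_Mapping.keys p. \<forall>v\<in>Poly_Mapping.keys m. \<forall>a. v \<noteq> Mv a)"
  unfolding inRx_def by (metis in_keys_iff)

lemma psubst_cong_inM: "inM p \<Longrightarrow> (\<And>a. \<sigma> (Mv a) = \<tau> (Mv a)) \<Longrightarrow> psubst \<sigma> p = psubst \<tau> p"
  by (rule psubst_cong) (metis inM_iff var.exhaust)

lemma psubst_cong_inRx: "inRx p \<Longrightarrow> (\<And>j. \<sigma> (Xv j) = \<tau> (Xv j)) \<Longrightarrow> psubst \<sigma> p = psubst \<tau> p"
  by (rule psubst_cong) (metis inRx_iff var.exhaust)

definition forget_x :: "'n mpoly \<Rightarrow> 'n mpoly" where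
  "forget_x = psubst (case_var (\<lambda>_. 0) (\<lambda>a. pvar (Mv a)))"

lemma forget_x_inM: "inM p \<Longrightarrow> forget_x p = p"
  unfolding forget_x_def
  by (subst psubst_cong_inM[where \<tau> = pvar]) (auto simp: psubst_pvar_id)

lemma inM_0 [simp]: "inM 0" and inM_1 [simp]: "inM 1"
  by (auto simp: inM_def)

lemma inM_add: "inM p \<Longrightarrow> inM q \<Longrightarrow> inM (p + q)"
  using keys_add[of p q] unfolding inM_def by blast

lemma inM_mult: "inM p \<Longrightarrow> inM q \<Longrightarrow> inM (p * q)"
  using keys_mult[of p q] unfolding inM_def by (fastforce simp: lookup_add)

lemma inM_pconst: "inM (pconst c)"
  by (auto simp: inM_def pconst_def split: if_splits)

lemma inM_pvar: "inM (pvar (Mv a))"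
  by (auto simp: inM_def pvar_def lookup_single)

lemma inM_generated: "p \<in> generated_algebra V \<Longrightarrow> (\<And>v. v \<in> V \<Longrightarrow> inM v) \<Longrightarrow> inM p"
  by (induction rule: generated_algebra.induct) (auto intro: inM_add inM_mult inM_pconst simp flip: pconst_eq_of_real)

lemma inM_forget_x: "inM (forget_x p)"
proof -
  have "forget_x p \<in> generated_algebra (range (\<lambda>a. pvar (Mv a)))"
    unfolding forget_x_def
    using generated_algebra.const[of 0 "range (\<lambda>a. pvar (Mv a))"]
    by (intro psubst_mem_generated_algebra) (auto split: var.split intro: generated_algebra.gen)
  then show ?thesis by (rule inM_generated) (auto intro: inM_pvar)
qed

lemma mpart_eq: "mpart m = monomial_value (case_var (\<lambda>_. 1) (\<lambda>a. pvar (Mv a))) m"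
  unfolding mpart_def monomial_value_def by (intro prod.cong refl) (simp split: var.split)

lemma mmap_eq: "mmap = linear_extension (\<lambda>m. mpart m * mvar (xexp m))"
  by (rule ext) (simp add: mmap_def linear_extension_def pconst_mult)

lemma linear_mmap: "linear mmap"
  unfolding mmap_eq by (rule linear_linear_extension)

lemma mmap_single: "mmap (Poly_Mapping.single m c) = c *\<^sub>R (mpart m * mvar (xexp m))"
  by (simp add: mmap_eq)

lemma inM_mvar: "inM (mvar \<alpha>)"
  by (auto simp: mvar_def inM_pvar)

lemma inM_mmap: "inM (mmap p)"
proof -
  have sum: "inM (sum g I)" if "\<And>i. i \<in> I \<Longrightarrow> inM (g i)" for g :: "_ \<Rightarrow> 'a mpoly" and I :: "('a var \<Rightarrow>\<^sub>0 nat) set"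
    using that by (induction I rule: infinite_finite_induct) (auto intro: inM_add)
  have "inM (mpart m)" for m :: "'a var \<Rightarrow>\<^sub>0 nat"
  proof -
    have "mpart m \<in> generated_algebra (range (\<lambda>a. pvar (Mv a)))"
      unfolding mpart_eq monomial_value_def
      using generated_algebra.const[of 1 "range (\<lambda>a. pvar (Mv a))"]
      by (intro generated_algebra_prod generated_algebra_power) (auto split: var.split intro: generated_algebra.gen)
    then show ?thesis by (rule inM_generated) (auto intro: inM_pvar)
  qed
  then show ?thesis unfolding mmap_def by (intro sum inM_mult inM_pconst inM_mvar)
qed

text \<open>Linearity in \<open>q\<close> and in \<open>p\<close> reduces the claim to monomials. A
  monomial of \<open>q\<close> contains no \<open>Xv j\<close>, so it leaves \<open>xexp\<close>
  unchanged and passes through \<open>mpart\<close>.\<close>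

lemma mmap_mult_inM:
  assumes q: "inM q"
  shows "mmap (q * p) = q * mmap p"
proof -
  have "mmap (Poly_Mapping.single m 1 * p) = Poly_Mapping.single m 1 * mmap p"
    if m: "m \<in> Poly_Mapping.keys q" for m
  proof -
    have x: "Poly_Mapping.lookup m (Xv j) = 0" for j using q m by (auto simp: inM_def)
    have "mpart m = monomial_value pvar m"
      unfolding mpart_eq using x by (intro monomial_value_cong) (auto simp: in_keys_iff split: var.split)
    then have mp: "mpart m = Poly_Mapping.single m 1" by (simp add: single_eq_monomial_value)
    have "linear (\<lambda>p. mmap (Poly_Mapping.single m 1 * p))" "linear (\<lambda>p. Poly_Mapping.single m 1 * mmap p)"
      by (auto intro!: linearI simp: distrib_left linear_add[OF linear_mmap] linear_scale[OF linear_mmap])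
    then show ?thesis
    proof (rule linear_eq_on_monomials[of "\<lambda>p. mmap (Poly_Mapping.single m 1 * p)"
          "\<lambda>p. Poly_Mapping.single m 1 * mmap p"])
      fix n
      have "xexp (m + n) = xexp n" using x by (simp add: xexp_def lookup_add)
      then show "mmap (Poly_Mapping.single m 1 * Poly_Mapping.single n 1)
          = Poly_Mapping.single m 1 * mmap (Poly_Mapping.single n 1)"
        using mp by (simp add: mult_single mmap_single mpart_eq monomial_value_add mult.assoc)
    qed
  qed
  moreover have "linear (\<lambda>q. mmap (q * p))" "linear (\<lambda>q. q * mmap p)"
    by (auto intro!: linearI simp: distrib_right linear_add[OF linear_mmap] linear_scale[OF linear_mmap])
  ultimately show ?thesis
    by (rule linear_eq_on_monomials[of "\<lambda>q. mmap (q * p)" "\<lambda>q. q * mmap p", rotated 2])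
qed

lemma mmap_1: "mmap 1 = 1"
  using mmap_single[of 0 1] by (simp add: mpart_eq xexp_def mvar_def)

definition xmonomial :: "('n::finite \<Rightarrow> nat) \<Rightarrow> 'n mpoly" where
  "xmonomial \<alpha> = (\<Prod>j\<in>UNIV. pvar (Xv j) ^ \<alpha> j)"

lemma mmap_xmonomial: "mmap (xmonomial \<alpha>) = mvar \<alpha>"
proof -
  define m :: "'a var \<Rightarrow>\<^sub>0 nat" where "m = (\<Sum>j\<in>UNIV. Poly_Mapping.single (Xv j) (\<alpha> j))"
  have val: "monomial_value \<sigma> m = (\<Prod>j\<in>UNIV. \<sigma> (Xv j) ^ \<alpha> j)" for \<sigma> :: "'a var \<Rightarrow> 'b::comm_monoid_mult"
  proof -
    have "monomial_value \<sigma> (\<Sum>j\<in>I. Poly_Mapping.single (Xv j) (\<alpha> j)) = (\<Prod>j\<in>I. \<sigma> (Xv j) ^ \<alpha> j)" for I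
      by (induction I rule: infinite_finite_induct) (simp_all add: monomial_value_add)
    then show ?thesis by (simp add: m_def)
  qed
  have "xexp m = \<alpha>"
    by (simp add: xexp_def m_def lookup_sum lookup_single when_def fun_eq_iff)
  moreover have "xmonomial \<alpha> = Poly_Mapping.single m 1"
    by (simp add: single_eq_monomial_value val xmonomial_def)
  moreover have "mpart m = 1" by (simp add: mpart_eq val)
  ultimately show ?thesis by (simp add: mmap_single)
qed

lemma monomial_value_split:
  fixes \<sigma> :: "'n::finite var \<Rightarrow> 'b::comm_monoid_mult"
  shows "monomial_value \<sigma> m
    = monomial_value (case_var (\<lambda>_. 1) (\<lambda>a. \<sigma> (Mv a))) m * (\<Prod>j\<in>UNIV. \<sigma> (Xv j) ^ xexp m j)"
proof -
  have "monomial_value (case_var (\<lambda>j. \<sigma> (Xv j)) (\<lambda>_. 1)) m = (\<Prod>j\<in>UNIV. \<sigma> (Xv j) ^ xexp m j)"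
  proof -
    let ?S = "Poly_Mapping.keys m \<union> range Xv"
    have "monomial_value (case_var (\<lambda>j. \<sigma> (Xv j)) (\<lambda>_. 1)) m
        = (\<Prod>v\<in>?S. case_var (\<lambda>j. \<sigma> (Xv j)) (\<lambda>_. 1) v ^ Poly_Mapping.lookup m v)"
      by (rule monomial_value_superset) auto
    also have "\<dots> = (\<Prod>v\<in>range Xv. case_var (\<lambda>j. \<sigma> (Xv j)) (\<lambda>_. 1) v ^ Poly_Mapping.lookup m v)"
      by (rule prod.mono_neutral_right) (auto split: var.split)
    also have "\<dots> = (\<Prod>j\<in>UNIV. \<sigma> (Xv j) ^ xexp m j)"
      by (subst prod.reindex) (auto simp: inj_on_def xexp_def)
    finally show ?thesis .
  qed
  moreover have "monomial_value \<sigma> m = monomial_value (\<lambda>v. case_var (\<lambda>_. 1) (\<lambda>a. \<sigma> (Mv a)) v * case_var (\<lambda>j. \<sigma> (Xv j)) (\<lambda>_. 1) v) m"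
    by (intro monomial_value_cong) (simp split: var.split)
  ultimately show ?thesis by (simp add: monomial_value_mult)
qed

section \<open>Finitely atomic representations\<close>

text \<open>\<tau> is an arbitrary assignment to the moment variables, because the values supplied
  by a character do not come with a measure.\<close>

definition point_eval :: "('n nzidx \<Rightarrow> real) \<Rightarrow> real ^ 'n \<Rightarrow> 'n mpoly \<Rightarrow> real" where
  "point_eval \<tau> y = psubst (case_var (\<lambda>j. y $ j) \<tau>)"

lemma point_eval_simps [simp]:
  "point_eval \<tau> y (p + q) = point_eval \<tau> y p + point_eval \<tau> y q"
  "point_eval \<tau> y (p - q) = point_eval \<tau> y p - point_eval \<tau> y q"
  "point_eval \<tau> y (- p) = - point_eval \<tau> y p"
  "point_eval \<tau> y (p * q) = point_eval \<tau> y p * point_eval \<tau> y q"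
  "point_eval \<tau> y (c *\<^sub>R p) = c * point_eval \<tau> y p"
  "point_eval \<tau> y (p ^ k) = point_eval \<tau> y p ^ k"
  "point_eval \<tau> y (sum g I) = (\<Sum>i\<in>I. point_eval \<tau> y (g i))"
  "point_eval \<tau> y (prod g I) = (\<Prod>i\<in>I. point_eval \<tau> y (g i))"
  "point_eval \<tau> y 0 = 0" "point_eval \<tau> y 1 = 1"
  "point_eval \<tau> y (of_real c) = c"
  "point_eval \<tau> y (pvar (Xv j)) = y $ j" "point_eval \<tau> y (pvar (Mv a)) = \<tau> a"
  by (simp_all add: point_eval_def psubst_add psubst_diff psubst_neg psubst_mult psubst_scaleR
      psubst_power psubst_sum psubst_prod psubst_0 of_real_def)

lemma mpoly_induct [case_names const var add mult]:
  fixes p :: "'n mpoly"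
  assumes "\<And>c. P (of_real c)" "\<And>v. P (pvar v)" "\<And>p q. P p \<Longrightarrow> P q \<Longrightarrow> P (p + q)" "\<And>p q. P p \<Longrightarrow> P q \<Longrightarrow> P (p * q)"
  shows "P p"
proof -
  have "p \<in> generated_algebra (range pvar)" by (simp add: generated_algebra_pvar)
  then show ?thesis by induction (use assms in auto)
qed

lemma continuous_on_point_eval: "continuous_on S (\<lambda>y. point_eval \<tau> y p)"
proof (induction p rule: mpoly_induct)
  case (var v)
  then show ?case by (cases v) (auto intro!: continuous_intros)
qed (auto intro!: continuous_intros)

definition xweight :: "'n::finite mpoly" where
  "xweight = 1 + (\<Sum>j\<in>UNIV. pvar (Xv j) ^ 2)"

lemma point_eval_xweight: "point_eval \<tau> y xweight = 1 + (\<Sum>j\<in>UNIV. (y $ j)\<^sup>2)"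
  by (simp add: xweight_def)

lemma point_eval_xweight_norm: "point_eval \<tau> y xweight = 1 + (norm y)\<^sup>2"
  unfolding point_eval_xweight power2_norm_eq_inner inner_vec_def by (simp add: power2_eq_square)

lemma norm_le_one_plus_square: "norm y \<le> 1 + (norm y)\<^sup>2"
proof -
  have "2 * norm y \<le> 1 + (norm y)\<^sup>2"
    using zero_le_power2[of "norm y - 1"] by (simp add: power2_eq_square algebra_simps)
  then show ?thesis using norm_ge_zero[of y] by linarith
qed

lemma one_le_point_eval_xweight: "1 \<le> point_eval \<tau> y xweight"
  by (simp add: point_eval_xweight_norm)

lemma point_eval_growth:
  "\<exists>C N. 0 \<le> C \<and> (\<forall>y. \<bar>point_eval \<tau> y p\<bar> \<le> C * (point_eval \<tau> y xweight) ^ N)"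
proof (induction p rule: mpoly_induct)
  case (const c)
  show ?case by (intro exI[of _ "\<bar>c\<bar>"] exI[of _ 0]) simp
next
  case (var v)
  show ?case
  proof (cases v)
    case (Xv j)
    have "\<bar>y $ j\<bar> \<le> 1 + (norm y)\<^sup>2" for y :: "real ^ 'a"
    proof -
      have "\<bar>y $ j\<bar> \<le> norm y" by (rule component_le_norm_cart)
      also have "\<dots> \<le> 1 + (norm y)\<^sup>2" by (rule norm_le_one_plus_square)
      finally show ?thesis .
    qed
    then show ?thesis using Xv by (intro exI[of _ 1] exI[of _ 1]) (simp add: point_eval_xweight_norm)
  next
    case (Mv a)
    then show ?thesis by (intro exI[of _ "\<bar>\<tau> a\<bar>"] exI[of _ 0]) simp
  qed
next
  case (add p q)
  then obtain C N D M where C: "0 \<le> C" "\<And>y. \<bar>point_eval \<tau> y p\<bar> \<le> C * (point_eval \<tau> y xweight) ^ N"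
    and D: "0 \<le> D" "\<And>y. \<bar>point_eval \<tau> y q\<bar> \<le> D * (point_eval \<tau> y xweight) ^ M" by blast
  have "\<bar>point_eval \<tau> y (p + q)\<bar> \<le> (C + D) * (point_eval \<tau> y xweight) ^ max N M" for y
  proof -
    have "(point_eval \<tau> y xweight) ^ N \<le> (point_eval \<tau> y xweight) ^ max N M"
      "(point_eval \<tau> y xweight) ^ M \<le> (point_eval \<tau> y xweight) ^ max N M"
      by (auto intro!: power_increasing one_le_point_eval_xweight)
    then have "C * (point_eval \<tau> y xweight) ^ N \<le> C * (point_eval \<tau> y xweight) ^ max N M"
      "D * (point_eval \<tau> y xweight) ^ M \<le> D * (point_eval \<tau> y xweight) ^ max N M"
      using C D by (auto intro: mult_left_mono)
    then show ?thesis using C(2)[of y] D(2)[of y] by (simp add: distrib_right)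
  qed
  then show ?case using C D by (intro exI[of _ "C + D"] exI[of _ "max N M"]) auto
next
  case (mult p q)
  then obtain C N D M where C: "0 \<le> C" "\<And>y. \<bar>point_eval \<tau> y p\<bar> \<le> C * (point_eval \<tau> y xweight) ^ N"
    and D: "0 \<le> D" "\<And>y. \<bar>point_eval \<tau> y q\<bar> \<le> D * (point_eval \<tau> y xweight) ^ M" by blast
  have "\<bar>point_eval \<tau> y (p * q)\<bar> \<le> (C * D) * (point_eval \<tau> y xweight) ^ (N + M)" for y
    using mult_mono[OF C(2)[of y] D(2)[of y]] C(1) one_le_point_eval_xweight[of \<tau> y]
    by (simp add: abs_mult power_add mult_ac)
  then show ?case using C D by (intro exI[of _ "C * D"] exI[of _ "N + M"]) auto
qed

text \<open>Adding \<open>\<epsilon> *\<^sub>R xweight ^ Suc N\<close> to \<open>p\<close> confines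
  the points of \<open>K\<close> with nonpositive value to a compact set. There \<open>g\<close> is
  bounded away from 0, so a multiple of \<open>g\<close> repairs the sign, at no cost since
  \<open>l g = 0\<close>.\<close>

lemma positive_functional_zero_set:
  fixes K :: "(real ^ 'n::finite) set" and l :: "'n mpoly \<Rightarrow> real"
  assumes K: "closed K" and lin: "linear l"
    and pos: "\<And>p. (\<And>y. y \<in> K \<Longrightarrow> 0 \<le> point_eval \<tau> y p) \<Longrightarrow> 0 \<le> l p"
    and g: "\<And>y. y \<in> K \<Longrightarrow> 0 \<le> point_eval \<tau> y g" "l g = 0"
    and p: "\<And>y. y \<in> K \<Longrightarrow> point_eval \<tau> y g = 0 \<Longrightarrow> 0 \<le> point_eval \<tau> y p"
  shows "0 \<le> l p"
proof -
  let ?e = "point_eval \<tau>"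
  obtain C N where C: "0 \<le> C" "\<And>y. \<bar>?e y p\<bar> \<le> C * (?e y xweight) ^ N"
    using point_eval_growth by blast
  have main: "0 \<le> l p + \<epsilon> * l (xweight ^ Suc N)" if \<epsilon>: "\<epsilon> > 0" for \<epsilon>
  proof -
    let ?q = "p + \<epsilon> *\<^sub>R xweight ^ Suc N"
    define Z where "Z = {y \<in> K. ?e y ?q \<le> 0}"
    have "compact Z"
    proof (rule compact_eq_bounded_closed[THEN iffD2, OF conjI])
      have "Z = K \<inter> {y. ?e y ?q \<le> 0}" by (auto simp: Z_def)
      then show "closed Z"
        using K closed_Collect_le[OF continuous_on_point_eval[of UNIV \<tau> ?q] continuous_on_const] by auto
      have "norm y \<le> 1 + C / \<epsilon>" if "y \<in> Z" for y
      proof -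
        have W: "1 \<le> ?e y xweight" by (rule one_le_point_eval_xweight)
        have "\<epsilon> * ?e y xweight ^ Suc N \<le> C * ?e y xweight ^ N"
          using that abs_le_D2[OF C(2)[of y]] by (auto simp: Z_def)
        then have "(\<epsilon> * ?e y xweight) * ?e y xweight ^ N \<le> C * ?e y xweight ^ N" by (simp add: mult_ac)
        moreover have "0 < ?e y xweight ^ N" using W by simp
        ultimately have "\<epsilon> * ?e y xweight \<le> C" by (rule mult_right_le_imp_le)
        then have "1 + (norm y)\<^sup>2 \<le> C / \<epsilon>" using \<epsilon> by (simp add: point_eval_xweight_norm field_simps)
        then show ?thesis using norm_le_one_plus_square[of y] by simp
      qed
      then show "bounded Z" unfolding bounded_iff by blast
    qed
    have "\<exists>M\<ge>0. \<forall>y\<in>Z. 0 \<le> ?e y (?q + M *\<^sub>R g)"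
    proof (cases "Z = {}")
      case True
      then show ?thesis by (intro exI[of _ 0]) auto
    next
      case False
      obtain z where z: "z \<in> Z" "\<And>y. y \<in> Z \<Longrightarrow> ?e z g \<le> ?e y g"
        using continuous_attains_inf[OF \<open>compact Z\<close> False continuous_on_point_eval[of Z \<tau> g]] by blast
      obtain u where u: "u \<in> Z" "\<And>y. y \<in> Z \<Longrightarrow> ?e u ?q \<le> ?e y ?q"
        using continuous_attains_inf[OF \<open>compact Z\<close> False continuous_on_point_eval[of Z \<tau> ?q]] by blast
      have "?e z g \<noteq> 0"
      proof
        assume "?e z g = 0"
        then have "0 \<le> ?e z p" using z(1) by (intro p) (auto simp: Z_def)
        moreover have "0 < ?e z xweight ^ Suc N" using one_le_point_eval_xweight[of \<tau> z] by simp
        then have "0 < \<epsilon> * ?e z xweight ^ Suc N" using \<epsilon> by (intro mult_pos_pos)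
        ultimately show False using z(1) by (simp add: Z_def)
      qed
      then have zg: "?e z g > 0" using g(1)[of z] z(1) by (auto simp: Z_def)
      define M where "M = - ?e u ?q / ?e z g"
      have M0: "M \<ge> 0" using u(1) zg by (auto simp: M_def Z_def intro!: divide_nonpos_pos)
      have "0 \<le> ?e y (?q + M *\<^sub>R g)" if "y \<in> Z" for y
      proof -
        have "- ?e u ?q = M * ?e z g" using zg by (simp add: M_def)
        also have "\<dots> \<le> M * ?e y g" using M0 z(2)[OF that] by (intro mult_left_mono)
        finally show ?thesis using u(2)[OF that] by simp
      qed
      then show ?thesis using M0 by blast
    qed
    then obtain M where M: "M \<ge> 0" "\<And>y. y \<in> Z \<Longrightarrow> 0 \<le> ?e y (?q + M *\<^sub>R g)" by blast
    have "0 \<le> ?e y (?q + M *\<^sub>R g)" if "y \<in> K" for y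
    proof (cases "y \<in> Z")
      case False
      then have "0 \<le> ?e y ?q" using that by (auto simp: Z_def)
      then show ?thesis using M(1) g(1)[OF that] by simp
    qed (rule M(2))
    then have "0 \<le> l (?q + M *\<^sub>R g)" by (rule pos)
    then show ?thesis using g(2) by (simp add: linear_add[OF lin] linear_scale[OF lin])
  qed
  have "((\<lambda>\<epsilon>. l p + \<epsilon> * l (xweight ^ Suc N)) \<longlongrightarrow> l p + 0 * l (xweight ^ Suc N)) (at_right 0)"
    by (intro tendsto_intros)
  moreover have "eventually (\<lambda>\<epsilon>. 0 \<le> l p + \<epsilon> * l (xweight ^ Suc N)) (at_right 0)"
    by (rule eventually_mono[OF eventually_at_right_less[of 0]]) (rule main)
  ultimately have "0 \<le> l p + 0 * l (xweight ^ Suc N)"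
    by (rule tendsto_lowerbound) simp
  then show ?thesis by simp
qed

text \<open>Either the values of \<open>l\<close> on \<open>F\<close> are a convex combination of
  values at points of \<open>K\<close>, or separation yields \<open>g\<close> with
  \<open>g \<ge> 0\<close> on \<open>K\<close> and \<open>l g = 0\<close>. Then \<open>l\<close> is
  positive already with respect to the zero set of \<open>g\<close>, and on that set the relation
  \<open>g = 0\<close> determines one element of \<open>F\<close> from the others. The induction
  thus shrinks \<open>F\<close> and \<open>K\<close> together.\<close>

theorem finitely_atomic_representation:
  fixes K :: "(real ^ 'n::finite) set" and l :: "'n mpoly \<Rightarrow> real"
  assumes lin: "linear l" and one: "l 1 = 1" and "finite F" and "closed K"
    and "\<And>p. (\<And>y. y \<in> K \<Longrightarrow> 0 \<le> point_eval \<tau> y p) \<Longrightarrow> 0 \<le> l p"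
  shows "\<exists>Y w. finite Y \<and> Y \<subseteq> K \<and> (\<forall>y. 0 \<le> w y) \<and> sum w Y = (1::real) \<and>
    (\<forall>p\<in>F. l p = (\<Sum>y\<in>Y. w y * point_eval \<tau> y p))"
  using assms(3-)
proof (induction F arbitrary: K rule: finite_psubset_induct)
  case (psubset F)
  note K = \<open>closed K\<close> and pos = psubset.prems(2)
  let ?e = "point_eval \<tau>"
  have "K \<noteq> {}"
  proof
    assume "K = {}"
    then have "0 \<le> l (- 1)" by (intro pos) auto
    then show False using one by (simp add: linear_neg[OF lin])
  qed
  then obtain y0 where y0: "y0 \<in> K" by blast
  show ?case
  proof (cases "F = {}")
    case True
    then show ?thesis using y0 by (intro exI[of _ "{y0}"] exI[of _ "\<lambda>_. 1"]) auto
  next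
    case F: False
    \<comment> \<open>The total weight must be positive, since a representation of the zero vector
      is normalised by it.\<close>
    define rep where "rep c \<longleftrightarrow> (\<exists>Y w. finite Y \<and> Y \<subseteq> K \<and> (\<forall>y. 0 \<le> w y) \<and> 0 < sum w Y \<and>
      (\<forall>p\<in>F. c p = (\<Sum>y\<in>Y. w y * (?e y p - l p))))" for c
    \<comment> \<open>Coordinate vectors indexed by \<open>F\<close>, realised in the free vector
      space on polynomials.\<close>
    define vec where "vec c = (\<Sum>p\<in>F. c p *\<^sub>R Poly_Mapping.single p (1::real))" for c
    have lookup_vec: "Poly_Mapping.lookup (vec c) p = c p" if "p \<in> F" for c p
      using that psubset.hyps by (simp add: vec_def lookup_sum lookup_scaleR lookup_single when_def if_distrib cong: if_cong)
    have rep_add: "rep (\<lambda>p. c p + d p)" if cd: "rep c" "rep d" for c d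
    proof -
      obtain Y u where Y: "finite Y" "Y \<subseteq> K" "\<And>y. 0 \<le> u y" "0 < sum u Y"
        "\<And>p. p \<in> F \<Longrightarrow> c p = (\<Sum>y\<in>Y. u y * (?e y p - l p))" using cd(1) unfolding rep_def by blast
      obtain Z v where Z: "finite Z" "Z \<subseteq> K" "\<And>y. 0 \<le> v y" "0 < sum v Z"
        "\<And>p. p \<in> F \<Longrightarrow> d p = (\<Sum>y\<in>Z. v y * (?e y p - l p))" using cd(2) unfolding rep_def by blast
      define w where "w y = (if y \<in> Y then u y else 0) + (if y \<in> Z then v y else 0)" for y
      have w: "(\<Sum>y\<in>Y \<union> Z. w y * h y) = (\<Sum>y\<in>Y. u y * h y) + (\<Sum>y\<in>Z. v y * h y)" for h
      proof -
        have "(\<Sum>y\<in>Y \<union> Z. w y * h y)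
            = (\<Sum>y\<in>Y \<union> Z. if y \<in> Y then u y * h y else 0) + (\<Sum>y\<in>Y \<union> Z. if y \<in> Z then v y * h y else 0)"
          unfolding sum.distrib[symmetric] by (intro sum.cong) (auto simp: w_def algebra_simps)
        also have "\<dots> = (\<Sum>y\<in>Y. u y * h y) + (\<Sum>y\<in>Z. v y * h y)"
          using Y(1) Z(1) by (simp add: sum.If_cases Int_absorb1)
        finally show ?thesis .
      qed
      show ?thesis
        unfolding rep_def
        using Y Z w[of "\<lambda>_. 1"] w
        by (intro exI[of _ "Y \<union> Z"] exI[of _ w]) (auto simp: w_def)
    qed
    have rep_scl: "rep (\<lambda>p. t * c p)" if c: "rep c" "t > 0" for c t
    proof -
      obtain Y u where Y: "finite Y" "Y \<subseteq> K" "\<And>y. 0 \<le> u y" "0 < sum u Y"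
        "\<And>p. p \<in> F \<Longrightarrow> c p = (\<Sum>y\<in>Y. u y * (?e y p - l p))" using c(1) unfolding rep_def by blast
      have "0 < (\<Sum>y\<in>Y. t * u y)" using Y(4) c(2) by (simp flip: sum_distrib_left)
      moreover have "t * c p = (\<Sum>y\<in>Y. t * u y * (?e y p - l p))" if "p \<in> F" for p
        using Y(5)[OF that] by (simp add: sum_distrib_left mult.assoc)
      ultimately show ?thesis
        unfolding rep_def using Y(1-3) c(2) by (intro exI[of _ Y] exI[of _ "\<lambda>y. t * u y"]) auto
    qed
    define C where "C = {vec c | c. rep c}"
    show ?thesis
    proof (cases "0 \<in> C")
      case True
      then obtain c where c: "rep c" "vec c = 0" by (auto simp: C_def)
      then obtain Y u where Y: "finite Y" "Y \<subseteq> K" "\<And>y. 0 \<le> u y" "0 < sum u Y"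
        "\<And>p. p \<in> F \<Longrightarrow> c p = (\<Sum>y\<in>Y. u y * (?e y p - l p))" unfolding rep_def by blast
      have "l p = (\<Sum>y\<in>Y. u y / sum u Y * ?e y p)" if p: "p \<in> F" for p
      proof -
        have "(\<Sum>y\<in>Y. u y * (?e y p - l p)) = 0" using lookup_vec[OF p, of c] c(2) Y(5)[OF p] by simp
        then have "(\<Sum>y\<in>Y. u y * ?e y p) = sum u Y * l p"
          by (simp add: right_diff_distrib sum_subtractf sum_distrib_right)
        then have "(\<Sum>y\<in>Y. u y * ?e y p) / sum u Y = l p" using Y(4) by simp
        then show ?thesis by (simp add: sum_divide_distrib)
      qed
      then show ?thesis
        using Y by (intro exI[of _ Y] exI[of _ "\<lambda>y. u y / sum u Y"]) (auto simp flip: sum_divide_distrib)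
    next
      case False
      have "blunt_cone C"
        unfolding blunt_cone_def
      proof (intro conjI ballI allI impI)
        fix x y assume "x \<in> C" "y \<in> C"
        then obtain c d where "x = vec c" "rep c" "y = vec d" "rep d" by (auto simp: C_def)
        moreover from this have "vec c + vec d = vec (\<lambda>p. c p + d p)"
          by (simp add: vec_def sum.distrib scaleR_add_left)
        ultimately show "x + y \<in> C" using rep_add unfolding C_def by auto
      next
        fix x and t :: real assume "x \<in> C" "t > 0"
        then obtain c where "x = vec c" "rep c" by (auto simp: C_def)
        moreover have "t *\<^sub>R vec c = vec (\<lambda>p. t * c p)" by (simp add: vec_def scaleR_sum_right)
        ultimately show "t *\<^sub>R x \<in> C" using rep_scl \<open>t > 0\<close> unfolding C_def by auto
      qed (use False in auto)
      moreover have "Poly_Mapping.single p (1::real) \<noteq> 0" for p :: "'n mpoly"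
        by (metis lookup_single_eq lookup_zero zero_neq_one)
      ultimately obtain \<alpha> where \<alpha>: "\<exists>p\<in>F. \<alpha> p \<noteq> 0" "\<And>c. vec c \<in> C \<Longrightarrow> 0 \<le> (\<Sum>p\<in>F. c p * \<alpha> p)"
        using blunt_cone_separation[of C F "\<lambda>p. Poly_Mapping.single p 1"] psubset.hyps F
        unfolding vec_def by blast
      define g where "g = (\<Sum>p\<in>F. \<alpha> p *\<^sub>R (p - l p *\<^sub>R 1))"
      have eg: "?e y g = (\<Sum>p\<in>F. (?e y p - l p) * \<alpha> p)" for y
        by (simp add: g_def mult.commute)
      have g0: "0 \<le> ?e y g" if "y \<in> K" for y
      proof -
        have "rep (\<lambda>p. ?e y p - l p)"
          unfolding rep_def using that by (intro exI[of _ "{y}"] exI[of _ "\<lambda>_. 1"]) auto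
        then show ?thesis unfolding eg by (intro \<alpha>) (auto simp: C_def)
      qed
      have lg: "l g = 0"
        by (simp add: g_def linear_sum[OF lin] linear_scale[OF lin] linear_diff[OF lin] one)
      obtain p0 where p0: "p0 \<in> F" "\<alpha> p0 \<noteq> 0" using \<alpha>(1) by blast
      define K' where "K' = K \<inter> {y. ?e y g = 0}"
      have "closed K'"
        unfolding K'_def using K closed_Collect_eq[OF continuous_on_point_eval[of UNIV \<tau> g] continuous_on_const]
        by auto
      moreover have pos': "0 \<le> l p" if "\<And>y. y \<in> K' \<Longrightarrow> 0 \<le> ?e y p" for p
        using that by (intro positive_functional_zero_set[OF K lin pos g0 lg]) (auto simp: K'_def)
      moreover have "F - {p0} \<subset> F" using p0 by auto
      ultimately have "\<exists>Y w. finite Y \<and> Y \<subseteq> K' \<and> (\<forall>y. 0 \<le> w y) \<and> sum w Y = 1 \<and>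
          (\<forall>p\<in>F - {p0}. l p = (\<Sum>y\<in>Y. w y * ?e y p))"
        by (intro psubset.IH pos') auto
      then obtain Y w where Y: "finite Y" "Y \<subseteq> K'" "\<forall>y. 0 \<le> w y" "sum w Y = 1"
        and rep: "\<And>p. p \<in> F - {p0} \<Longrightarrow> l p = (\<Sum>y\<in>Y. w y * ?e y p)"
        by blast
      have rep0: "(\<Sum>y\<in>Y. w y * (?e y p - l p)) = 0" if "p \<in> F - {p0}" for p
        using rep[OF that] Y(4) by (simp add: right_diff_distrib sum_subtractf flip: sum_distrib_right)
      \<comment> \<open>Averaging \<open>?e y g = 0\<close> over \<open>Y\<close> expresses the
        error at \<open>p0\<close> by the errors at the other polynomials, which are 0.\<close>
      have "(\<Sum>y\<in>Y. w y * ((?e y p0 - l p0) * \<alpha> p0)) = (\<Sum>y\<in>Y. w y * (- (\<Sum>p\<in>F - {p0}. (?e y p - l p) * \<alpha> p)))"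
      proof (intro sum.cong refl)
        fix y assume "y \<in> Y"
        then have "(\<Sum>p\<in>F. (?e y p - l p) * \<alpha> p) = 0" using Y(2) eg by (auto simp: K'_def)
        then have "(?e y p0 - l p0) * \<alpha> p0 + (\<Sum>p\<in>F - {p0}. (?e y p - l p) * \<alpha> p) = 0"
          using sum.remove[OF psubset.hyps p0(1), of "\<lambda>p. (?e y p - l p) * \<alpha> p"] by simp
        then show "w y * ((?e y p0 - l p0) * \<alpha> p0) = w y * (- (\<Sum>p\<in>F - {p0}. (?e y p - l p) * \<alpha> p))"
          by (simp add: add_eq_0_iff2)
      qed
      also have "\<dots> = - (\<Sum>p\<in>F - {p0}. \<Sum>y\<in>Y. (w y * (?e y p - l p)) * \<alpha> p)"
        by (subst sum.swap) (simp add: sum_distrib_left sum_negf mult.assoc)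
      also have "\<dots> = 0" using rep0 by (simp flip: sum_distrib_right)
      finally have "(\<Sum>y\<in>Y. w y * (?e y p0 - l p0)) * \<alpha> p0 = 0" by (simp add: sum_distrib_right mult.assoc)
      then have "(\<Sum>y\<in>Y. w y * (?e y p0 - l p0)) = 0" using p0(2) by simp
      then have "l p0 = (\<Sum>y\<in>Y. w y * ?e y p0)"
        using Y(4) by (simp add: right_diff_distrib sum_subtractf flip: sum_distrib_right)
      then show ?thesis
        using Y rep by (intro exI[of _ Y] exI[of _ w]) (auto simp: K'_def)
    qed
  qed
qed

section \<open>The weights \<open>Phi\<close> and \<open>Psi\<close>\<close>

lemma quadratic_module_qmod: "quadratic_module (qmod UNIV G)"
  by unfold_locales (auto intro: qmod.intros)

abbreviation xmoment :: "'n::finite \<Rightarrow> nat \<Rightarrow> 'n mpoly" where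
  "xmoment j k \<equiv> mmap (pvar (Xv j) ^ (2 * k))"

lemma Phi_eq: "Phi r = (\<Sum>(j, k)\<in>UNIV \<times> {0..r}. (1 / fact k) *\<^sub>R pvar (Xv j) ^ (2 * k))"
  unfolding Phi_def sum.cartesian_product by (simp add: pconst_mult)

lemma Psi_eq: "Psi r = (\<Sum>j\<in>UNIV. \<Sum>(k, l)\<in>{(k, l). 1 \<le> k \<and> 1 \<le> l \<and> k * l \<le> r}.
    (1 / (fact k ^ l * fact l)) *\<^sub>R xmoment j k ^ l)"
  unfolding Psi_def by (simp add: pconst_mult)

lemma Psi_index_subset: "{(k, l). 1 \<le> k \<and> 1 \<le> l \<and> k * l \<le> r} \<subseteq> {1..r} \<times> {1..r :: nat}"
proof clarify
  fix k l :: nat assume kl: "1 \<le> k" "1 \<le> l" "k * l \<le> r"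
  have "k \<le> k * l" "l \<le> k * l" using kl by auto
  then have "k \<le> r" "l \<le> r" using kl(3) by (blast intro: order_trans)+
  then show "k \<in> {1..r} \<and> l \<in> {1..r}" using kl by simp
qed

lemma finite_Psi_index: "finite {(k, l). 1 \<le> k \<and> 1 \<le> l \<and> k * l \<le> (r :: nat)}"
  by (rule finite_subset[OF Psi_index_subset]) auto

context quadratic_module
begin

lemma sum_subset_le:
  assumes "finite I" "J \<subseteq> I" "\<And>i. i \<in> I \<Longrightarrow> g i \<in> Q"
  shows "sum g J \<preceq> sum g I"
  unfolding le_def using assms sum_diff[of I J g] sum_mem[of "I - J" g] by auto

lemma sum_le: "(\<And>i. i \<in> I \<Longrightarrow> g i \<preceq> h i) \<Longrightarrow> sum g I \<preceq> sum h I"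
  unfolding le_def sum_subtractf[symmetric] by (intro sum_mem) auto

text \<open>Polarisation: \<open>h\<close> is a quarter of
  \<open>(h + 1)\<^sup>2 - (h - 1)\<^sup>2\<close>, and each square meets \<open>g\<close> with a
  sign available in \<open>Q\<close>.\<close>

lemma ideal_mult_mem:
  assumes "g \<in> Q" "- g \<in> Q"
  shows "h * g \<in> Q"
proof -
  have "(1 / 4) *\<^sub>R ((h + 1)\<^sup>2 * g + (h - 1)\<^sup>2 * (- g)) = h * g"
  proof -
    have "(h + 1)\<^sup>2 * g + (h - 1)\<^sup>2 * (- g) = 4 * (h * g)"
      by (simp add: power2_eq_square algebra_simps)
    also have "\<dots> = 4 *\<^sub>R (h * g)" by (simp add: scaleR_conv_of_real)
    finally show ?thesis by simp
  qed
  moreover have "(1 / 4) *\<^sub>R ((h + 1)\<^sup>2 * g + (h - 1)\<^sup>2 * (- g)) \<in> Q"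
    using assms by (intro scaleR_mem add_mem square_mult_mem) auto
  ultimately show ?thesis by simp
qed

lemma power_mem: "x \<in> Q \<Longrightarrow> x ^ l \<in> Q"
  using even_power_mem[of x "l div 2"] even_power_mult_mem[of x x "l div 2"]
  by (cases "even l") (auto elim!: evenE oddE simp: mult.commute)

end

lemma Phi_term_mem:
  assumes "quadratic_module (Q :: 'n::finite mpoly set)"
  shows "(1 / fact k) *\<^sub>R pvar (Xv j) ^ (2 * k) \<in> Q"
  using assms by (intro quadratic_module.scaleR_mem quadratic_module.even_power_mem) auto

lemma weighted_Phi:
  assumes Q: "quadratic_module (Q :: 'n::finite mpoly set)"
  shows "weighted_module Q Phi"
proof -
  interpret quadratic_module Q by fact
  show ?thesis
  proof
    fix r
    have "Phi r \<preceq> Phi (Suc r)"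
      unfolding Phi_eq by (intro sum_subset_le) (auto intro: Phi_term_mem[OF Q])
    then show "Phi (Suc r) - Phi r \<in> Q" by (simp add: le_def)
    \<comment> \<open>One summand with \<open>k = 0\<close> is already 1; \<open>undefined\<close>
      only picks some index \<open>j\<close>.\<close>
    have "(\<Sum>(j, k)\<in>{(undefined :: 'n, 0 :: nat)}. (1 / fact k) *\<^sub>R pvar (Xv j) ^ (2 * k)) \<preceq> Phi 0"
      unfolding Phi_eq by (intro sum_subset_le) (auto intro: Phi_term_mem[OF Q])
    then show "Phi 0 - 1 \<in> Q" by (simp add: le_def)
  qed
qed

context weighted_module
begin

lemma factorial_growth_I:
  assumes "1 \<le> c" "\<And>k. (1 / (c ^ k * fact (2 * k))) *\<^sub>R g ^ (2 * k) \<preceq> \<theta> (r k)"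
  shows "factorial_growth g"
  unfolding factorial_growth_def
proof (intro exI[of _ c] conjI allI exI)
  fix k
  have pos: "0 < c ^ k * fact (2 * k)" using assms(1) by simp
  have "(c ^ k * fact (2 * k)) *\<^sub>R (1 / (c ^ k * fact (2 * k))) *\<^sub>R g ^ (2 * k) \<preceq> (c ^ k * fact (2 * k)) *\<^sub>R \<theta> (r k)"
    using pos assms(2) by (intro le_scaleR) auto
  then have *: "g ^ (2 * k) \<preceq> (c ^ k * fact (2 * k)) *\<^sub>R \<theta> (r k)" using pos assms(1) by simp
  show "g ^ (2 * k) \<preceq> (c ^ Suc k * fact (2 * k)) *\<^sub>R \<theta> (r k)"
    using pos assms(1) by (intro le_weight_mono[OF *]) (auto intro!: mult_right_mono power_increasing)
qed fact

end

text \<open>\<open>Phi k\<close> contains \<open>pvar (Xv j) ^ (2 * k)\<close> with coefficient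
  \<open>1 / fact k\<close>, at least the \<open>1 / fact (2 * k)\<close> required. A general
  \<theta> above \<open>Phi\<close> covers both weights in use.\<close>

lemma factorial_growth_Xv:
  assumes W: "weighted_module (Q :: 'n::finite mpoly set) \<theta>" and le: "\<And>r. \<theta> r - Phi r \<in> Q"
  shows "weighted_module.factorial_growth Q \<theta> (pvar (Xv j))"
proof -
  interpret weighted_module Q \<theta> by fact
  show ?thesis
  proof (rule factorial_growth_I[of 1])
    fix k
    have "(1 / (1 ^ k * fact (2 * k))) *\<^sub>R pvar (Xv j) ^ (2 * k) \<preceq> (1 / fact k) *\<^sub>R pvar (Xv j) ^ (2 * k)"
    proof (rule le_scaleR_left_mono)
      have "(fact k :: real) \<le> fact (2 * k)" by (intro fact_mono) simp
      then show "1 / (1 ^ k * fact (2 * k)) \<le> 1 / (fact k :: real)" by (simp add: divide_left_mono)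
    qed (simp add: le_def even_power_mem)
    also have "\<dots> = (\<Sum>(j, k)\<in>{(j, k)}. (1 / fact k) *\<^sub>R pvar (Xv j) ^ (2 * k))" by simp
    also have "\<dots> \<preceq> Phi k"
      unfolding Phi_eq by (intro sum_subset_le) (auto intro: Phi_term_mem[OF quadratic_module_axioms])
    also have "\<dots> \<preceq> \<theta> k" using le by (simp add: le_def)
    finally show "(1 / (1 ^ k * fact (2 * k))) *\<^sub>R pvar (Xv j) ^ (2 * k) \<preceq> \<theta> k" .
  qed simp
qed

text \<open>The bound holds modulo sums of squares alone, so \<open>mmap\<close> can be applied to
  it: such sums are mapped into every \<open>moment_quadratic_module\<close>.\<close>

lemma xmonomial_square_bound:
  fixes \<alpha> :: "'n::finite \<Rightarrow> nat"
  obtains t r where "0 \<le> t" "t *\<^sub>R Phi r - xmonomial \<alpha> ^ 2 \<in> qmod UNIV {}"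
proof -
  interpret weighted_module "qmod UNIV {} :: 'n mpoly set" Phi
    by (intro weighted_Phi quadratic_module_qmod)
  have "factorial_growth (pvar (Xv j))" for j :: 'n
    by (rule factorial_growth_Xv[OF weighted_module_axioms]) (simp add: zero_mem)
  then have pb: "power_bounded v" if "v \<in> range (\<lambda>j. pvar (Xv j))" for v :: "'n mpoly"
    using that factorial_growth_power_bounded by auto
  have "xmonomial \<alpha> \<in> generated_algebra (range (\<lambda>j. pvar (Xv j)))"
    unfolding xmonomial_def
    by (intro generated_algebra_prod generated_algebra_power generated_algebra.gen) auto
  with pb have "power_bounded (xmonomial \<alpha>)" by (rule power_bounded_generated)
  then have "bounded_above (xmonomial \<alpha> ^ (2 * 1))" unfolding power_bounded_def by blast
  then show ?thesis using that by (auto simp: bounded_above_def le_def)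
qed

locale moment_quadratic_module = quadratic_module Q for Q :: "'n::finite mpoly set" +
  assumes mmap_square_mem: "mmap (h\<^sup>2) \<in> Q"
begin

lemma xmoment_mem: "xmoment j k \<in> Q"
  using mmap_square_mem[of "pvar (Xv j) ^ k"] by (simp add: mult.commute flip: power_mult)

lemma Psi_term_mem: "(1 / (fact k ^ l * fact l)) *\<^sub>R xmoment j k ^ l \<in> Q"
  by (intro scaleR_mem power_mem xmoment_mem) auto

lemma Psi_mem: "Psi r \<in> Q"
  unfolding Psi_eq by (intro sum_mem) (auto intro!: sum_mem Psi_term_mem)

lemma weighted: "weighted_module Q (\<lambda>r. Phi r + Psi r)"
proof -
  interpret P: weighted_module Q Phi by (rule weighted_Phi) unfold_locales
  show ?thesis
  proof
    fix r
    have "Psi r \<preceq> Psi (Suc r)"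
      unfolding Psi_eq
      by (intro sum_le sum_subset_le finite_Psi_index) (auto intro: Psi_term_mem)
    then have "Phi r + Psi r \<preceq> Phi (Suc r) + Psi (Suc r)"
      by (intro le_add) (auto simp: le_def P.weight_Suc)
    then show "Phi (Suc r) + Psi (Suc r) - (Phi r + Psi r) \<in> Q" by (simp add: le_def)
    have "(Phi 0 - 1) + Psi 0 \<in> Q" by (intro add_mem P.weight_0 Psi_mem)
    then show "Phi 0 + Psi 0 - 1 \<in> Q" by (simp add: algebra_simps)
  qed
qed

sublocale weighted_module Q "\<lambda>r. Phi r + Psi r"
  by (rule weighted)

lemma Psi_le_weight: "Psi r \<preceq> Phi r + Psi r"
proof -
  have "Phi r \<in> Q" unfolding Phi_eq by (intro sum_mem) (auto intro: Phi_term_mem quadratic_module_axioms)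
  then show ?thesis by (simp add: le_def)
qed

text \<open>\<open>Psi (k * (2 * i))\<close> contains the power \<open>2 * i\<close> of the moment
  with coefficient \<open>1 / (fact k ^ (2 * i) * fact (2 * i))\<close>, whence the constant
  \<open>(fact k)\<^sup>2\<close>. For \<open>k = 0\<close>, absent from \<open>Psi\<close>, the
  moment is 1.\<close>

lemma factorial_growth_xmoment: "factorial_growth (xmoment j k)"
proof (cases "k = 0")
  case True
  then show ?thesis using factorial_growth_of_real[of 1] by (simp add: mmap_1)
next
  case k: False
  show ?thesis
  proof (rule factorial_growth_I[of "(fact k)\<^sup>2" _ "\<lambda>i. k * (2 * i)"])
    have "(1::real) \<le> fact k" by (rule fact_ge_1)
    then show "1 \<le> ((fact k)\<^sup>2 :: real)" by (rule one_le_power)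
    fix i
    show "(1 / (((fact k)\<^sup>2) ^ i * fact (2 * i))) *\<^sub>R xmoment j k ^ (2 * i) \<preceq> Phi (k * (2 * i)) + Psi (k * (2 * i))"
    proof (cases "i = 0")
      case True
      then show ?thesis using one_le_weight[of 0] by simp
    next
      case False
      let ?t = "\<lambda>j. \<lambda>(k, l). (1 / (fact k ^ l * fact l)) *\<^sub>R xmoment j k ^ l"
      let ?I = "{(k', l). 1 \<le> k' \<and> 1 \<le> l \<and> k' * l \<le> k * (2 * i)}"
      have "(1 / (((fact k)\<^sup>2) ^ i * fact (2 * i))) *\<^sub>R xmoment j k ^ (2 * i) = sum (?t j) {(k, 2 * i)}"
        by (simp only: power_mult[symmetric]) simp
      also have "\<dots> \<preceq> sum (?t j) ?I"
        using k False by (intro sum_subset_le finite_Psi_index) (auto intro: Psi_term_mem)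
      also have "\<dots> = (\<Sum>j\<in>{j}. sum (?t j) ?I)" by simp
      also have "\<dots> \<preceq> (\<Sum>j\<in>UNIV. sum (?t j) ?I)"
        by (intro sum_subset_le) (auto intro!: sum_mem Psi_term_mem)
      also have "\<dots> = Psi (k * (2 * i))" by (simp add: Psi_eq)
      also have "\<dots> \<preceq> Phi (k * (2 * i)) + Psi (k * (2 * i))" by (rule Psi_le_weight)
      finally show ?thesis .
    qed
  qed
qed

lemma mmap_Phi: "mmap (Phi r) = (\<Sum>(j, k)\<in>UNIV \<times> {0..r}. (1 / fact k) *\<^sub>R xmoment j k)"
  unfolding Phi_eq by (simp add: linear_sum[OF linear_mmap] linear_scale[OF linear_mmap] split_def)

text \<open>The terms of \<open>Psi r\<close> with \<open>l = 1\<close> are the terms of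
  \<open>mmap (Phi r)\<close> with \<open>k \<ge> 1\<close>; the term \<open>k = 0\<close>
  contributes 1 for each \<open>j\<close>.\<close>

lemma mmap_Phi_le: "mmap (Phi r) \<preceq> of_nat CARD('n) + Psi r"
proof -
  let ?t = "\<lambda>j. \<lambda>(k, l). (1 / (fact k ^ l * fact l)) *\<^sub>R xmoment j k ^ l"
  have "mmap (Phi r) = (\<Sum>j\<in>UNIV. (\<Sum>k\<in>{0..r}. (1 / fact k) *\<^sub>R xmoment j k))"
    by (simp add: mmap_Phi flip: sum.cartesian_product)
  also have "\<dots> = (\<Sum>j\<in>UNIV. 1 + sum (?t j) ((\<lambda>k. (k, 1)) ` {1..r}))"
    by (intro sum.cong refl) (simp add: sum.atLeast_Suc_atMost mmap_1 sum.reindex inj_on_def)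
  also have "\<dots> \<preceq> (\<Sum>j\<in>UNIV. 1 + sum (?t j) {(k, l). 1 \<le> k \<and> 1 \<le> l \<and> k * l \<le> r})"
    by (intro sum_le le_add le_refl sum_subset_le finite_Psi_index) (auto intro: Psi_term_mem)
  also have "\<dots> = of_nat CARD('n) + Psi r" by (simp add: Psi_eq sum.distrib)
  finally show ?thesis .
qed

lemma mmap_sos_mem: "p \<in> qmod UNIV {} \<Longrightarrow> mmap (h\<^sup>2 * p) \<in> Q"
proof (induction arbitrary: h rule: qmod.induct)
  case (add x y)
  then show ?case by (simp add: distrib_left linear_add[OF linear_mmap] add_mem)
next
  case (sq a x)
  then show ?case using sq.IH[of "h * a"] by (simp add: power_mult_distrib mult.assoc)
qed (auto intro: mmap_square_mem)

text \<open>A variance is nonnegative: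
  \<open>mmap ((x - m)\<^sup>2) = mmap (x\<^sup>2) - m\<^sup>2\<close> for the monomial
  \<open>x\<close> with \<open>mmap x = m\<close>. Since \<open>x\<^sup>2\<close> is bounded by a
  multiple of some \<open>Phi r\<close>, finitely many pure even moments control
  \<open>m\<close>.\<close>

lemma factorial_growth_Mv: "factorial_growth (pvar (Mv a))"
proof -
  let ?m = "pvar (Mv a) :: 'n mpoly" and ?x = "xmonomial (idx a)"
  have mx: "mmap ?x = ?m"
    using idx[of a] by (simp add: mmap_xmonomial mvar_def idx_inverse)
  obtain t r where t: "0 \<le> t" "t *\<^sub>R Phi r - ?x ^ 2 \<in> qmod UNIV {}" using xmonomial_square_bound by blast
  have "?m\<^sup>2 \<preceq> mmap (?x\<^sup>2)"
  proof -
    have "(?x - ?m)\<^sup>2 = ?x\<^sup>2 - ?m * ?x - ?m * ?x + ?m * ?m * 1" by (simp add: power2_eq_square algebra_simps)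
    then have "mmap ((?x - ?m)\<^sup>2) = mmap (?x\<^sup>2) - ?m * mmap ?x - ?m * mmap ?x + ?m * ?m * mmap 1"
      by (simp only: linear_add[OF linear_mmap] linear_diff[OF linear_mmap] mmap_mult_inM[OF inM_pvar]
          mmap_mult_inM[OF inM_mult[OF inM_pvar inM_pvar]])
    then have "mmap ((?x - ?m)\<^sup>2) = mmap (?x\<^sup>2) - ?m\<^sup>2" by (simp add: mx mmap_1 power2_eq_square)
    then show ?thesis using mmap_square_mem[of "?x - ?m"] by (simp add: le_def)
  qed
  also have "mmap (?x\<^sup>2) \<preceq> t *\<^sub>R mmap (Phi r)"
    using mmap_sos_mem[OF t(2), of 1] by (simp add: le_def linear_diff[OF linear_mmap] linear_scale[OF linear_mmap])
  finally have "?m\<^sup>2 \<preceq> t *\<^sub>R mmap (Phi r)" .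
  moreover have "factorial_growth (t *\<^sub>R mmap (Phi r))"
    unfolding mmap_Phi
    by (intro factorial_growth_scaleR factorial_growth_sum) (auto intro: factorial_growth_scaleR factorial_growth_xmoment)
  ultimately show ?thesis by (rule factorial_growth_square_le[rotated])
qed

lemma factorial_growth_pvar: "factorial_growth (pvar v)"
proof (cases v)
  case (Xv j)
  have "factorial_growth (pvar (Xv j))"
    by (rule factorial_growth_Xv[OF weighted]) (simp add: Psi_mem)
  then show ?thesis using Xv by simp
next
  case (Mv a)
  then show ?thesis using factorial_growth_Mv by simp
qed

end

section \<open>From characters to functionals positive on \<open>Kset\<close>\<close>

lemma real_ge_0_if_perturbed:
  fixes a C :: real
  assumes "\<And>\<epsilon>. \<epsilon> > 0 \<Longrightarrow> 0 \<le> a + \<epsilon> * C"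
  shows "0 \<le> a"
proof (rule ccontr)
  assume "\<not> 0 \<le> a"
  then have "0 \<le> a + (- a / (2 * (\<bar>C\<bar> + 1))) * C" by (intro assms) (auto simp: divide_neg_pos)
  also have "\<dots> \<le> a + (- a / (2 * (\<bar>C\<bar> + 1))) * (\<bar>C\<bar> + 1)"
    using \<open>\<not> 0 \<le> a\<close> by (intro add_left_mono mult_left_mono) (auto simp: divide_nonpos_pos)
  also have "\<dots> = a / 2" by (simp add: field_simps)
  finally show False using \<open>\<not> 0 \<le> a\<close> by simp
qed

lemma character_eq_point_eval:
  assumes "weighted_module (Q :: 'n::finite mpoly set) \<theta>"
    and \<phi>: "weighted_module.character Q \<theta> \<phi>"
  shows "\<phi> p = point_eval (\<lambda>a. \<phi> (pvar (Mv a))) (\<chi> j. \<phi> (pvar (Xv j))) p"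
proof -
  have "linear \<phi>" "\<phi> 1 = 1" "\<And>p q. \<phi> (p * q) = \<phi> p * \<phi> q"
    using \<phi> assms(1) by (auto simp: weighted_module.character_def)
  then have "\<phi> p = psubst (\<lambda>v. \<phi> (pvar v)) p" by (rule algebra_hom_eq_psubst)
  also have "\<dots> = point_eval (\<lambda>a. \<phi> (pvar (Mv a))) (\<chi> j. \<phi> (pvar (Xv j))) p"
    unfolding point_eval_def by (rule psubst_cong) (simp split: var.split)
  finally show ?thesis .
qed

lemma evalX_eq: "evalX X p = point_eval (\<lambda>_. 0) X p"
  by (simp add: evalX_def point_eval_def peval_eq_psubst)

lemma evalX_inRx: "inRx p \<Longrightarrow> evalX X p = point_eval \<tau> X p"
  unfolding evalX_eq point_eval_def by (rule psubst_cong_inRx) auto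

lemma closed_Kset: "closed (Kset S)"
proof -
  have "Kset S = (\<Inter>p\<in>S. {X. 0 \<le> point_eval (\<lambda>_. 0) X p})" by (auto simp: Kset_def evalX_eq)
  moreover have "closed {X. 0 \<le> point_eval (\<lambda>_. 0) X p}" for p :: "'a mpoly"
    by (rule closed_Collect_le[OF continuous_on_const continuous_on_point_eval])
  ultimately show ?thesis by auto
qed

text \<open>The scalars \<open>\<tau> a\<close> of the moment variables are kept fixed: the quadratic module contains
  \<open>\<plusminus> (Mv a - \<tau> a)\<close>, so its characters are evaluations at points of \<open>Kset S1\<close>.\<close>
lemma nonneg_on_Kset_approx:
  fixes S1 :: "'n::finite mpoly set"
  assumes S1: "\<And>s. s \<in> S1 \<Longrightarrow> inRx s" and p: "\<And>y. y \<in> Kset S1 \<Longrightarrow> 0 \<le> point_eval \<tau> y p"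
    and \<epsilon>: "\<epsilon> > 0"
  shows "\<exists>r. p + \<epsilon> *\<^sub>R Phi r \<in> qmod UNIV (S1 \<union> range (\<lambda>a. pvar (Mv a) - of_real (\<tau> a)) \<union>
    range (\<lambda>a. of_real (\<tau> a) - pvar (Mv a)))" (is "\<exists>r. _ \<in> qmod UNIV ?G")
proof -
  interpret weighted_module "qmod UNIV ?G" Phi
    by (intro weighted_Phi quadratic_module_qmod)
  have mem: "pvar (Mv a) - of_real (\<tau> a) \<in> qmod UNIV ?G" "of_real (\<tau> a) - pvar (Mv a) \<in> qmod UNIV ?G" for a
    by (auto intro: qmod.gen)
  have fg: "factorial_growth (pvar v)" for v
  proof (cases v)
    case (Xv j)
    have "factorial_growth (pvar (Xv j))"
      by (rule factorial_growth_Xv[OF weighted_module_axioms]) (simp add: zero_mem)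
    then show ?thesis using Xv by simp
  next
    case (Mv a)
    have "(pvar (Mv a) + of_real (\<tau> a)) * (of_real (\<tau> a) - pvar (Mv a)) \<in> qmod UNIV ?G"
      using mem[of a] by (intro ideal_mult_mem) auto
    then have "le ((pvar (Mv a))\<^sup>2) (of_real ((\<tau> a)\<^sup>2))"
      by (simp add: le_def power2_eq_square algebra_simps)
    then have "factorial_growth (pvar (Mv a))"
      by (rule factorial_growth_square_le[OF factorial_growth_of_real])
    then show ?thesis using Mv by simp
  qed
  show ?thesis
  proof (rule weighted_positivstellensatz[OF _ generated_algebra_pvar _ \<epsilon>])
    show "factorial_growth v" if "v \<in> range pvar" for v using that fg by auto
    fix \<phi> assume \<phi>: "character \<phi>"
    have nn: "0 \<le> \<phi> q" if "q \<in> qmod UNIV ?G" for q using \<phi> that by (auto simp: character_def)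
    have lin: "linear \<phi>" and one: "\<phi> 1 = 1" using \<phi> by (auto simp: character_def)
    have "\<phi> (pvar (Mv a)) = \<tau> a" for a
      using nn[OF mem(1)[of a]] nn[OF mem(2)[of a]]
      by (simp add: linear_diff[OF lin] linear_scale[OF lin] one of_real_def)
    then have eq: "\<phi> q = point_eval \<tau> (\<chi> j. \<phi> (pvar (Xv j))) q" for q
      using character_eq_point_eval[OF weighted_module_axioms \<phi>, of q] by simp
    have "(\<chi> j. \<phi> (pvar (Xv j))) \<in> Kset S1"
      unfolding Kset_def
    proof (clarify)
      fix s assume s: "s \<in> S1"
      then have "0 \<le> \<phi> s" by (intro nn qmod.gen) auto
      then show "0 \<le> evalX (\<chi> j. \<phi> (pvar (Xv j))) s"
        using evalX_inRx[OF S1[OF s], of _ \<tau>] eq[of s] by simp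
    qed
    then show "0 \<le> \<phi> p" using p eq[of p] by simp
  qed
qed

text \<open>\<open>S1\<close> constrains the measure and \<open>T\<close> the point
  \<open>X\<close>: the first equivalence uses \<open>T = S1\<close>, the second takes for
  \<open>T\<close> both signs of all \<open>pvar (Xv j)\<close>. The hypothesis \<open>rep\<close>
  isolates what remains once a character has been turned into the functional
  \<open>l\<close>.\<close>

theorem perturbation_mem_if_representable:
  fixes S1 S2 T :: "'n::finite mpoly set"
  assumes S1: "\<And>s. s \<in> S1 \<Longrightarrow> inRx s" and T: "\<And>s. s \<in> T \<Longrightarrow> inRx s" and \<epsilon>: "\<epsilon> > 0"
    and rep: "\<And>\<tau> X l. linear l \<Longrightarrow> l 1 = 1 \<Longrightarrow>
      (\<And>p. (\<And>y. y \<in> Kset S1 \<Longrightarrow> 0 \<le> point_eval \<tau> y p) \<Longrightarrow> 0 \<le> l p) \<Longrightarrow>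
      (\<And>a. l (xmonomial (idx a)) = \<tau> a) \<Longrightarrow> (\<And>s. s \<in> S2 \<Longrightarrow> 0 \<le> point_eval \<tau> X s) \<Longrightarrow>
      X \<in> Kset T \<Longrightarrow> 0 \<le> point_eval \<tau> X f"
  shows "\<exists>r\<ge>1. f + \<epsilon> *\<^sub>R (Phi r + Psi r) \<in> qmod UNIV (T \<union> mgens S1 \<union> S2)"
proof -
  let ?Q = "qmod UNIV (T \<union> mgens S1 \<union> S2)"
  interpret quadratic_module ?Q by (rule quadratic_module_qmod)
  have mg: "mmap (h\<^sup>2 * s) \<in> ?Q" if "s \<in> insert 1 S1" for h s
    using that by (intro qmod.gen) (auto simp: mgens_def)
  interpret moment_quadratic_module ?Q
    using mg[of 1] by unfold_locales simp
  have "\<exists>r. f + \<epsilon> *\<^sub>R (Phi r + Psi r) \<in> ?Q"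
  proof (rule weighted_positivstellensatz[OF _ generated_algebra_pvar _ \<epsilon>])
    show "factorial_growth v" if "v \<in> range pvar" for v using that factorial_growth_pvar by auto
    fix \<phi> assume \<phi>: "character \<phi>"
    have nn: "0 \<le> \<phi> q" if "q \<in> ?Q" for q using \<phi> that by (auto simp: character_def)
    have lin: "linear \<phi>" and one: "\<phi> 1 = 1" and mult: "\<And>p q. \<phi> (p * q) = \<phi> p * \<phi> q"
      using \<phi> by (auto simp: character_def)
    obtain C where C: "\<And>r. \<phi> (Phi r + Psi r) \<le> C" using \<phi> by (auto simp: character_def)
    have pos\<phi>: "positive \<phi>" using lin nn by (simp add: positive_def)
    define \<tau> where "\<tau> a = \<phi> (pvar (Mv a))" for a
    define X where "X = (\<chi> j. \<phi> (pvar (Xv j)))"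
    have eq: "\<phi> q = point_eval \<tau> X q" for q
      unfolding \<tau>_def X_def by (rule character_eq_point_eval[OF weighted_module_axioms \<phi>])
    \<comment> \<open>\<open>l\<close> stands in for integration against the measure sought.\<close>
    define l where "l p = \<phi> (mmap p)" for p
    have linl: "linear l" unfolding l_def using linear_compose[OF linear_mmap lin] by (simp add: comp_def)
    \<comment> \<open>The index \<open>r\<close> used below depends on \<delta>, so only a bound
      uniform in \<open>r\<close> lets \<delta> tend to 0.\<close>
    have lPhi: "l (Phi r) \<le> real CARD('n) + C" for r
    proof -
      have "l (Phi r) \<le> \<phi> (of_nat CARD('n) + Psi r)"
        unfolding l_def by (rule positive_mono[OF pos\<phi> mmap_Phi_le])
      also have "\<dots> = real CARD('n) + \<phi> (Psi r)"
        using linear_scale[OF lin, of "real CARD('n)" 1] by (simp add: linear_add[OF lin] one scaleR_conv_of_real)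
      also have "\<phi> (Psi r) \<le> C"
        using positive_mono[OF pos\<phi> Psi_le_weight[of r]] C[of r] by simp
      finally show ?thesis by simp
    qed
    let ?G = "S1 \<union> range (\<lambda>a. pvar (Mv a) - of_real (\<tau> a)) \<union> range (\<lambda>a. of_real (\<tau> a) - pvar (Mv a))"
    have lpos: "0 \<le> l (h\<^sup>2 * q)" if "q \<in> qmod UNIV ?G" for h q
      using that
    proof (induction arbitrary: h rule: qmod.induct)
      case one
      show ?case unfolding l_def by (intro nn mg) auto
    next
      case (gen g)
      \<comment> \<open>\<open>pvar (Mv a) - of_real (\<tau> a)\<close> can be pulled out of
        \<open>mmap\<close>, and \<phi> vanishes on it, so the generators of both signs contribute
        0.\<close>
      have ann: "l (h\<^sup>2 * (c *\<^sub>R (pvar (Mv a) - of_real (\<tau> a)))) = 0" for c a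
      proof -
        have "inM (pvar (Mv a) - of_real (\<tau> a))"
          using inM_add[OF inM_pvar inM_pconst[of "- \<tau> a"], of a] by (simp add: pconst_eq_of_real)
        then have "mmap ((pvar (Mv a) - of_real (\<tau> a)) * h\<^sup>2) = (pvar (Mv a) - of_real (\<tau> a)) * mmap (h\<^sup>2)"
          by (rule mmap_mult_inM)
        then have "l (h\<^sup>2 * (pvar (Mv a) - of_real (\<tau> a))) = \<phi> (pvar (Mv a) - of_real (\<tau> a)) * \<phi> (mmap (h\<^sup>2))"
          by (simp add: l_def mult mult.commute)
        also have "\<phi> (pvar (Mv a) - of_real (\<tau> a)) = 0" by (simp add: eq)
        finally show ?thesis by (simp add: linear_scale[OF linl])
      qed
      consider "g \<in> S1" | a where "g = pvar (Mv a) - of_real (\<tau> a)" | a where "g = of_real (\<tau> a) - pvar (Mv a)"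
        using gen by blast
      then show ?case
      proof cases
        case 1
        then show ?thesis unfolding l_def by (intro nn mg) auto
      next
        case 2
        then show ?thesis using ann[of 1] by simp
      next
        case 3
        then show ?thesis using ann[of "-1"] by simp
      qed
    next
      case (add x y)
      then show ?case by (simp add: distrib_left linear_add[OF linl])
    next
      case (sq a x)
      then show ?case using sq.IH[of "h * a"] by (simp add: power_mult_distrib mult.assoc)
    qed
    have "0 \<le> point_eval \<tau> X f"
    proof (rule rep[OF linl])
      show "l 1 = 1" by (simp add: l_def mmap_1 one)
      show "l (xmonomial (idx a)) = \<tau> a" for a
        using idx[of a] by (simp add: l_def \<tau>_def mmap_xmonomial mvar_def idx_inverse)
      show "0 \<le> point_eval \<tau> X s" if "s \<in> S2" for s
        using nn[of s] that by (auto simp: eq intro: qmod.gen)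
      show "X \<in> Kset T"
        unfolding Kset_def
      proof clarify
        fix s assume s: "s \<in> T"
        then have "0 \<le> \<phi> s" by (intro nn qmod.gen) auto
        then show "0 \<le> evalX X s" using evalX_inRx[OF T[OF s], of X \<tau>] eq[of s] by simp
      qed
      show "0 \<le> l p" if p: "\<And>y. y \<in> Kset S1 \<Longrightarrow> 0 \<le> point_eval \<tau> y p" for p
      proof (rule real_ge_0_if_perturbed)
        fix \<delta> :: real assume \<delta>: "\<delta> > 0"
        obtain r where "p + \<delta> *\<^sub>R Phi r \<in> qmod UNIV ?G"
          using nonneg_on_Kset_approx[OF S1 p \<delta>] by blast
        from lpos[OF this, of 1] have "0 \<le> l p + \<delta> * l (Phi r)"
          by (simp add: linear_add[OF linl] linear_scale[OF linl])
        also have "\<dots> \<le> l p + \<delta> * (real CARD('n) + C)"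
          using \<delta> lPhi by (intro add_left_mono mult_left_mono) auto
        finally show "0 \<le> l p + \<delta> * (real CARD('n) + C)" .
      qed
    qed
    then show "0 \<le> \<phi> f" by (simp add: eq)
  qed
  then obtain r where r: "f + \<epsilon> *\<^sub>R (Phi r + Psi r) \<in> ?Q" by blast
  have "le (\<epsilon> *\<^sub>R (Phi r + Psi r)) (\<epsilon> *\<^sub>R (Phi (max r 1) + Psi (max r 1)))"
    using \<epsilon> by (intro le_scaleR weight_mono) auto
  from add_mem[OF r this[unfolded le_def]] show ?thesis
    by (intro exI[of _ "max r 1"]) (simp add: algebra_simps)
qed

section \<open>Measures\<close>

lemma evalMX_eq: "evalMX \<mu> X = point_eval (\<lambda>a. moment \<mu> (idx a)) X"
proof
  fix p
  show "evalMX \<mu> X p = point_eval (\<lambda>a. moment \<mu> (idx a)) X p"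
    unfolding evalMX_def point_eval_def peval_eq_psubst by (rule psubst_cong) (simp split: var.split)
qed

lemma linear_point_eval: "linear (point_eval \<tau> y)"
  unfolding point_eval_def by (rule linear_psubst)

lemma point_eval_inM: "inM p \<Longrightarrow> point_eval \<tau> X p = point_eval \<tau> Y p"
  unfolding point_eval_def by (rule psubst_cong_inM) auto

definition mvars :: "'n mpoly \<Rightarrow> 'n nzidx set" where
  "mvars p = {a. \<exists>m\<in>Poly_Mapping.keys p. Mv a \<in> Poly_Mapping.keys m}"

lemma finite_mvars: "finite (mvars p)"
proof -
  have "mvars p = (\<Union>m\<in>Poly_Mapping.keys p. Mv -` Poly_Mapping.keys m)" by (auto simp: mvars_def)
  then show ?thesis by (simp add: finite_vimageI inj_def)
qed

lemma point_eval_cong_mvars: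
  "(\<And>a. a \<in> mvars p \<Longrightarrow> \<tau> a = \<tau>' a) \<Longrightarrow> point_eval \<tau> X p = point_eval \<tau>' X p"
  unfolding point_eval_def by (rule psubst_cong) (auto simp: mvars_def split: var.split)

lemma Pmeas_borel_measurable:
  assumes "\<mu> \<in> Pmeas K"
  shows "(\<lambda>y. point_eval \<tau> y p) \<in> borel_measurable \<mu>"
proof -
  have "(\<lambda>y. point_eval \<tau> y p) \<in> borel_measurable borel"
    by (intro borel_measurable_continuous_onI continuous_on_point_eval)
  then show ?thesis using assms by (simp add: Pmeas_def cong: measurable_cong_sets)
qed

text \<open>\<open>Pmeas\<close> gives integrability of pure even powers only, so mixed monomials
  are avoided: \<open>xweight\<close> is at most \<open>1 + n\<close> times the largest of 1 and the
  \<open>(y $ j)\<^sup>2\<close>, and the \<open>N\<close>-th power of that maximum is one of the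
  terms on the right.\<close>

lemma xweight_power_le:
  fixes y :: "real ^ 'n::finite"
  shows "point_eval \<tau> y xweight ^ N \<le> (1 + real CARD('n)) ^ N * (1 + (\<Sum>j\<in>UNIV. (y $ j) ^ (2 * N)))"
proof -
  define M where "M = Max (insert 1 (range (\<lambda>j. (y $ j)\<^sup>2)))"
  have M: "M \<in> insert 1 (range (\<lambda>j. (y $ j)\<^sup>2))" unfolding M_def by (rule Max_in) auto
  have M1: "1 \<le> M" "\<And>j. (y $ j)\<^sup>2 \<le> M" unfolding M_def by (rule Max_ge; simp)+
  have nn: "0 \<le> (\<Sum>j\<in>UNIV. (y $ j) ^ (2 * N))" by (intro sum_nonneg) (simp add: power_mult)
  have "point_eval \<tau> y xweight \<le> M + (\<Sum>j\<in>(UNIV :: 'n set). M)"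
    unfolding point_eval_xweight by (intro add_mono sum_mono M1)
  also have "\<dots> = (1 + real CARD('n)) * M" by (simp add: algebra_simps)
  finally have "point_eval \<tau> y xweight ^ N \<le> ((1 + real CARD('n)) * M) ^ N"
    using one_le_point_eval_xweight[of \<tau> y] by (intro power_mono) auto
  also have "\<dots> = (1 + real CARD('n)) ^ N * M ^ N" by (rule power_mult_distrib)
  also have "\<dots> \<le> (1 + real CARD('n)) ^ N * (1 + (\<Sum>j\<in>UNIV. (y $ j) ^ (2 * N)))"
  proof (rule mult_left_mono)
    consider "M = 1" | j where "M = (y $ j)\<^sup>2" using M by blast
    then show "M ^ N \<le> 1 + (\<Sum>j\<in>UNIV. (y $ j) ^ (2 * N))"
    proof cases
      case 2
      have "(y $ j) ^ (2 * N) \<le> (\<Sum>j\<in>UNIV. (y $ j) ^ (2 * N))"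
        by (intro member_le_sum) (auto simp: power_mult)
      then show ?thesis using 2 by (simp add: power_mult)
    qed (use nn in auto)
  qed simp
  finally show ?thesis .
qed

lemma Pmeas_integrable:
  assumes \<mu>: "\<mu> \<in> Pmeas (K :: (real ^ 'n::finite) set)"
  shows "integrable \<mu> (\<lambda>y. point_eval \<tau> y p)"
proof -
  interpret prob_space \<mu> using \<mu> by (simp add: Pmeas_def)
  obtain C N where C: "0 \<le> C" "\<And>y. \<bar>point_eval \<tau> y p\<bar> \<le> C * (point_eval \<tau> y xweight) ^ N"
    using point_eval_growth by blast
  show ?thesis
  proof (rule Bochner_Integration.integrable_bound)
    show "integrable \<mu> (\<lambda>y. C * ((1 + real CARD('n)) ^ N * (1 + (\<Sum>j\<in>UNIV. (y $ j) ^ (2 * N)))))"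
      using \<mu> by (intro integrable_mult_right Bochner_Integration.integrable_add Bochner_Integration.integrable_sum)
        (auto simp: Pmeas_def)
    show "AE y in \<mu>. norm (point_eval \<tau> y p) \<le> norm (C * ((1 + real CARD('n)) ^ N * (1 + (\<Sum>j\<in>UNIV. (y $ j) ^ (2 * N)))))"
    proof (rule AE_I2)
      fix y
      have "norm (point_eval \<tau> y p) \<le> C * (point_eval \<tau> y xweight) ^ N" using C(2) by simp
      also have "\<dots> \<le> C * ((1 + real CARD('n)) ^ N * (1 + (\<Sum>j\<in>UNIV. (y $ j) ^ (2 * N))))"
        using C(1) by (intro mult_left_mono xweight_power_le)
      finally show "norm (point_eval \<tau> y p) \<le> norm (C * ((1 + real CARD('n)) ^ N * (1 + (\<Sum>j\<in>UNIV. (y $ j) ^ (2 * N)))))"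
        by simp
    qed
  qed (rule Pmeas_borel_measurable[OF \<mu>])
qed

lemma moment_eq: "moment \<mu> \<alpha> = (\<integral>y. point_eval \<tau> y (xmonomial \<alpha>) \<partial>\<mu>)"
  by (simp add: moment_def xmonomial_def)

lemma linear_integral_point_eval:
  assumes "\<mu> \<in> Pmeas (K :: (real ^ 'n::finite) set)"
  shows "linear (\<lambda>p. \<integral>y. point_eval \<tau> y p \<partial>\<mu>)"
  by (rule linearI) (simp_all add: Pmeas_integrable[OF assms])

text \<open>Both sides are linear in \<open>p\<close>. On a monomial the moment variables are
  constants for the integral, and the part in \<open>x\<close> integrates to the moment that
  \<open>mvar\<close> stands for.\<close>

lemma evalMX_mmap:
  assumes \<mu>: "\<mu> \<in> Pmeas (K :: (real ^ 'n::finite) set)"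
  shows "evalMX \<mu> X (mmap p) = (\<integral>y. evalMX \<mu> y p \<partial>\<mu>)"
proof -
  interpret prob_space \<mu> using \<mu> by (simp add: Pmeas_def)
  let ?\<tau> = "\<lambda>a. moment \<mu> (idx a)"
  have lin: "linear (\<lambda>p. point_eval ?\<tau> X (mmap p))"
    using linear_compose[OF linear_mmap linear_point_eval] by (simp add: comp_def)
  have "point_eval ?\<tau> X (mmap p) = (\<integral>y. point_eval ?\<tau> y p \<partial>\<mu>)"
  proof (rule linear_eq_on_monomials[OF lin linear_integral_point_eval[OF \<mu>]])
    fix m :: "'n var \<Rightarrow>\<^sub>0 nat"
    let ?v = "monomial_value (case_var (\<lambda>_. 1) ?\<tau>) m"
    have v: "point_eval \<tau> y (monomial_value \<sigma> m) = monomial_value (\<lambda>v. point_eval \<tau> y (\<sigma> v)) m"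
      for \<tau> and y :: "real ^ 'n" and \<sigma>
      by (simp add: monomial_value_def)
    have "monomial_value (\<lambda>v. point_eval ?\<tau> X (case_var (\<lambda>_. 1) (\<lambda>a. pvar (Mv a)) v)) m = ?v"
      by (rule monomial_value_cong) (simp split: var.split)
    then have mp: "point_eval ?\<tau> X (mpart m) = ?v" by (simp only: mpart_eq v)
    have mv: "point_eval ?\<tau> X (mvar (xexp m)) = moment \<mu> (xexp m)"
      by (auto simp: mvar_def Abs_nzidx_inverse moment_def prob_space)
    have "point_eval ?\<tau> X (mmap (Poly_Mapping.single m 1)) = ?v * moment \<mu> (xexp m)"
      by (simp add: mmap_single mp mv)
    also have "\<dots> = (\<integral>y. ?v * point_eval ?\<tau> y (xmonomial (xexp m)) \<partial>\<mu>)"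
      by (simp only: moment_eq[of \<mu> "xexp m" ?\<tau>] integral_mult_right_zero)
    also have "\<dots> = (\<integral>y. point_eval ?\<tau> y (Poly_Mapping.single m 1) \<partial>\<mu>)"
    proof (rule Bochner_Integration.integral_cong[OF refl])
      fix y :: "real ^ 'n"
      show "?v * point_eval ?\<tau> y (xmonomial (xexp m)) = point_eval ?\<tau> y (Poly_Mapping.single m 1)"
        by (simp add: point_eval_def[of ?\<tau> y] psubst_single monomial_value_split[of "case_var (\<lambda>j. y $ j) ?\<tau>"]
            xmonomial_def psubst_prod psubst_power)
    qed
    finally show "point_eval ?\<tau> X (mmap (Poly_Mapping.single m 1)) = (\<integral>y. point_eval ?\<tau> y (Poly_Mapping.single m 1) \<partial>\<mu>)" .
  qed
  then show ?thesis by (simp add: evalMX_eq)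
qed

lemma Pmeas_AE:
  assumes \<mu>: "\<mu> \<in> Pmeas K" and K: "closed K"
  shows "AE y in \<mu>. y \<in> K"
proof (rule AE_I)
  show "{y \<in> space \<mu>. \<not> y \<in> K} \<subseteq> UNIV - K" by auto
  show "emeasure \<mu> (UNIV - K) = 0" using \<mu> by (simp add: Pmeas_def)
  show "UNIV - K \<in> sets \<mu>"
    using \<mu> borel_open[OF open_Diff[OF open_UNIV K]] by (simp add: Pmeas_def)
qed

text \<open>A generator \<open>mmap (h\<^sup>2 * s)\<close> evaluates to the integral of a function
  that is nonnegative almost everywhere. The multiplier set \<open>A\<close> is left open to serve
  \<open>QM\<close> and \<open>qm\<close> alike.\<close>

lemma evalMX_qmod_nonneg:
  assumes S1: "\<And>s. s \<in> S1 \<Longrightarrow> inRx s" and S2: "\<And>s. s \<in> S2 \<Longrightarrow> inM s" and T: "\<And>s. s \<in> T \<Longrightarrow> inRx s"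
    and \<mu>: "\<mu> \<in> KK S1 S2" and X: "X \<in> Kset T" and q: "q \<in> qmod A (T \<union> mgens S1 \<union> S2)"
  shows "0 \<le> evalMX \<mu> X q"
  using q
proof induction
  case (gen g)
  have P: "\<mu> \<in> Pmeas (Kset S1)" using \<mu> by (simp add: KK_def)
  consider "g \<in> T" | h s where "g = mmap (h\<^sup>2 * s)" "s \<in> insert 1 S1" | "g \<in> S2"
    using gen by (auto simp: mgens_def)
  then show ?case
  proof cases
    case 1
    then show ?thesis using X evalX_inRx[OF T[OF 1]] by (auto simp: Kset_def evalMX_eq)
  next
    case 2
    have "AE y in \<mu>. y \<in> Kset S1" by (rule Pmeas_AE[OF P closed_Kset])
    then have "AE y in \<mu>. 0 \<le> evalMX \<mu> y (h\<^sup>2 * s)"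
    proof (rule AE_mp, intro AE_I2 impI)
      fix y assume "y \<in> Kset S1"
      then have "0 \<le> evalMX \<mu> y s"
        using 2(2) evalX_inRx[OF S1] by (auto simp: Kset_def evalMX_eq)
      then show "0 \<le> evalMX \<mu> y (h\<^sup>2 * s)" by (simp add: evalMX_eq)
    qed
    then have "0 \<le> (\<integral>y. evalMX \<mu> y (h\<^sup>2 * s) \<partial>\<mu>)" by (rule integral_nonneg_AE)
    then show ?thesis using 2(1) evalMX_mmap[OF P] by simp
  next
    case 3
    then have "0 \<le> evalMX \<mu> 0 g" using \<mu> by (auto simp: KK_def evalM_def)
    then show ?thesis using point_eval_inM[OF S2[OF 3], of _ 0 X] by (simp add: evalMX_eq)
  qed
qed (simp_all add: evalMX_eq)

text \<open>\<open>point_measure\<close> carries the power set of \<open>Y\<close> as its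
  sigma-algebra; pushing it to \<open>borel\<close> gives the sets that \<open>Pmeas\<close> asks
  for.\<close>

definition atomic_measure :: "(real ^ 'n) set \<Rightarrow> (real ^ 'n \<Rightarrow> real) \<Rightarrow> (real ^ 'n) measure" where
  "atomic_measure Y w = distr (point_measure Y (\<lambda>y. ennreal (w y))) borel (\<lambda>y. y)"

lemma
  assumes Y: "finite Y" and w: "\<And>y. 0 \<le> w y" "sum w Y = 1"
  shows prob_space_atomic_measure: "prob_space (atomic_measure Y w)"
    and sets_atomic_measure: "sets (atomic_measure Y w) = sets borel"
    and atomic_measure_null: "Y \<subseteq> K \<Longrightarrow> closed K \<Longrightarrow> emeasure (atomic_measure Y w) (UNIV - K) = 0"
    and integrable_atomic_measure: "g \<in> borel_measurable borel \<Longrightarrow> integrable (atomic_measure Y w) (g :: real ^ 'n \<Rightarrow> real)"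
    and integral_atomic_measure: "g \<in> borel_measurable borel \<Longrightarrow> integral\<^sup>L (atomic_measure Y w) (g :: real ^ 'n \<Rightarrow> real) = (\<Sum>y\<in>Y. w y * g y)"
proof -
  let ?P = "point_measure Y (\<lambda>y. ennreal (w y))"
  have meas: "(\<lambda>y. y) \<in> measurable ?P borel" by (simp add: measurable_def space_point_measure sets_point_measure)
  have "prob_space ?P"
  proof
    have "emeasure ?P (space ?P) = (\<Sum>y\<in>Y. ennreal (w y))"
      using Y by (simp add: space_point_measure emeasure_point_measure_finite)
    also have "\<dots> = ennreal (sum w Y)" using w(1) by (rule sum_ennreal)
    finally show "emeasure ?P (space ?P) = 1" using w(2) by simp
  qed
  then show "prob_space (atomic_measure Y w)"
    unfolding atomic_measure_def using meas by (rule prob_space.prob_space_distr)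
  show "sets (atomic_measure Y w) = sets borel" by (simp add: atomic_measure_def)
  show "emeasure (atomic_measure Y w) (UNIV - K) = 0" if K: "Y \<subseteq> K" "closed K"
  proof -
    have "(\<lambda>y. y) -` (UNIV - K) \<inter> space ?P = {}" using K by (auto simp: space_point_measure)
    then show ?thesis unfolding atomic_measure_def using K meas by (subst emeasure_distr) auto
  qed
  have int: "integrable ?P g" for g :: "real ^ 'n \<Rightarrow> real"
    using Y by (rule integrable_point_measure_finite)
  show "integrable (atomic_measure Y w) g" if "g \<in> borel_measurable borel"
    unfolding atomic_measure_def using that int meas by (subst integrable_distr_eq) auto
  show "integral\<^sup>L (atomic_measure Y w) g = (\<Sum>y\<in>Y. w y * g y)" if "g \<in> borel_measurable borel"
    unfolding atomic_measure_def using that meas Y w(1)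
    by (subst integral_distr) (auto simp: lebesgue_integral_point_measure_finite)
qed

lemma atomic_measure_Pmeas:
  fixes Y :: "(real ^ 'n::finite) set"
  assumes "finite Y" "\<And>y. 0 \<le> w y" "sum w Y = 1" "Y \<subseteq> K" "closed K"
  shows "atomic_measure Y w \<in> Pmeas K"
  using assms prob_space_atomic_measure[OF assms(1-3)] sets_atomic_measure[OF assms(1-3)]
    atomic_measure_null[OF assms(1-5)]
  by (auto simp: Pmeas_def intro!: integrable_atomic_measure[OF assms(1-3)])

text \<open>Only the moment variables occurring in \<open>f\<close> or \<open>S2\<close> are
  matched, and finiteness of \<open>S2\<close> makes them finitely many. Other moments of the atomic
  measure may differ from \<tau>, which \<open>f\<close> and \<open>S2\<close> do not see.\<close>

theorem atomic_measure_representation: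
  fixes l :: "'n::finite mpoly \<Rightarrow> real"
  assumes S2: "finite S2" "\<And>s. s \<in> S2 \<Longrightarrow> inM s"
    and lin: "linear l" and one: "l 1 = 1"
    and pos: "\<And>p. (\<And>y. y \<in> Kset S1 \<Longrightarrow> 0 \<le> point_eval \<tau> y p) \<Longrightarrow> 0 \<le> l p"
    and \<tau>: "\<And>a. l (xmonomial (idx a)) = \<tau> a"
    and S2_pos: "\<And>s. s \<in> S2 \<Longrightarrow> 0 \<le> point_eval \<tau> X s"
  obtains Y w where "finite Y" "\<And>y. 0 \<le> w y" "sum w Y = 1" "atomic_measure Y w \<in> KK S1 S2"
    "\<And>X. evalMX (atomic_measure Y w) X f = point_eval \<tau> X f"
proof -
  define V where "V = (\<Union>p\<in>insert f S2. mvars p)"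
  have "finite V" unfolding V_def using S2 finite_mvars by auto
  then have "finite ((\<lambda>a. xmonomial (idx a)) ` V)" by simp
  then have "\<exists>Y w. finite Y \<and> Y \<subseteq> Kset S1 \<and> (\<forall>y. 0 \<le> w y) \<and> sum w Y = (1::real) \<and>
      (\<forall>p\<in>(\<lambda>a. xmonomial (idx a)) ` V. l p = (\<Sum>y\<in>Y. w y * point_eval \<tau> y p))"
    by (rule finitely_atomic_representation[OF lin one _ closed_Kset pos])
  then obtain Y w where Y: "finite Y" "Y \<subseteq> Kset S1" "\<And>y. 0 \<le> w y" "sum w Y = 1"
    and "\<forall>p\<in>(\<lambda>a. xmonomial (idx a)) ` V. l p = (\<Sum>y\<in>Y. w y * point_eval \<tau> y p)"
    by blast
  then have rep: "l (xmonomial (idx a)) = (\<Sum>y\<in>Y. w y * point_eval \<tau> y (xmonomial (idx a)))" if "a \<in> V" for a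
    using that by blast
  let ?\<mu> = "atomic_measure Y w"
  have m: "moment ?\<mu> (idx a) = \<tau> a" if "a \<in> V" for a
    unfolding moment_eq[of _ _ \<tau>] \<tau>[symmetric] rep[OF that]
    by (intro integral_atomic_measure Y borel_measurable_continuous_onI continuous_on_point_eval)
  have eq: "evalMX ?\<mu> X p = point_eval \<tau> X p" if "p \<in> insert f S2" for p X
    unfolding evalMX_eq using that by (intro point_eval_cong_mvars m) (auto simp: V_def)
  have "?\<mu> \<in> Pmeas (Kset S1)" by (intro atomic_measure_Pmeas Y closed_Kset)
  moreover have "0 \<le> evalM ?\<mu> s" if "s \<in> S2" for s
    using S2_pos[OF that] eq[of s 0] that point_eval_inM[OF S2(2)[OF that], of \<tau> 0 X] by (simp add: evalM_def)
  ultimately have "?\<mu> \<in> KK S1 S2" by (simp add: KK_def)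
  then show ?thesis using that Y eq by blast
qed

section \<open>Boundedness of the weights at finitely supported measures\<close>

lemma sum_power_div_fact_le_exp:
  fixes x :: real
  assumes "0 \<le> x" "finite I"
  shows "(\<Sum>k\<in>I. x ^ k / fact k) \<le> exp x"
proof -
  have "(\<Sum>k\<in>I. x ^ k / fact k) = (\<Sum>k\<in>I. x ^ k /\<^sub>R fact k)"
    by (simp add: divide_inverse mult.commute)
  also have "\<dots> \<le> suminf (\<lambda>k. x ^ k /\<^sub>R fact k)"
    by (rule sum_le_suminf[OF summable_exp_generic assms(2)]) (use assms(1) in auto)
  finally show ?thesis by (simp add: exp_def)
qed

lemma evalMX_Phi_bounded: "evalMX \<mu> X (Phi r) \<le> (\<Sum>j\<in>UNIV. exp ((X $ j)\<^sup>2))"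
proof -
  have "evalMX \<mu> X (Phi r) = (\<Sum>j\<in>UNIV. \<Sum>k\<in>{0..r}. ((X $ j)\<^sup>2) ^ k / fact k)"
    by (simp add: evalMX_eq Phi_def pconst_mult power_mult)
  also have "\<dots> \<le> (\<Sum>j\<in>UNIV. exp ((X $ j)\<^sup>2))"
    by (intro sum_mono sum_power_div_fact_le_exp) auto
  finally show ?thesis .
qed

text \<open>All points of \<open>Y\<close> have squared coordinates at most \<rho>, so
  \<open>xmoment j k\<close> is at most \<open>\<rho> ^ k\<close>. With
  \<open>b k = \<rho> ^ k / fact k\<close> the terms of \<open>Psi r\<close> are dominated by
  \<open>b k ^ l / fact l\<close>, a summable double family.\<close>

lemma evalMX_Psi_bounded:
  fixes Y :: "(real ^ 'n::finite) set"
  assumes Y: "finite Y" "\<And>y. 0 \<le> w y" "sum w Y = 1"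
  obtains C where "\<And>r X. evalMX (atomic_measure Y w) X (Psi r) \<le> C"
proof -
  let ?\<mu> = "atomic_measure Y w"
  define \<rho> where "\<rho> = (\<Sum>y\<in>Y. (norm y)\<^sup>2)"
  have \<rho>: "(y $ j)\<^sup>2 \<le> \<rho>" if "y \<in> Y" for y j
  proof -
    have "(y $ j)\<^sup>2 \<le> (norm y)\<^sup>2"
      using power_mono[OF component_le_norm_cart[of y j], of 2] by simp
    also have "\<dots> \<le> \<rho>" unfolding \<rho>_def using that Y(1) by (intro member_le_sum) auto
    finally show ?thesis .
  qed
  have \<rho>0: "0 \<le> \<rho>" unfolding \<rho>_def by (intro sum_nonneg) auto
  define b where "b k = \<rho> ^ k / fact k" for k
  have b: "0 \<le> b k" "b k \<le> exp \<rho>" for k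
    using sum_power_div_fact_le_exp[OF \<rho>0, of "{k}"] \<rho>0 by (auto simp: b_def)
  have mom: "0 \<le> evalMX ?\<mu> X (xmoment j k)" "evalMX ?\<mu> X (xmoment j k) \<le> \<rho> ^ k" for X j k
  proof -
    have P: "?\<mu> \<in> Pmeas UNIV" using Y by (intro atomic_measure_Pmeas) auto
    have e: "evalMX ?\<mu> X (xmoment j k) = (\<Sum>y\<in>Y. w y * ((y $ j)\<^sup>2) ^ k)"
      unfolding evalMX_mmap[OF P]
      by (subst integral_atomic_measure[OF Y])
        (auto simp: evalMX_eq power_mult intro!: borel_measurable_continuous_onI continuous_intros)
    show "0 \<le> evalMX ?\<mu> X (xmoment j k)" unfolding e using Y(2) by (intro sum_nonneg) auto
    have "(\<Sum>y\<in>Y. w y * ((y $ j)\<^sup>2) ^ k) \<le> (\<Sum>y\<in>Y. w y * \<rho> ^ k)"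
      using Y(2) \<rho> by (intro sum_mono mult_left_mono power_mono) auto
    then show "evalMX ?\<mu> X (xmoment j k) \<le> \<rho> ^ k" unfolding e using Y(3) by (simp flip: sum_distrib_right)
  qed
  \<comment> \<open>As \<open>l\<close> starts at 1, a factor \<open>b k\<close> splits off, and it
    makes the sum over \<open>k\<close> converge.\<close>
  have inner: "(\<Sum>l\<in>{1..r}. b k ^ l / fact l) \<le> b k * exp (exp \<rho>)" for k r
  proof -
    have "(\<Sum>l\<in>{1..r}. b k ^ l / fact l) = (\<Sum>l\<in>{0..<r}. b k ^ Suc l / fact (Suc l))"
      using sum.shift_bounds_Suc_ivl[of "\<lambda>l. b k ^ l / fact l" 0 r] by (simp add: atLeastLessThanSuc_atLeastAtMost)
    also have "\<dots> \<le> (\<Sum>l\<in>{0..<r}. b k * (b k ^ l / fact l))"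
    proof (rule sum_mono)
      fix l
      have "(fact l :: real) \<le> fact (Suc l)" by (rule fact_mono) simp
      then show "b k ^ Suc l / fact (Suc l) \<le> b k * (b k ^ l / fact l)"
        using b(1)[of k] by (simp add: divide_left_mono del: fact_Suc)
    qed
    also have "\<dots> = b k * (\<Sum>l\<in>{0..<r}. b k ^ l / fact l)" by (simp add: sum_distrib_left)
    also have "\<dots> \<le> b k * exp (exp \<rho>)"
    proof (rule mult_left_mono[OF _ b(1)])
      have "(\<Sum>l\<in>{0..<r}. b k ^ l / fact l) \<le> exp (b k)" by (intro sum_power_div_fact_le_exp b) auto
      also have "\<dots> \<le> exp (exp \<rho>)" using b(2) by simp
      finally show "(\<Sum>l\<in>{0..<r}. b k ^ l / fact l) \<le> exp (exp \<rho>)" .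
    qed
    finally show ?thesis .
  qed
  have "evalMX ?\<mu> X (Psi r) \<le> real CARD('n) * (exp \<rho> * exp (exp \<rho>))" for r X
  proof -
    let ?I = "{(k, l). 1 \<le> k \<and> 1 \<le> l \<and> k * l \<le> r}"
    have "evalMX ?\<mu> X (Psi r)
        = (\<Sum>j\<in>UNIV. \<Sum>(k, l)\<in>?I. evalMX ?\<mu> X (xmoment j k) ^ l / (fact k ^ l * fact l))"
      by (simp add: evalMX_eq Psi_eq split_def)
    also have "\<dots> \<le> (\<Sum>j\<in>(UNIV :: 'n set). exp \<rho> * exp (exp \<rho>))"
    proof (rule sum_mono)
      fix j :: 'n
      have "(\<Sum>(k, l)\<in>?I. evalMX ?\<mu> X (xmoment j k) ^ l / (fact k ^ l * fact l)) \<le> (\<Sum>(k, l)\<in>?I. b k ^ l / fact l)"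
      proof (rule sum_mono)
        fix z assume "z \<in> ?I"
        obtain k l where z: "z = (k, l)" by fastforce
        have "evalMX ?\<mu> X (xmoment j k) ^ l \<le> (\<rho> ^ k) ^ l" using mom by (intro power_mono)
        then have "evalMX ?\<mu> X (xmoment j k) ^ l / (fact k ^ l * fact l) \<le> (\<rho> ^ k) ^ l / (fact k ^ l * fact l)"
          by (intro divide_right_mono) auto
        then show "(case z of (k, l) \<Rightarrow> evalMX ?\<mu> X (xmoment j k) ^ l / (fact k ^ l * fact l)) \<le> (case z of (k, l) \<Rightarrow> b k ^ l / fact l)"
          by (simp add: z b_def power_divide)
      qed
      also have "\<dots> \<le> (\<Sum>(k, l)\<in>{1..r} \<times> {1..r}. b k ^ l / fact l)"
        using b(1) by (intro sum_mono2 Psi_index_subset) auto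
      also have "\<dots> = (\<Sum>k\<in>{1..r}. \<Sum>l\<in>{1..r}. b k ^ l / fact l)" by (simp add: sum.cartesian_product)
      also have "\<dots> \<le> (\<Sum>k\<in>{1..r}. b k * exp (exp \<rho>))" by (intro sum_mono inner)
      also have "\<dots> = (\<Sum>k\<in>{1..r}. b k) * exp (exp \<rho>)" by (simp add: sum_distrib_right)
      also have "\<dots> \<le> exp \<rho> * exp (exp \<rho>)"
        unfolding b_def by (intro mult_right_mono sum_power_div_fact_le_exp \<rho>0) auto
      finally show "(\<Sum>(k, l)\<in>?I. evalMX ?\<mu> X (xmoment j k) ^ l / (fact k ^ l * fact l)) \<le> exp \<rho> * exp (exp \<rho>)" .
    qed
    finally show ?thesis by simp
  qed
  then show ?thesis by (rule that)
qed

text \<open>A general \<open>\<mu>\<close> may have moments growing so fast that \<open>Psi r\<close> is unbounded at \<open>\<mu>\<close>; it is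
  replaced by a finitely supported measure with the same values at \<open>f\<close> and at the finitely many
  constraints \<open>S2\<close>.\<close>
lemma evalMX_nonneg_if_perturbed:
  fixes S1 S2 T :: "'n::finite mpoly set"
  assumes S1: "\<And>s. s \<in> S1 \<Longrightarrow> inRx s" and S2: "finite S2" "\<And>s. s \<in> S2 \<Longrightarrow> inM s"
    and T: "\<And>s. s \<in> T \<Longrightarrow> inRx s"
    and \<mu>: "\<mu> \<in> KK S1 S2" and X: "X \<in> Kset T"
    and pert: "\<And>\<epsilon>. \<epsilon> > 0 \<Longrightarrow> \<exists>r. f + \<epsilon> *\<^sub>R (h r + Psi r) \<in> qmod A (T \<union> mgens S1 \<union> S2)"
    and h: "\<And>\<nu> r. evalMX \<nu> X (h r) \<le> B"
  shows "0 \<le> evalMX \<mu> X f"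
proof -
  let ?\<tau> = "\<lambda>a. moment \<mu> (idx a)"
  have P: "\<mu> \<in> Pmeas (Kset S1)" using \<mu> by (simp add: KK_def)
  interpret prob_space \<mu> using P by (simp add: Pmeas_def)
  have AE: "AE y in \<mu>. y \<in> Kset S1" by (rule Pmeas_AE[OF P closed_Kset])
  obtain Y w where Y: "finite Y" "\<And>y. 0 \<le> w y" "sum w Y = 1" and KK: "atomic_measure Y w \<in> KK S1 S2"
    and eq: "\<And>X. evalMX (atomic_measure Y w) X f = point_eval ?\<tau> X f"
  proof (rule atomic_measure_representation[OF S2 linear_integral_point_eval[OF P, of ?\<tau>],
        where f = f and X = X and ?S1.0 = S1 and \<tau> = ?\<tau>])
    show "(\<integral>y. point_eval ?\<tau> y 1 \<partial>\<mu>) = 1" by (simp add: prob_space)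
    show "0 \<le> (\<integral>y. point_eval ?\<tau> y p \<partial>\<mu>)" if "\<And>y. y \<in> Kset S1 \<Longrightarrow> 0 \<le> point_eval ?\<tau> y p" for p
      using AE that by (intro integral_nonneg_AE) auto
    show "(\<integral>y. point_eval ?\<tau> y (xmonomial (idx a)) \<partial>\<mu>) = moment \<mu> (idx a)" for a
      by (rule moment_eq[symmetric])
    show "0 \<le> point_eval ?\<tau> X s" if "s \<in> S2" for s
      using \<mu> that point_eval_inM[OF S2(2)[OF that], of ?\<tau> 0 X] by (auto simp: KK_def evalM_def evalMX_eq)
  qed auto
  let ?\<nu> = "atomic_measure Y w"
  obtain C where C: "\<And>r X. evalMX ?\<nu> X (Psi r) \<le> C" using evalMX_Psi_bounded[OF Y] by blast
  have "0 \<le> evalMX ?\<nu> X f"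
  proof (rule real_ge_0_if_perturbed)
    fix \<epsilon> :: real assume \<epsilon>: "\<epsilon> > 0"
    then obtain r where "f + \<epsilon> *\<^sub>R (h r + Psi r) \<in> qmod A (T \<union> mgens S1 \<union> S2)" using pert by blast
    from evalMX_qmod_nonneg[OF S1 S2(2) T KK X this]
    have "0 \<le> evalMX ?\<nu> X f + \<epsilon> * (evalMX ?\<nu> X (h r) + evalMX ?\<nu> X (Psi r))"
      by (simp add: evalMX_eq)
    also have "\<dots> \<le> evalMX ?\<nu> X f + \<epsilon> * (B + C)"
      using \<epsilon> h C by (intro add_left_mono mult_left_mono add_mono) auto
    finally show "0 \<le> evalMX ?\<nu> X f + \<epsilon> * (B + C)" .
  qed
  then show ?thesis using eq[of X] by (simp only: evalMX_eq[of \<mu> X])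
qed

lemma perturbation_mem_if_nonneg:
  fixes S1 S2 T :: "'n::finite mpoly set"
  assumes S1: "\<And>s. s \<in> S1 \<Longrightarrow> inRx s" and S2: "finite S2" "\<And>s. s \<in> S2 \<Longrightarrow> inM s"
    and T: "\<And>s. s \<in> T \<Longrightarrow> inRx s" and \<epsilon>: "\<epsilon> > 0"
    and f: "\<And>\<mu> X. \<mu> \<in> KK S1 S2 \<Longrightarrow> X \<in> Kset T \<Longrightarrow> 0 \<le> evalMX \<mu> X f"
  shows "\<exists>r\<ge>1. f + \<epsilon> *\<^sub>R (Phi r + Psi r) \<in> qmod UNIV (T \<union> mgens S1 \<union> S2)"
proof (rule perturbation_mem_if_representable[OF S1 T \<epsilon>])
  fix \<tau> X and l :: "'n mpoly \<Rightarrow> real"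
  assume "linear l" "l 1 = 1" "\<And>p. (\<And>y. y \<in> Kset S1 \<Longrightarrow> 0 \<le> point_eval \<tau> y p) \<Longrightarrow> 0 \<le> l p"
    "\<And>a. l (xmonomial (idx a)) = \<tau> a" "\<And>s. s \<in> S2 \<Longrightarrow> 0 \<le> point_eval \<tau> X s" and X: "X \<in> Kset T"
  from atomic_measure_representation[OF S2 this(1-5)]
  obtain Y w where "atomic_measure Y w \<in> KK S1 S2" "\<And>X. evalMX (atomic_measure Y w) X f = point_eval \<tau> X f"
    by metis
  then show "0 \<le> point_eval \<tau> X f" using f[OF _ X] by metis
qed

text \<open>\<open>forget_x\<close> is a ring homomorphism that sends both signs of
  \<open>pvar (Xv j)\<close> to 0, fixes \<open>G\<close>, and turns arbitrary multipliers into
  polynomials in the moment variables, as \<open>qm\<close> demands.\<close>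

lemma forget_x_qmod:
  assumes G: "\<And>g. g \<in> G \<Longrightarrow> inM g" and q: "q \<in> qmod UNIV (range (\<lambda>j. pvar (Xv j)) \<union> range (\<lambda>j. - pvar (Xv j)) \<union> G)"
  shows "forget_x q \<in> qmod {p. inM p} G"
  using q
proof induction
  case (gen g)
  have "0\<^sup>2 * 1 \<in> qmod {p. inM p} G" by (intro qmod.sq qmod.one) simp
  moreover have "forget_x g = 0 \<or> g \<in> G"
    using gen by (auto simp: forget_x_def psubst_neg)
  ultimately show ?case using forget_x_inM[OF G, of g] by (auto intro: qmod.gen)
next
  case (sq a x)
  have "forget_x (a\<^sup>2 * x) = (forget_x a)\<^sup>2 * forget_x x"
    by (simp add: forget_x_def psubst_mult psubst_power)
  moreover have "(forget_x a)\<^sup>2 * forget_x x \<in> qmod {p. inM p} G"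
    using sq.IH by (intro qmod.sq) (auto intro: inM_forget_x)
  ultimately show ?case by simp
qed (simp_all add: forget_x_def psubst_add qmod.one qmod.add)

text \<open>Each \<open>j\<close> keeps its constant term \<open>k = 0\<close>, since
  \<open>0 ^ 0 = 1\<close>.\<close>

lemma forget_x_Phi: "forget_x (Phi r :: 'n::finite mpoly) = of_nat CARD('n)"
proof -
  have "forget_x (Phi r :: 'n mpoly) = (\<Sum>j\<in>(UNIV :: 'n set). \<Sum>k\<in>{0..r}. (1 / fact k) *\<^sub>R 0 ^ (2 * k))"
    by (simp add: forget_x_def Phi_def pconst_mult psubst_sum psubst_scaleR psubst_power)
  also have "\<dots> = (\<Sum>j\<in>(UNIV :: 'n set). 1)"
    by (intro sum.cong refl) (simp add: sum.atLeast_Suc_atMost power_0_left)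
  finally show ?thesis by simp
qed

lemma inM_Psi: "inM (Psi r)"
proof -
  have sum: "inM (sum g I)" if "\<And>i. i \<in> I \<Longrightarrow> inM (g i)" for g :: "'i \<Rightarrow> 'a mpoly" and I
    using that by (induction I rule: infinite_finite_induct) (auto intro: inM_add)
  have pow: "inM (p ^ k)" if "inM p" for p :: "'a mpoly" and k
    using that by (induction k) (auto intro: inM_mult)
  show ?thesis unfolding Psi_def by (intro sum) (auto intro!: sum inM_mult inM_pconst pow inM_mmap)
qed

lemma inM_mgens: "g \<in> mgens S \<Longrightarrow> inM g"
  by (auto simp: mgens_def inM_mmap)

theorem theorem6p9:
  fixes S1 S2 :: "'n::finite mpoly set"
  assumes "\<forall>p\<in>S1. inRx p"
    and "\<forall>s\<in>S2. inM s"
    and "finite S2"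
  shows "(\<forall>f :: 'n mpoly.
            (\<forall>\<mu>\<in>KK S1 S2. \<forall>X\<in>Kset S1. evalMX \<mu> X f \<ge> 0) \<longleftrightarrow>
            (\<forall>\<epsilon>>0. \<exists>r\<ge>1. f + pconst \<epsilon> * (Phi r + Psi r) \<in> QM S1 S2))
       \<and> (\<forall>f :: 'n mpoly. inM f \<longrightarrow>
            ((\<forall>\<mu>\<in>KK S1 S2. evalM \<mu> f \<ge> 0) \<longleftrightarrow>
             (\<forall>\<epsilon>>0. \<exists>r\<ge>1. f + pconst \<epsilon> * (1 + Psi r) \<in> qm S1 S2)))"
proof -
  have S1: "\<And>s. s \<in> S1 \<Longrightarrow> inRx s" and S2: "finite S2" "\<And>s. s \<in> S2 \<Longrightarrow> inM s"
    using assms by auto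
  have part1: "(\<forall>\<mu>\<in>KK S1 S2. \<forall>X\<in>Kset S1. evalMX \<mu> X f \<ge> 0) \<longleftrightarrow>
      (\<forall>\<epsilon>>0. \<exists>r\<ge>1. f + pconst \<epsilon> * (Phi r + Psi r) \<in> QM S1 S2)" for f
  proof (intro iffI ballI allI impI)
    fix \<epsilon> :: real
    assume f: "\<forall>\<mu>\<in>KK S1 S2. \<forall>X\<in>Kset S1. evalMX \<mu> X f \<ge> 0" and \<epsilon>: "\<epsilon> > 0"
    show "\<exists>r\<ge>1. f + pconst \<epsilon> * (Phi r + Psi r) \<in> QM S1 S2"
      unfolding QM_def pconst_mult using f by (intro perturbation_mem_if_nonneg S1 S2 \<epsilon>) auto
  next
    fix \<mu> X
    assume pert: "\<forall>\<epsilon>>0. \<exists>r\<ge>1. f + pconst \<epsilon> * (Phi r + Psi r) \<in> QM S1 S2"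
      and \<mu>: "\<mu> \<in> KK S1 S2" and X: "X \<in> Kset S1"
    show "0 \<le> evalMX \<mu> X f"
      using pert by (intro evalMX_nonneg_if_perturbed[OF S1 S2 S1 \<mu> X _ evalMX_Phi_bounded])
        (auto simp: QM_def pconst_mult)
  qed
  have part2: "(\<forall>\<mu>\<in>KK S1 S2. evalM \<mu> f \<ge> 0) \<longleftrightarrow>
      (\<forall>\<epsilon>>0. \<exists>r\<ge>1. f + pconst \<epsilon> * (1 + Psi r) \<in> qm S1 S2)" if fM: "inM f" for f
  proof (intro iffI ballI allI impI)
    fix \<epsilon> :: real
    assume f: "\<forall>\<mu>\<in>KK S1 S2. evalM \<mu> f \<ge> 0" and \<epsilon>: "\<epsilon> > 0"
    let ?T = "range (\<lambda>j. pvar (Xv j)) \<union> range (\<lambda>j. - pvar (Xv j)) :: 'n mpoly set"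
    let ?Q = "qmod UNIV (?T \<union> mgens S1 \<union> S2)"
    let ?n = "real CARD('n)"
    interpret moment_quadratic_module ?Q
    proof (intro moment_quadratic_module.intro quadratic_module_qmod moment_quadratic_module_axioms.intro)
      show "mmap (h\<^sup>2) \<in> ?Q" for h :: "'n mpoly"
      proof -
        have "mmap (h\<^sup>2 * 1) \<in> mgens S1" unfolding mgens_def by blast
        then show ?thesis by (auto intro: qmod.gen)
      qed
    qed
    have n: "?n \<ge> 1" by (simp add: Suc_le_eq)
    have T: "inRx s" if "s \<in> ?T" for s
      using that by (auto simp: inRx_def pvar_def lookup_single)
    have "0 \<le> evalMX \<mu> X f" if "\<mu> \<in> KK S1 S2" for \<mu> X
      using f that point_eval_inM[OF fM, of _ 0 X] by (auto simp: evalM_def evalMX_eq)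
    \<comment> \<open>Dividing by \<open>?n\<close> anticipates that \<open>forget_x\<close> turns
      \<open>Phi r\<close> into \<open>?n\<close>.\<close>
    then have "\<exists>r\<ge>1. f + (\<epsilon> / ?n) *\<^sub>R (Phi r + Psi r) \<in> ?Q"
      using \<epsilon> n by (intro perturbation_mem_if_nonneg S1 S2 T) auto
    then obtain r where r: "r \<ge> 1" "f + (\<epsilon> / ?n) *\<^sub>R (Phi r + Psi r) \<in> ?Q" by blast
    \<comment> \<open>\<open>Psi r\<close> lies in the module, so its coefficient can be raised back
      to \<epsilon>.\<close>
    have "(\<epsilon> - \<epsilon> / ?n) *\<^sub>R Psi r \<in> ?Q"
      using \<epsilon> n by (intro scaleR_mem Psi_mem) (simp add: field_simps)
    from add_mem[OF r(2) this] have "f + (\<epsilon> / ?n) *\<^sub>R Phi r + \<epsilon> *\<^sub>R Psi r \<in> ?Q"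
      by (simp add: algebra_simps)
    then have "forget_x (f + (\<epsilon> / ?n) *\<^sub>R Phi r + \<epsilon> *\<^sub>R Psi r) \<in> qmod {p. inM p} (mgens S1 \<union> S2)"
      using S2 inM_mgens by (intro forget_x_qmod) (auto simp: Un_assoc)
    also have "forget_x (f + (\<epsilon> / ?n) *\<^sub>R Phi r + \<epsilon> *\<^sub>R Psi r)
        = forget_x f + (\<epsilon> / ?n) *\<^sub>R forget_x (Phi r) + \<epsilon> *\<^sub>R forget_x (Psi r)"
      by (simp add: forget_x_def psubst_add psubst_scaleR)
    also have "\<dots> = f + \<epsilon> *\<^sub>R (1 + Psi r)"
    proof -
      have "(of_nat CARD('n) :: 'n mpoly) = ?n *\<^sub>R 1" by (simp add: scaleR_conv_of_real)
      then have "(\<epsilon> / ?n) *\<^sub>R forget_x (Phi r :: 'n mpoly) = \<epsilon> *\<^sub>R 1"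
        using n by (simp only: forget_x_Phi scaleR_scaleR) simp
      then show ?thesis by (simp add: forget_x_inM fM inM_Psi scaleR_add_right)
    qed
    finally show "\<exists>r\<ge>1. f + pconst \<epsilon> * (1 + Psi r) \<in> qm S1 S2"
      using r(1) unfolding qm_def pconst_mult by blast
  next
    fix \<mu>
    assume pert: "\<forall>\<epsilon>>0. \<exists>r\<ge>1. f + pconst \<epsilon> * (1 + Psi r) \<in> qm S1 S2" and \<mu>: "\<mu> \<in> KK S1 S2"
    \<comment> \<open>The point is unconstrained and set to 0, and the constant 1 takes the place of
      \<open>Phi r\<close> in the perturbation.\<close>
    have "0 \<le> evalMX \<mu> 0 f"
    proof (rule evalMX_nonneg_if_perturbed[OF S1 S2 _ \<mu>])
      show "0 \<in> Kset ({} :: 'n mpoly set)" by (simp add: Kset_def)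
      show "\<exists>r. f + \<epsilon> *\<^sub>R ((\<lambda>_. 1) r + Psi r) \<in> qmod {p. inM p} ({} \<union> mgens S1 \<union> S2)" if "\<epsilon> > 0" for \<epsilon>
        using pert that by (auto simp: qm_def pconst_mult)
      show "evalMX \<nu> 0 1 \<le> 1" for \<nu> :: "(real ^ 'n) measure" by (simp add: evalMX_eq)
    qed auto
    then show "0 \<le> evalM \<mu> f" by (simp add: evalM_def)
  qed
  show ?thesis using part1 part2 by blast
qed

end
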